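(* For two reclaimers with given stockpile positions, the optimal makespan of a preemptive schedule equals $K^*=\min\{K_i: i=0,1,\dots,r\}$, and an optimal preemptive schedule can be computed in linear time (in the number of stockpiles).
   Context: Reclaimer scheduling model. Two pads $P_1,P_2$ are each modeled as $[0,L]$, $L$ a positive integer. Stockpiles $1,\dots,n_1$ lie on $P_1$ and $n_1+1,\dots,n$ on $P_2$; stockpile $j$ occupies $[l_j,r_j]\subseteq[0,L]$ with integers $l_j<r_j$, and on each pad the stockpiles are non-overlapping and indexed from left to right. Reclaimers $R_0,R_1$ move on a rail represented by $[0,L]$; $R_0$ starts and ends at $0$, $R_1$ starts and ends at $L$. Reclaim speed is $1$, travel speed $s\ge1$. A schedule of $R_k$ with makespan $C_k$ is a continuous piecewise linear $H_k:[0,C_k]\to[0,L]$, $H_k(0)=H_k(C_k)=kL$ (extended by $kL$ after $C_k$), whose pieces have slope $0$, $\pm s$ (travel) or $\pm1$ (reclaiming on a designated one of the two pads). Feasibility requires $H_0(t)\le H_1(t)$ for all $t$. In a preemptive schedule stockpiles may be split: it suffices that for each pad $P_i$, every point of $S_i$ is covered by the position range of some reclaiming piece (slope $\pm1$) of either reclaimer designated to pad $P_i$; the objective is $\max(C_0,C_1)$. Notation: $S_1=\bigcup_{j=1}^{n_1}[l_j,r_j]$, $S_2=\bigcup_{j=n_1+1}^{n}[l_j,r_j]$, $Q_1=S_1\triangle S_2$, $Q_2=S_1\cap S_2$, $E=[0,L]\setminus(S_1\cup S_2)$; $\ell(X)$ is the total length of $X$. Let $[a_1,b_1],\dots,[a_r,b_r]$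 be the closures of the connected components of $E$. Define $K_0=\frac12\left[2\ell(Q_2)+\ell(Q_1)+\ell(Q_1)/s+2\ell(E)/s\right]$ and, for $i=1,\dots,r$, $K_i=\max\Big\{2\ell(Q_2^-)+\ell(Q_1^-)+\frac{\ell(Q_1^-)}{s}+\frac{2\ell(E^-)}{s},\ 2\ell(Q_2^+)+\ell(Q_1^+)+\frac{\ell(Q_1^+)}{s}+\frac{2\ell(E^+)}{s}\Big\}$, where $Q_2^-=Q_2\cap[0,a_i]$, $Q_2^+=Q_2\cap[b_i,L]$, and similarly $Q_1^\pm$, $E^\pm$. *)

theory Defs
  imports "HOL-Analysis.Analysis"
begin

datatype pad = P1 | P2

text \<open>
  Stockpiles are numbered \<open>1..num\<close>; those up to \<open>num1\<close> lie on \<open>P1\<close>, the others on \<open>P2\<close>.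
  The values of \<open>left\<close> and \<open>right\<close> at other indices are irrelevant.
\<close>

record instance_data =
  rail :: int
  speed :: real
  num1 :: nat
  num :: nat
  left :: "nat \<Rightarrow> int"
  right :: "nat \<Rightarrow> int"

definition valid_instance :: "instance_data \<Rightarrow> bool" where
  "valid_instance I \<longleftrightarrow>
     rail I > 0 \<and> speed I \<ge> 1 \<and> num1 I \<le> num I \<and>
     (\<forall>j\<in>{1..num I}. 0 \<le> left I j \<and> left I j < right I j \<and> right I j \<le> rail I) \<and>
     (\<forall>i j. 1 \<le> i \<and> i < j \<and> j \<le> num1 I \<longrightarrow> right I i \<le> left I j) \<and>
     (\<forall>i j. num1 I + 1 \<le> i \<and> i < j \<and> j \<le> num I \<longrightarrow> right I i \<le> left I j)"

fun stockpiles :: "instance_data \<Rightarrow> pad \<Rightarrow> nat set" where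
  "stockpiles I P1 = {1..num1 I}"
| "stockpiles I P2 = {num1 I + 1..num I}"

definition stock :: "instance_data \<Rightarrow> pad \<Rightarrow> real set" where
  "stock I p = (\<Union>j\<in>stockpiles I p. {of_int (left I j)..of_int (right I j)})"

datatype direction = Rightward | Leftward

datatype action = Wait | Travel direction | Reclaim pad direction

fun sign :: "direction \<Rightarrow> real" where
  "sign Rightward = 1"
| "sign Leftward = -1"

fun slope :: "real \<Rightarrow> action \<Rightarrow> real" where
  "slope s Wait = 0"
| "slope s (Travel d) = sign d * s"
| "slope s (Reclaim p d) = sign d"

text \<open>
  The movement of one reclaimer. The \<open>j\<close>-th linear piece lives on the time interval
  \<open>[breaks ! j, breaks ! (j + 1)]\<close> and carries the label \<open>actions ! j\<close>; the label is needed to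
  know the designated pad, and to tell travelling from reclaiming if the travel speed is 1.
\<close>

record schedule =
  finish :: real
  pos :: "real \<Rightarrow> real"
  breaks :: "real list"
  actions :: "action list"

abbreviation piece :: "schedule \<Rightarrow> nat \<Rightarrow> real set" where
  "piece H j \<equiv> {breaks H ! j..breaks H ! (j + 1)}"

definition schedule_of :: "instance_data \<Rightarrow> nat \<Rightarrow> schedule \<Rightarrow> bool" where
  "schedule_of I k H \<longleftrightarrow>
     finish H \<ge> 0 \<and>
     continuous_on {0..finish H} (pos H) \<and>
     pos H ` {0..finish H} \<subseteq> {0..of_int (rail I)} \<and>
     pos H 0 = of_nat k * of_int (rail I) \<and>
     (\<forall>t\<ge>finish H. pos H t = of_nat k * of_int (rail I)) \<and>
     length (breaks H) = length (actions H) + 1 \<and>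
     breaks H ! 0 = 0 \<and> breaks H ! length (actions H) = finish H \<and>
     (\<forall>j<length (actions H).
        breaks H ! j < breaks H ! (j + 1) \<and>
        (\<forall>t\<in>piece H j.
           pos H t = pos H (breaks H ! j) + slope (speed I) (actions H ! j) * (t - breaks H ! j)))"

definition reclaims :: "schedule \<Rightarrow> pad \<Rightarrow> real \<Rightarrow> bool" where
  "reclaims H p x \<longleftrightarrow>
     (\<exists>j<length (actions H). (\<exists>d. actions H ! j = Reclaim p d) \<and> x \<in> pos H ` piece H j)"

fun preemptive_schedule :: "instance_data \<Rightarrow> schedule \<times> schedule \<Rightarrow> bool" where
  "preemptive_schedule I (H0, H1) \<longleftrightarrow>
     schedule_of I 0 H0 \<and> schedule_of I 1 H1 \<and>
     (\<forall>t\<ge>0. pos H0 t \<le> pos H1 t) \<and>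
     (\<forall>p. \<forall>x\<in>stock I p. reclaims H0 p x \<or> reclaims H1 p x)"

fun makespan :: "schedule \<times> schedule \<Rightarrow> real" where
  "makespan (H0, H1) = max (finish H0) (finish H1)"

definition optimal :: "instance_data \<Rightarrow> schedule \<times> schedule \<Rightarrow> bool" where
  "optimal I H \<longleftrightarrow> is_arg_min makespan (preemptive_schedule I) H"

definition Q1 :: "instance_data \<Rightarrow> real set" where
  "Q1 I = sym_diff (stock I P1) (stock I P2)"

definition Q2 :: "instance_data \<Rightarrow> real set" where
  "Q2 I = stock I P1 \<inter> stock I P2"

definition empty_part :: "instance_data \<Rightarrow> real set" where
  "empty_part I = {0..of_int (rail I)} - (stock I P1 \<union> stock I P2)"

text \<open>The common bracket of \<open>K\<^sub>0\<close> (for \<open>X = [0, L]\<close>) and \<open>K\<^sub>i\<close> (for \<open>X = [0, a\<^sub>i]\<close> and \<open>X = [b\<^sub>i, L]\<close>).\<close>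

definition work :: "instance_data \<Rightarrow> real set \<Rightarrow> real" where
  "work I X =
     2 * measure lebesgue (Q2 I \<inter> X) + measure lebesgue (Q1 I \<inter> X)
     + measure lebesgue (Q1 I \<inter> X) / speed I + 2 * measure lebesgue (empty_part I \<inter> X) / speed I"

text \<open>The pairs \<open>(a\<^sub>i, b\<^sub>i)\<close>; components are nonempty, so these satisfy \<open>a\<^sub>i \<le> b\<^sub>i\<close>.\<close>

definition gaps :: "instance_data \<Rightarrow> (real \<times> real) set" where
  "gaps I = {(a, b). {a..b} \<in> closure ` components (empty_part I)}"

definition K0 :: "instance_data \<Rightarrow> real" where
  "K0 I = 1 / 2 * work I {0..of_int (rail I)}"

fun K_gap :: "instance_data \<Rightarrow> real \<times> real \<Rightarrow> real" where
  "K_gap I (a, b) = max (work I {0..a}) (work I {b..of_int (rail I)})"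

definition K_star :: "instance_data \<Rightarrow> real" where
  "K_star I = Min (insert (K0 I) (K_gap I ` gaps I))"

text \<open>
  Computation is modelled by while programs on a unit-cost real RAM. Registers hold natural
  numbers, arrays hold real numbers; a real variable is an array cell with index 0. There is no
  rounding and no other way to turn a real number into an index. Every assignment and every
  evaluation of a branching condition costs one step. Since the expressions of a fixed program
  have bounded size, charging for each arithmetic operation separately would change running
  times only by a constant factor.
\<close>

record state =
  reg :: "string \<Rightarrow> nat"
  arr :: "string \<Rightarrow> nat \<Rightarrow> real"

datatype iexp = INum nat | Reg string | IPlus iexp iexp | IMinus iexp iexp

datatype rexp = RNum int | Arr string iexp
  | RPlus rexp rexp | RMinus rexp rexp | RTimes rexp rexp | RDivide rexp rexp

datatype bexp = ILess iexp iexp | RLess rexp rexp | Neg bexp | Conj bexp bexp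

datatype com = Skip | SetReg string iexp | SetArr string iexp rexp
  | Seq com com | If bexp com com | While bexp com

fun ival :: "iexp \<Rightarrow> state \<Rightarrow> nat" where
  "ival (INum n) st = n"
| "ival (Reg x) st = reg st x"
| "ival (IPlus e f) st = ival e st + ival f st"
| "ival (IMinus e f) st = ival e st - ival f st"

fun rval :: "rexp \<Rightarrow> state \<Rightarrow> real" where
  "rval (RNum z) st = of_int z"
| "rval (Arr a e) st = arr st a (ival e st)"
| "rval (RPlus e f) st = rval e st + rval f st"
| "rval (RMinus e f) st = rval e st - rval f st"
| "rval (RTimes e f) st = rval e st * rval f st"
| "rval (RDivide e f) st = rval e st / rval f st"

fun bval :: "bexp \<Rightarrow> state \<Rightarrow> bool" where
  "bval (ILess e f) st \<longleftrightarrow> ival e st < ival f st"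
| "bval (RLess e f) st \<longleftrightarrow> rval e st < rval f st"
| "bval (Neg b) st \<longleftrightarrow> \<not> bval b st"
| "bval (Conj b c) st \<longleftrightarrow> bval b st \<and> bval c st"

text \<open>\<open>run c st t st'\<close>: started in \<open>st\<close>, program \<open>c\<close> halts in \<open>st'\<close> after \<open>t\<close> steps.\<close>

inductive run :: "com \<Rightarrow> state \<Rightarrow> nat \<Rightarrow> state \<Rightarrow> bool" where
  run_Skip: "run Skip st 1 st"
| run_SetReg: "run (SetReg x e) st 1 (st\<lparr>reg := (reg st)(x := ival e st)\<rparr>)"
| run_SetArr:
    "run (SetArr a e f) st 1
       (st\<lparr>arr := (arr st)(a := (arr st a)(ival e st := rval f st))\<rparr>)"
| run_Seq: "run c st t st' \<Longrightarrow> run d st' u st'' \<Longrightarrow> run (Seq c d) st (t + u) st''"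
| run_IfTrue: "bval b st \<Longrightarrow> run c st t st' \<Longrightarrow> run (If b c d) st (t + 1) st'"
| run_IfFalse: "\<not> bval b st \<Longrightarrow> run d st t st' \<Longrightarrow> run (If b c d) st (t + 1) st'"
| run_WhileFalse: "\<not> bval b st \<Longrightarrow> run (While b c) st 1 st"
| run_WhileTrue:
    "bval b st \<Longrightarrow> run c st t st' \<Longrightarrow> run (While b c) st' u st'' \<Longrightarrow>
     run (While b c) st (t + u + 1) st''"

definition input_state :: "instance_data \<Rightarrow> state" where
  "input_state I = \<lparr>
     reg = (\<lambda>_. 0)(''n1'' := num1 I, ''n'' := num I),
     arr = (\<lambda>_ _. 0)(
       ''L'' := (\<lambda>_. 0)(0 := of_int (rail I)),
       ''s'' := (\<lambda>_. 0)(0 := speed I),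
       ''l'' := (\<lambda>j. if j \<in> {1..num I} then of_int (left I j) else 0),
       ''r'' := (\<lambda>j. if j \<in> {1..num I} then of_int (right I j) else 0))\<rparr>"

fun action_code :: "action \<Rightarrow> real" where
  "action_code Wait = 0"
| "action_code (Travel Rightward) = 1"
| "action_code (Travel Leftward) = 2"
| "action_code (Reclaim P1 Rightward) = 3"
| "action_code (Reclaim P1 Leftward) = 4"
| "action_code (Reclaim P2 Rightward) = 5"
| "action_code (Reclaim P2 Leftward) = 6"

text \<open>
  A movement is output as its number of pieces together with the breakpoints, the positions at
  the breakpoints, and the labels of the pieces. This determines it for all times \<open>t \<ge> 0\<close>.
\<close>

definition outputs :: "state \<Rightarrow> string \<Rightarrow> string \<Rightarrow> string \<Rightarrow> string \<Rightarrow> schedule \<Rightarrow> bool" where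
  "outputs st m t x a H \<longleftrightarrow>
     reg st m = length (actions H) \<and>
     (\<forall>j\<le>length (actions H). arr st t j = breaks H ! j \<and> arr st x j = pos H (breaks H ! j)) \<and>
     (\<forall>j<length (actions H). arr st a j = action_code (actions H ! j))"

fun outputs_schedule :: "state \<Rightarrow> schedule \<times> schedule \<Rightarrow> bool" where
  "outputs_schedule st (H0, H1) \<longleftrightarrow>
     outputs st ''m0'' ''t0'' ''x0'' ''a0'' H0 \<and> outputs st ''m1'' ''t1'' ''x1'' ''a1'' H1"

definition computes_optimal_in_linear_time :: "com \<Rightarrow> bool" where
  "computes_optimal_in_linear_time prog \<longleftrightarrow>
     (\<exists>c::nat. \<forall>I. valid_instance I \<longrightarrow>
        (\<exists>t st H. run prog (input_state I) t st \<and> t \<le> c * (num I + 1) \<and>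
                  outputs_schedule st H \<and> optimal I H))"

end

theory Submission imports Defs begin

text \<open>
  Write \<open>g x\<close> for \<open>work I {0..x}\<close>, the time one reclaimer needs for a round trip on \<open>[0, x]\<close> that
  serves both pads; \<open>g\<close> is continuous and strictly increasing, and \<open>g L = 2 K\<^sub>0\<close>.

  Lower bound: almost every point that a reclaimer passes at all is crossed by it at least twice, and
  a crossing costs \<open>1\<close> per unit length if it reclaims and at least \<open>1/s\<close> otherwise. If the ranges of
  the two reclaimers cover the rail, integrating over it shows that their finishing times add up to
  at least \<open>g L\<close>. Otherwise their ranges leave out an interval without stock, and integrating over
  either side bounds the two times separately. Collisions play no role in this argument.

  Upper bound: pick \<open>x\<close> with \<open>g x = K\<^sub>0\<close> and let \<open>R\<^sub>0\<close> serve \<open>[0, x]\<close> and \<open>R\<^sub>1\<close> serve \<open>[x, L]\<close>, so that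
  they cannot collide; if \<open>x\<close> lies in a gap \<open>[a\<^sub>i, b\<^sub>i]\<close>, they stop at its two ends instead. Both move
  rightwards for \<open>P\<^sub>1\<close> and leftwards for \<open>P\<^sub>2\<close>.

  Algorithm: the trip of \<open>R\<^sub>0\<close> over the whole rail is an array listing the ends of the stockpiles of
  \<open>P\<^sub>1\<close> upwards and then those of \<open>P\<^sub>2\<close> downwards. Two pointers started at the ends of this array
  merge the two lists and stop in the cell that contains \<open>x\<close>.
\<close>

subsection \<open>Lower bound\<close>

text \<open>The formula and the optimum are never compared directly: both are shown equal to the
  longer trip of a \<open>balanced_split\<close>, a notion that covers the single point with
  \<open>g x = K0\<close> and the gap around it alike. Such a split cannot be beaten, because a
  stock-free interval lies inside the gap of the split or entirely on one side of it; in the second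
  case monotonicity of \<open>g\<close> leaves at least \<open>K0\<close> to one reclaimer. The
  pointwise charging succeeds because a pass reclaims on one pad only: a point in both stocks needs
  two distinct reclaiming passes, a point in just one stock a reclaiming pass and some other pass.
  The exceptional points are the finitely many positions of breakpoints. The delicate part of the
  construction is the borders: stockpiles are closed and may touch, so the range of a trip can meet
  a stockpile in one point and reclaim nothing there. For the running time, the full trip supplies
  everything at once: the ends of the stockpiles in order, labels that tell stock from empty ground,
  and, as its duration, twice \<open>K0\<close>.\<close>

lemma finite_stockpiles [simp]: "finite (stockpiles I p)"
  by (cases p) auto

lemma closed_stock: "closed (stock I p)"
  unfolding stock_def by (intro closed_UN) auto

lemma stockpile_bounds:
  assumes "valid_instance I" "j \<in> stockpiles I p"
  shows "0 \<le> left I j" "left I j < right I j" "right I j \<le> rail I"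
proof -
  have "j \<in> {1..num I}" using assms by (cases p) (auto simp: valid_instance_def)
  moreover have "\<forall>j\<in>{1..num I}. 0 \<le> left I j \<and> left I j < right I j \<and> right I j \<le> rail I"
    using assms(1) unfolding valid_instance_def by (elim conjE)
  ultimately show "0 \<le> left I j" "left I j < right I j" "right I j \<le> rail I" by simp_all
qed

lemma speed_ge_1: "valid_instance I \<Longrightarrow> speed I \<ge> 1"
  by (simp add: valid_instance_def)

lemma rail_pos: "valid_instance I \<Longrightarrow> rail I > 0"
  by (simp add: valid_instance_def)

section \<open>The work function as a measure\<close>

lemma sets_stock [measurable]: "stock I p \<in> sets lebesgue"
  by (rule sets_completionI_sets) (simp add: borel_closed closed_stock)

lemma lmeasurable_stock_Int:
  "X \<in> lmeasurable \<Longrightarrow> stock I p \<inter> X \<in> lmeasurable"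
  using fmeasurable_Int_fmeasurable[OF _ sets_stock] by (simp add: Int_commute)

text \<open>The time for one sweep of \<open>X\<close> that serves pad \<open>p\<close>: travel time
  everywhere, plus the surcharge for reclaiming on the stock.\<close>

definition ptime :: "instance_data \<Rightarrow> pad \<Rightarrow> real set \<Rightarrow> real" where
  "ptime I p X = measure lebesgue X / speed I
     + (1 - 1 / speed I) * measure lebesgue (stock I p \<inter> X)"

text \<open>A point of \<open>Q2\<close>, of \<open>Q1\<close> or of the empty part weighs 2, 1 +
  1/s or 2/s. This is the sum over the two pads of 1 on the stock and 1/s off it, so
  inclusion-exclusion separates the pads.\<close>

lemma work_eq_ptime:
  assumes I: "valid_instance I" and X: "X \<in> lmeasurable" "X \<subseteq> {0..of_int (rail I)}"
  shows "work I X = ptime I P1 X + ptime I P2 X"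
proof -
  let ?m = "measure lebesgue"
  let ?A = "stock I P1 \<inter> X" and ?B = "stock I P2 \<inter> X"
  have A: "?A \<in> lmeasurable" and B: "?B \<in> lmeasurable"
    using X(1) lmeasurable_stock_Int by auto
  have AB: "?A \<inter> ?B \<in> lmeasurable" and AuB: "?A \<union> ?B \<in> lmeasurable"
    using A B by auto
  have q2: "Q2 I \<inter> X = ?A \<inter> ?B" by (auto simp: Q2_def)
  have q1: "Q1 I \<inter> X = (?A \<union> ?B) - (?A \<inter> ?B)" by (auto simp: Q1_def)
  have e: "empty_part I \<inter> X = X - (?A \<union> ?B)" using X(2) by (auto simp: empty_part_def)
  have un: "?m (?A \<union> ?B) = ?m ?A + ?m ?B - ?m (?A \<inter> ?B)"
    using measure_Un3[OF A B] by simp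
  have mq1: "?m (Q1 I \<inter> X) = ?m (?A \<union> ?B) - ?m (?A \<inter> ?B)"
    unfolding q1 by (rule measurable_measure_Diff[OF AuB]) (use AB in \<open>auto dest: fmeasurableD\<close>)
  have me: "?m (empty_part I \<inter> X) = ?m X - ?m (?A \<union> ?B)"
    unfolding e by (rule measurable_measure_Diff[OF X(1)]) (use AuB in \<open>auto dest: fmeasurableD\<close>)
  show ?thesis
    using speed_ge_1[OF I] unfolding work_def mq1 me q2 un ptime_def by (simp add: field_simps)
qed

lemma ptime_nonneg:
  assumes "valid_instance I" shows "ptime I p X \<ge> 0"
  using speed_ge_1[OF assms] unfolding ptime_def by simp

lemma ptime_add:
  assumes "a \<le> b" "b \<le> c"
  shows "ptime I p {a..c} = ptime I p {a..b} + ptime I p {b..c}"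
proof -
  have *: "measure lebesgue (T \<inter> {a..c}) = measure lebesgue (T \<inter> {a..b}) + measure lebesgue (T \<inter> {b..c})"
    if T: "T \<in> sets lebesgue" for T :: "real set"
  proof -
    have "T \<inter> {a..c} = (T \<inter> {a..b}) \<union> (T \<inter> {b..c})" using assms by auto
    moreover have "(T \<inter> {a..b}) \<in> lmeasurable" "(T \<inter> {b..c}) \<in> lmeasurable"
      using fmeasurable_Int_fmeasurable[OF lmeasurable_interval(1) T] by (simp_all add: Int_commute)
    moreover have "negligible ((T \<inter> {a..b}) \<inter> (T \<inter> {b..c}))"
      by (rule negligible_subset[of "{b}"]) auto
    ultimately show ?thesis by (simp add: measure_Un3 negligible_imp_measure0)
  qed
  from *[OF sets_stock[of I p]] assms show ?thesis
    unfolding ptime_def by (simp add: field_simps diff_divide_distrib)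
qed

lemma ptime_inside:
  assumes "a \<le> b" "{a..b} \<subseteq> stock I p" shows "ptime I p {a..b} = b - a"
proof -
  have "stock I p \<inter> {a..b} = {a..b}" using assms by auto
  with assms show ?thesis by (simp add: ptime_def algebra_simps)
qed

text \<open>Only the open interval has to avoid the stock, as stockpiles are closed and usually
  begin or end at \<open>a\<close> or \<open>b\<close>; two points have measure 0.\<close>

lemma ptime_outside:
  assumes "a \<le> b" "{a<..<b} \<inter> stock I p = {}" shows "ptime I p {a..b} = (b - a) / speed I"
proof -
  have "negligible (stock I p \<inter> {a..b})"
    by (rule negligible_subset[of "{a,b}"]) (use assms in \<open>auto simp: set_eq_iff\<close>,
      metis greaterThanLessThan_iff order_le_less)
  with assms show ?thesis by (simp add: ptime_def negligible_imp_measure0)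
qed

lemma ptime_ge:
  assumes "valid_instance I" "a \<le> b" shows "ptime I p {a..b} \<ge> (b - a) / speed I"
  using speed_ge_1[OF assms(1)] assms(2) unfolding ptime_def by simp

lemma work_ivl:
  assumes "valid_instance I" "0 \<le> a" "b \<le> of_int (rail I)"
  shows "work I {a..b} = ptime I P1 {a..b} + ptime I P2 {a..b}"
  by (rule work_eq_ptime) (use assms in auto)

lemma work_add:
  assumes "valid_instance I" "0 \<le> a" "a \<le> b" "b \<le> c" "c \<le> of_int (rail I)"
  shows "work I {a..c} = work I {a..b} + work I {b..c}"
  using assms by (simp add: work_ivl ptime_add[of a b c])

lemma work_nonneg:
  assumes "valid_instance I" "0 \<le> a" "b \<le> of_int (rail I)" shows "work I {a..b} \<ge> 0"
  using assms by (simp add: work_ivl ptime_nonneg)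

lemma work_pos:
  assumes "valid_instance I" "0 \<le> a" "a < b" "b \<le> of_int (rail I)"
  shows "work I {a..b} > 0"
proof -
  have "(b - a) / speed I > 0" using assms speed_ge_1[OF assms(1)] by simp
  with ptime_ge[OF assms(1), of a b P1] ptime_ge[OF assms(1), of a b P2] assms
  show ?thesis by (simp add: work_ivl)
qed

lemma work_mono:
  assumes "valid_instance I" "0 \<le> a" "a \<le> b" "b \<le> c" "c \<le> d" "d \<le> of_int (rail I)"
  shows "work I {b..c} \<le> work I {a..d}"
  using work_add[of I a b d] work_add[of I b c d] work_nonneg[of I a b] work_nonneg[of I c d] assms
  by linarith

section \<open>Schedules as polygonal paths\<close>

fun pace :: "real \<Rightarrow> action \<Rightarrow> real" where
  "pace s Wait = 0"
| "pace s (Travel d) = 1 / s"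
| "pace s (Reclaim p d) = 1"

abbreviation npieces :: "schedule \<Rightarrow> nat" where
  "npieces H \<equiv> length (actions H)"

abbreviation node :: "schedule \<Rightarrow> nat \<Rightarrow> real" where
  "node H j \<equiv> pos H (breaks H ! j)"

abbreviation stretch :: "schedule \<Rightarrow> nat \<Rightarrow> real set" where
  "stretch H j \<equiv> closed_segment (node H j) (node H (Suc j))"

lemma linear_image_segment:
  fixes f :: "real \<Rightarrow> real"
  assumes "a \<le> b" "\<And>t. t \<in> {a..b} \<Longrightarrow> f t = f a + c * (t - a)"
  shows "f ` {a..b} = closed_segment (f a) (f b)"
proof -
  have img: "f ` {a..b} = (\<lambda>t. c * t + (f a - c * a)) ` {a..b}"
    using assms(2) by (intro image_cong) (auto simp: algebra_simps)
  have fb: "f b = f a + c * (b - a)" using assms(2)[of b] assms(1) by simp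
  have "(\<lambda>t. c * t + (f a - c * a)) ` {a..b} = closed_segment (f a) (f b)"
  proof (cases "0 \<le> c")
    case True
    then have "0 \<le> c * (b - a)" using assms(1) by simp
    moreover have "(\<lambda>t. c * t + (f a - c * a)) ` {a..b} = {c * a + (f a - c * a)..c * b + (f a - c * a)}"
      using True assms(1) by (simp only: image_affinity_atLeastAtMost) auto
    ultimately show ?thesis
      by (simp add: fb closed_segment_eq_real_ivl algebra_simps)
  next
    case False
    then have "c * (b - a) \<le> 0" using assms(1) by (simp add: mult_nonpos_nonneg)
    moreover have "(\<lambda>t. c * t + (f a - c * a)) ` {a..b} = {c * b + (f a - c * a)..c * a + (f a - c * a)}"
      using False assms(1) by (simp only: image_affinity_atLeastAtMost) auto
    ultimately show ?thesis
      by (auto simp add: fb closed_segment_eq_real_ivl algebra_simps)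
  qed
  with img show ?thesis by simp
qed

lemma schedule_of_ends:
  assumes "schedule_of I k H"
  shows "breaks H ! 0 = 0" "breaks H ! npieces H = finish H"
    "node H 0 = real k * of_int (rail I)" "node H (npieces H) = real k * of_int (rail I)"
  using assms unfolding schedule_of_def by simp_all

lemma schedule_of_pieces:
  assumes "schedule_of I k H"
  shows "\<forall>j<npieces H. breaks H ! j < breaks H ! (j + 1) \<and>
      (\<forall>t\<in>piece H j. pos H t = node H j + slope (speed I) (actions H ! j) * (t - breaks H ! j))"
  using assms unfolding schedule_of_def by (elim conjE)

lemma breaks_less:
  assumes "schedule_of I k H" "j < npieces H"
  shows "breaks H ! j < breaks H ! Suc j"
  using conjunct1[OF mp[OF spec[OF schedule_of_pieces[OF assms(1)]] assms(2)]] by simp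

lemma pos_on_piece:
  assumes "schedule_of I k H" "j < npieces H" "t \<in> piece H j"
  shows "pos H t = node H j + slope (speed I) (actions H ! j) * (t - breaks H ! j)"
  by (rule bspec[OF conjunct2[OF mp[OF spec[OF schedule_of_pieces[OF assms(1)]] assms(2)]] assms(3)])

lemma pos_on_piece_end:
  assumes "schedule_of I k H" "j < npieces H"
  shows "node H (Suc j) = node H j + slope (speed I) (actions H ! j) * (breaks H ! Suc j - breaks H ! j)"
  using pos_on_piece[OF assms, of "breaks H ! Suc j"] breaks_less[OF assms] by simp

lemma pos_image_piece:
  assumes "schedule_of I k H" "j < npieces H"
  shows "pos H ` piece H j = stretch H j"
  using linear_image_segment[OF less_imp_le[OF breaks_less[OF assms]] pos_on_piece[OF assms]] by simp

lemma node_in_range: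
  assumes "schedule_of I k H" "j \<le> npieces H"
  shows "node H j \<in> {0..of_int (rail I)}"
proof -
  have mono: "breaks H ! i \<le> breaks H ! j" if "i \<le> j" "j \<le> npieces H" for i j
    using that
  proof (induction j)
    case (Suc j)
    then show ?case
      using breaks_less[OF assms(1), of j] by (cases "i = Suc j") simp_all
  qed auto
  have fin: "breaks H ! j \<in> {0..finish H}"
    using mono[of 0 j] mono[of j "npieces H"] assms schedule_of_ends(1,2)[OF assms(1)] by auto
  have "pos H ` {0..finish H} \<subseteq> {0..of_int (rail I)}"
    using assms(1) unfolding schedule_of_def by (elim conjE)
  from subsetD[OF this imageI[OF fin]] show ?thesis .
qed

text \<open>A density on the rail for the time spent moving: every piece spreads its duration evenly
  over the segment that it sweeps.\<close>

definition cost_at :: "real \<Rightarrow> schedule \<Rightarrow> real \<Rightarrow> real" where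
  "cost_at s H x = (\<Sum>j<npieces H. pace s (actions H ! j) * indicator (stretch H j) x)"

lemma pace_nonneg: "s \<ge> 1 \<Longrightarrow> pace s a \<ge> 0"
  by (cases a) auto

lemma abs_sign [simp]: "\<bar>sign d\<bar> = 1"
  by (cases d) auto

lemma pace_slope: "s \<ge> 1 \<Longrightarrow> pace s a * \<bar>slope s a\<bar> \<le> 1"
  by (cases a) (auto simp: abs_mult)

lemma lmeasurable_stretch [simp]: "closed_segment (a::real) b \<in> lmeasurable"
  by (simp add: closed_segment_eq_real_ivl)

text \<open>A piece contributes at most pace times length, which is at most its duration, and the
  durations telescope to the finishing time. Waiting pieces and the part of a segment outside
  \<open>X\<close> make this an inequality.\<close>

lemma integral_cost_le_finish:
  assumes I: "valid_instance I" and H: "schedule_of I k H" and X: "X \<in> sets lebesgue"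
  shows "integrable lebesgue (\<lambda>x. indicator X x * cost_at (speed I) H x)"
    "integral\<^sup>L lebesgue (\<lambda>x. indicator X x * cost_at (speed I) H x) \<le> finish H"
proof -
  note s = speed_ge_1[OF I]
  let ?c = "\<lambda>j. pace (speed I) (actions H ! j)"
  have eq: "indicator X x * cost_at (speed I) H x = (\<Sum>j<npieces H. ?c j * indicator (X \<inter> stretch H j) x)" for x
    by (cases "x \<in> X") (simp_all add: cost_at_def indicator_def)
  have fm: "X \<inter> stretch H j \<in> lmeasurable" for j
    using X by (metis Int_commute fmeasurable_Int_fmeasurable lmeasurable_stretch)
  have int: "integrable lebesgue (\<lambda>x. ?c j * indicator (X \<inter> stretch H j) x)" for j
    using fm[of j] by (intro integrable_mult_right) (auto simp: fmeasurable_def)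
  show "integrable lebesgue (\<lambda>x. indicator X x * cost_at (speed I) H x)"
    unfolding eq by (intro Bochner_Integration.integrable_sum int)
  have "integral\<^sup>L lebesgue (\<lambda>x. indicator X x * cost_at (speed I) H x)
      = (\<Sum>j<npieces H. ?c j * measure lebesgue (X \<inter> stretch H j))"
    unfolding eq by (subst Bochner_Integration.integral_sum) (use int fm in auto)
  also have "\<dots> \<le> (\<Sum>j<npieces H. breaks H ! Suc j - breaks H ! j)"
  proof (rule sum_mono)
    fix j assume j: "j \<in> {..<npieces H}"
    have lt: "breaks H ! j < breaks H ! Suc j" using breaks_less[OF H, of j] j by simp
    have "measure lebesgue (X \<inter> stretch H j) \<le> measure lebesgue (stretch H j)"
      by (rule measure_mono_fmeasurable) (use fm X in \<open>auto intro: fmeasurableD\<close>)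
    also have "\<dots> = \<bar>node H (Suc j) - node H j\<bar>"
      by (simp add: closed_segment_eq_real_ivl)
    also have "\<dots> = \<bar>slope (speed I) (actions H ! j)\<bar> * (breaks H ! Suc j - breaks H ! j)"
      using pos_on_piece_end[OF H, of j] j lt by (simp add: abs_mult)
    finally have "?c j * measure lebesgue (X \<inter> stretch H j)
        \<le> ?c j * (\<bar>slope (speed I) (actions H ! j)\<bar> * (breaks H ! Suc j - breaks H ! j))"
      using pace_nonneg[OF s] by (intro mult_left_mono) auto
    also have "\<dots> = (?c j * \<bar>slope (speed I) (actions H ! j)\<bar>) * (breaks H ! Suc j - breaks H ! j)"
      by (simp add: mult.assoc)
    also have "\<dots> \<le> 1 * (breaks H ! Suc j - breaks H ! j)"
      using lt pace_slope[OF s] by (intro mult_right_mono) auto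
    finally show "?c j * measure lebesgue (X \<inter> stretch H j) \<le> breaks H ! Suc j - breaks H ! j" by simp
  qed
  also have "\<dots> = finish H"
    using sum_lessThan_telescope[of "\<lambda>j. breaks H ! j" "npieces H"] schedule_of_ends(1,2)[OF H] by simp
  finally show "integral\<^sup>L lebesgue (\<lambda>x. indicator X x * cost_at (speed I) H x) \<le> finish H" .
qed

section \<open>Crossings of a generic point\<close>

lemma change_between:
  fixes P :: "nat \<Rightarrow> bool"
  assumes "i \<le> k" "P i \<noteq> P k" shows "\<exists>j. i \<le> j \<and> j < k \<and> P j \<noteq> P (Suc j)"
proof (rule ccontr)
  assume *: "\<nexists>j. i \<le> j \<and> j < k \<and> P j \<noteq> P (Suc j)"
  have "P j = P i" if "i \<le> j" "j \<le> k" for j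
    using that
  proof (induction j rule: dec_induct)
    case (step n) then show ?case using * by simp
  qed simp
  with assms show False by blast
qed

text \<open>A path that returns to its initial side of \<open>x\<close> changes sides once before
  node \<open>k\<close> and once after it; the two pieces differ since one has index below
  \<open>k\<close> and the other does not.\<close>

lemma crossed_twice:
  fixes y :: "nat \<Rightarrow> real"
  assumes "k \<le> m" "\<And>j. j \<le> m \<Longrightarrow> y j \<noteq> x" "(y 0 < x) \<noteq> (y k < x)" "(y m < x) \<noteq> (y k < x)"
  shows "\<exists>i j. i \<noteq> j \<and> i < m \<and> j < m \<and> x \<in> closed_segment (y i) (y (Suc i)) \<and> x \<in> closed_segment (y j) (y (Suc j))"
proof -
  from change_between[of 0 k "\<lambda>i. y i < x", OF le0 assms(3)]
  obtain i where i: "i < k" "(y i < x) \<noteq> (y (Suc i) < x)" by (elim exE conjE)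
  from change_between[of k m "\<lambda>i. y i < x", OF assms(1) assms(4)[symmetric]]
  obtain j where j: "k \<le> j" "j < m" "(y j < x) \<noteq> (y (Suc j) < x)" by (elim exE conjE)
  have seg: "x \<in> closed_segment (y i) (y (Suc i))" if "(y i < x) \<noteq> (y (Suc i) < x)" for i
    using that by (cases "y i < x") (simp_all add: closed_segment_eq_real_ivl)
  have "i \<noteq> j" "i < m" using i(1) j(1) assms(1) by auto
  with j(2) seg[OF i(2)] seg[OF j(3)] show ?thesis
    by (intro exI[of _ i] exI[of _ j] conjI)
qed

lemma two_le_sum:
  fixes c :: "'a \<Rightarrow> real"
  assumes "finite J" "\<And>e. e \<in> J \<Longrightarrow> c e \<ge> 0" "e \<in> J" "e' \<in> J" "e \<noteq> e'"
  shows "c e + c e' \<le> sum c J"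
proof -
  have "sum c {e, e'} \<le> sum c J" by (rule sum_mono2) (use assms in auto)
  then show ?thesis using assms(5) by simp
qed

text \<open>\<open>J\<close> stands for the passes over \<open>x\<close> and \<open>c\<close> for
  their paces. If \<open>x\<close> lies in both stocks, the two reclaiming passes are distinct
  because their labels name different pads. If it lies in one, at least one of \<open>e1\<close> and
  \<open>e2\<close> differs from the reclaiming pass and adds 1/s. Otherwise \<open>e1\<close> and
  \<open>e2\<close> add 1/s each.\<close>

lemma local_work_le_sum:
  fixes c :: "'a \<Rightarrow> real"
  assumes "finite J" "s \<ge> 1" "\<And>e. e \<in> J \<Longrightarrow> c e \<ge> 1 / s"
    "e1 \<in> J" "e2 \<in> J" "e1 \<noteq> e2"
    "\<And>p. x \<in> S p \<Longrightarrow> \<exists>e\<in>J. \<exists>d. lab e = Reclaim p d \<and> c e = 1"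
  shows "1 / s + (1 - 1 / s) * indicator (S P1) x + (1 / s + (1 - 1 / s) * indicator (S P2) x) \<le> sum c J"
proof -
  have nn: "c e \<ge> 0" if "e \<in> J" for e
    using assms(2) assms(3)[OF that] by (smt (verit) divide_nonneg_nonneg)
  note two = two_le_sum[of J c, OF assms(1) nn]
  have one: "1 + 1 / s \<le> sum c J" if p: "x \<in> S p" for p
  proof -
    obtain e where e: "e \<in> J" "c e = 1" using assms(7)[OF p] by blast
    obtain e' where "e' \<in> J" "e' \<noteq> e" using assms(4-6) by metis
    then show ?thesis using two[of e e'] e assms(3)[of e'] by auto
  qed
  consider "x \<in> S P1" "x \<in> S P2" | "x \<in> S P1" "x \<notin> S P2" | "x \<notin> S P1" "x \<in> S P2" | "x \<notin> S P1" "x \<notin> S P2"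
    by blast
  then show ?thesis
  proof cases
    case 1
    obtain e d where e: "e \<in> J" "c e = 1" "lab e = Reclaim P1 d" using assms(7)[OF 1(1)] by blast
    obtain e' d' where e': "e' \<in> J" "c e' = 1" "lab e' = Reclaim P2 d'" using assms(7)[OF 1(2)] by blast
    have "e \<noteq> e'" using e e' by auto
    then show ?thesis using two[of e e'] e e' 1 by auto
  next
    case 2 then show ?thesis using one[of P1] by simp
  next
    case 3 then show ?thesis using one[of P2] by simp
  next
    case 4 then show ?thesis using two[of e1 e2] assms(3)[of e1] assms(3)[of e2] assms(4-6) by simp
  qed
qed

text \<open>The passes of both reclaimers are pooled, so it does not matter which of them reclaims
  and which merely passes. By \<open>turn\<close> one of the tours gets to the other side of
  \<open>x\<close> and therefore crosses it twice.\<close>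

lemma work_le_cost_at:
  assumes I: "valid_instance I" and H: "\<And>k. k < 2 \<Longrightarrow> schedule_of I k (H k)"
    and cov: "\<And>p. x \<in> stock I p \<Longrightarrow> \<exists>k<2. reclaims (H k) p x"
    and gen: "\<And>k j. k < 2 \<Longrightarrow> j \<le> npieces (H k) \<Longrightarrow> node (H k) j \<noteq> x"
    and turn: "\<exists>k<2. \<exists>j \<le> npieces (H k). (node (H k) j < x) \<noteq> (node (H k) 0 < x)"
  shows "1 / speed I + (1 - 1 / speed I) * indicator (stock I P1) x
      + (1 / speed I + (1 - 1 / speed I) * indicator (stock I P2) x)
    \<le> cost_at (speed I) (H 0) x + cost_at (speed I) (H 1) x"
proof -
  note s = speed_ge_1[OF I]
  define J where "J = Sigma {0,1::nat} (\<lambda>k. {j. j < npieces (H k) \<and> x \<in> stretch (H k) j})"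
  define lab where "lab e = (case e of (k, j) \<Rightarrow> actions (H k) ! j)" for e :: "nat \<times> nat"
  define c where "c e = pace (speed I) (lab e)" for e
  have two: "k < 2 \<longleftrightarrow> k = 0 \<or> k = (1::nat)" for k by auto
  have fin: "finite J" unfolding J_def by auto
  have cost: "cost_at (speed I) (H k) x = (\<Sum>j\<in>{j. j < npieces (H k) \<and> x \<in> stretch (H k) j}. c (k, j))" for k
    unfolding cost_at_def c_def lab_def
    by (rule sum.mono_neutral_cong_right) (auto simp: indicator_def)
  have sumc: "cost_at (speed I) (H 0) x + cost_at (speed I) (H 1) x = sum c J"
    unfolding J_def by (subst sum.Sigma[symmetric, where g = "\<lambda>k j. c (k,j)", simplified]) (auto simp: cost)
  have ge: "c e \<ge> 1 / speed I" if "e \<in> J" for e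
  proof -
    obtain k j where e: "e = (k, j)" "k < 2" "j < npieces (H k)" "x \<in> stretch (H k) j"
      using \<open>e \<in> J\<close> unfolding J_def by (auto simp: two)
    \<comment> \<open>A waiting piece sweeps only the position of its node, and \<open>x\<close> is
      not a node.\<close>
    have "lab e \<noteq> Wait"
    proof
      assume w: "lab e = Wait"
      have "node (H k) (Suc j) = node (H k) j"
        using pos_on_piece_end[OF H[OF e(2)] e(3)] w e(1) by (simp add: lab_def)
      then have "x = node (H k) j" using e(4) by simp
      then show False using gen[OF e(2), of j] e(3) by simp
    qed
    then show ?thesis using s by (cases "lab e") (auto simp: c_def)
  qed
  from turn obtain k j where k: "k < 2" "j \<le> npieces (H k)" "(node (H k) j < x) \<noteq> (node (H k) 0 < x)"
    by (elim exE conjE)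
  have ends: "node (H k) (npieces (H k)) = node (H k) 0"
    using schedule_of_ends(3,4)[OF H[OF k(1)]] by (simp only:)
  have "\<exists>i j. i \<noteq> j \<and> i < npieces (H k) \<and> j < npieces (H k) \<and> x \<in> stretch (H k) i \<and> x \<in> stretch (H k) j"
    by (rule crossed_twice[OF k(2) gen[OF k(1)]]) (simp_all only: ends k(3) k(3)[symmetric] not_sym simp_thms)
  then obtain i i' where i: "i \<noteq> i'" "i < npieces (H k)" "i' < npieces (H k)"
      "x \<in> stretch (H k) i" "x \<in> stretch (H k) i'" by (elim exE conjE)
  have "k \<in> {0, 1}" using k(1) by auto
  with i have e12: "(k, i) \<in> J" "(k, i') \<in> J" "(k, i) \<noteq> (k, i')"
    unfolding J_def by auto
  have rec: "\<exists>e\<in>J. \<exists>d. lab e = Reclaim p d \<and> c e = 1" if p: "x \<in> stock I p" for p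
  proof -
    obtain k where k: "k < 2" "reclaims (H k) p x" using cov[OF p] by blast
    then obtain j d where j: "j < npieces (H k)" "actions (H k) ! j = Reclaim p d" "x \<in> pos (H k) ` piece (H k) j"
      unfolding reclaims_def by blast
    have "x \<in> stretch (H k) j" using j pos_image_piece[OF H[OF k(1)] j(1)] by simp
    then show ?thesis
      using j k(1) by (intro bexI[of _ "(k,j)"]) (auto simp: J_def c_def lab_def two)
  qed
  show ?thesis
    unfolding sumc by (rule local_work_le_sum[OF fin s ge e12 rec])
qed

text \<open>Integrates the pointwise bound over \<open>X\<close>. The nodes form a finite set and
  may be discarded, which is why \<open>turn\<close> is required only at points that are not
  nodes.\<close>

lemma lower_bound_on:
  assumes I: "valid_instance I" and H: "\<And>k. k < 2 \<Longrightarrow> schedule_of I k (H k)"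
    and cov: "\<And>p x. x \<in> stock I p \<Longrightarrow> \<exists>k<2. reclaims (H k) p x"
    and X: "X \<in> lmeasurable" "X \<subseteq> {0..of_int (rail I)}"
    and turn: "\<And>x. x \<in> X \<Longrightarrow> (\<And>k j. k < 2 \<Longrightarrow> j \<le> npieces (H k) \<Longrightarrow> node (H k) j \<noteq> x) \<Longrightarrow>
         \<exists>k<2. \<exists>j \<le> npieces (H k). (node (H k) j < x) \<noteq> (node (H k) 0 < x)"
  shows "work I X \<le> integral\<^sup>L lebesgue (\<lambda>x. indicator X x * cost_at (speed I) (H 0) x)
     + integral\<^sup>L lebesgue (\<lambda>x. indicator X x * cost_at (speed I) (H 1) x)"
proof -
  let ?s = "speed I" and ?w = "\<lambda>k x. indicator X x * cost_at (speed I) (H k) x"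
  let ?h = "\<lambda>p x. 1 / ?s * indicator X x + (1 - 1 / ?s) * indicator (stock I p \<inter> X) x"
  define N where "N = (\<Union>k\<in>{0,1}. node (H k) ` {..npieces (H k)})"
  have "finite N" unfolding N_def by auto
  then have ae: "AE x in lebesgue. x \<notin> N"
    by (metis AE_not_in finite_imp_null_set_lborel null_sets_completionI)
  have fm: "stock I p \<inter> X \<in> lmeasurable" for p using X(1) by (rule lmeasurable_stock_Int)
  have ii: "integrable lebesgue (indicator Y :: real \<Rightarrow> real)" if "Y \<in> lmeasurable" for Y
    using that by (auto simp: fmeasurable_def)
  have inth: "integrable lebesgue (?h p)" for p
    by (intro Bochner_Integration.integrable_add integrable_mult_right ii X fm)
  have ih: "integral\<^sup>L lebesgue (?h p) = ptime I p X" for p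
    unfolding ptime_def using ii[OF X(1)] ii[OF fm] fmeasurableD[OF X(1)]
    by (subst Bochner_Integration.integral_add) (auto)
  have intw: "integrable lebesgue (?w k)" if "k < 2" for k
    using integral_cost_le_finish(1)[OF I H[OF that]] X(1) by (auto intro: fmeasurableD)
  have "work I X = integral\<^sup>L lebesgue (\<lambda>x. ?h P1 x + ?h P2 x)"
    using work_eq_ptime[OF I X] ih inth by (subst Bochner_Integration.integral_add) auto
  also have "\<dots> \<le> integral\<^sup>L lebesgue (\<lambda>x. ?w 0 x + ?w 1 x)"
  proof (rule integral_mono_AE)
    show "AE x in lebesgue. ?h P1 x + ?h P2 x \<le> ?w 0 x + ?w 1 x"
      using ae
    proof eventually_elim
      case (elim x)
      show ?case
      proof (cases "x \<in> X")
        case True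
        have gen: "node (H k) j \<noteq> x" if "k < 2" "j \<le> npieces (H k)" for k j
          using elim that unfolding N_def by (cases "k = 0"; force simp: less_2_cases_iff)
        have "1 / ?s + (1 - 1 / ?s) * indicator (stock I P1) x
            + (1 / ?s + (1 - 1 / ?s) * indicator (stock I P2) x)
          \<le> cost_at ?s (H 0) x + cost_at ?s (H 1) x"
          by (rule work_le_cost_at) (use I H cov gen turn[OF True] in auto)
        then show ?thesis using True by (simp add: indicator_def)
      qed simp
    qed
  next
    show "integrable lebesgue (\<lambda>x. ?h P1 x + ?h P2 x)"
      by (rule Bochner_Integration.integrable_add[OF inth inth])
    show "integrable lebesgue (\<lambda>x. ?w 0 x + ?w 1 x)"
      by (rule Bochner_Integration.integrable_add[OF intw intw]) simp_all
  qed
  also have "\<dots> = integral\<^sup>L lebesgue (?w 0) + integral\<^sup>L lebesgue (?w 1)"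
    using intw by (subst Bochner_Integration.integral_add) auto
  finally show ?thesis .
qed

lemma preemptive_lower_bound:
  assumes I: "valid_instance I" and H: "preemptive_schedule I (H0, H1)"
  shows "work I {0..of_int (rail I)} \<le> finish H0 + finish H1 \<or>
    (\<exists>c d. 0 \<le> c \<and> c < d \<and> d \<le> of_int (rail I) \<and> (\<forall>p. {c<..<d} \<inter> stock I p = {}) \<and>
       work I {0..c} \<le> finish H0 \<and> work I {d..of_int (rail I)} \<le> finish H1)"
proof -
  let ?L = "of_int (rail I) :: real"
  define H where "H k = (if k = 0 then H0 else H1)" for k :: nat
  have two: "k < 2 \<longleftrightarrow> k = 0 \<or> k = (1::nat)" for k by auto
  have S: "schedule_of I k (H k)" if "k < 2" for k
    using H that unfolding H_def two by (auto simp: two)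
  have cov: "\<exists>k<2. reclaims (H k) p x" if "x \<in> stock I p" for p x
    using H that unfolding H_def by (fastforce simp: two)
  \<comment> \<open>A piecewise linear movement takes its extreme values at nodes, so
    \<open>c\<close> and \<open>d\<close> bound the ranges \<open>[0, c]\<close> and
    \<open>[d, L]\<close> of the two reclaimers.\<close>
  define c where "c = Max (node H0 ` {..npieces H0})"
  define d where "d = Min (node H1 ` {..npieces H1})"
  have "c \<in> node H0 ` {..npieces H0}" unfolding c_def by (rule Max_in) auto
  then obtain jc where jc: "jc \<le> npieces H0" "c = node H0 jc" by auto
  have "d \<in> node H1 ` {..npieces H1}" unfolding d_def by (rule Min_in) auto
  then obtain jd where jd: "jd \<le> npieces H1" "d = node H1 jd" by auto
  have le_c: "node H0 j \<le> c" if "j \<le> npieces H0" for j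
    unfolding c_def using that by (intro Max_ge) auto
  have ge_d: "d \<le> node H1 j" if "j \<le> npieces H1" for j
    unfolding d_def using that by (intro Min_le) auto
  have S0: "schedule_of I 0 H0" and S1: "schedule_of I 1 H1" using H by auto
  have n0: "node H0 0 = 0" and n1: "node H1 0 = ?L"
    using schedule_of_ends(3)[OF S0] schedule_of_ends(3)[OF S1] by auto
  have cr: "c \<in> {0..?L}" and dr: "d \<in> {0..?L}"
    using node_in_range[OF S0 jc(1)] node_in_range[OF S1 jd(1)] jc jd by auto
  have turn: "\<exists>k<2. \<exists>j \<le> npieces (H k). (node (H k) j < x) \<noteq> (node (H k) 0 < x)"
    if x: "0 \<le> x" "x \<le> ?L" "x \<le> c \<or> d \<le> x"
      and gen: "\<And>k j. k < 2 \<Longrightarrow> j \<le> npieces (H k) \<Longrightarrow> node (H k) j \<noteq> x" for x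
  proof -
    have g0: "node H0 j \<noteq> x" if "j \<le> npieces H0" for j using gen[of 0] that by (simp add: H_def)
    have g1: "node H1 j \<noteq> x" if "j \<le> npieces H1" for j using gen[of 1] that by (simp add: H_def)
    from x(3) show ?thesis
    proof
      assume "x \<le> c"
      then have "\<not> node H0 jc < x" "node H0 0 < x" using g0[of jc] g0[of 0] n0 x jc by auto
      then show ?thesis using jc by (intro exI[of _ 0]) (auto simp: H_def)
    next
      assume "d \<le> x"
      then have "node H1 jd < x" "\<not> node H1 0 < x" using g1[of jd] g1[of 0] n1 x jd by auto
      then show ?thesis using jd by (intro exI[of _ 1]) (auto simp: H_def)
    qed
  qed
  let ?W = "\<lambda>X H. integral\<^sup>L lebesgue (\<lambda>x. indicator X x * cost_at (speed I) H x)"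
  have lb: "work I X \<le> ?W X H0 + ?W X H1"
    if "X \<in> lmeasurable" "X \<subseteq> {0..?L}" "\<And>x. x \<in> X \<Longrightarrow> x \<le> c \<or> d \<le> x" for X
  proof -
    have "work I X \<le> ?W X (H 0) + ?W X (H 1)"
    proof (rule lower_bound_on[OF I S cov that(1,2)])
      fix x assume x: "x \<in> X" and gen: "\<And>k j. k < 2 \<Longrightarrow> j \<le> npieces (H k) \<Longrightarrow> node (H k) j \<noteq> x"
      have "0 \<le> x" "x \<le> ?L" using x that(2) by auto
      from turn[OF this that(3)[OF x] gen]
      show "\<exists>k<2. \<exists>j \<le> npieces (H k). (node (H k) j < x) \<noteq> (node (H k) 0 < x)" .
    qed
    then show ?thesis by (simp add: H_def)
  qed
  have le: "?W X H0 \<le> finish H0" "?W X H1 \<le> finish H1" if "X \<in> lmeasurable" for X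
    using integral_cost_le_finish(2)[OF I S0] integral_cost_le_finish(2)[OF I S1] that
    by (auto intro: fmeasurableD)
  show ?thesis
  proof (cases "d \<le> c")
    case True
    have m: "{0..?L} \<in> lmeasurable" by (rule lmeasurable_interval)
    have "work I {0..?L} \<le> ?W {0..?L} H0 + ?W {0..?L} H1"
      by (rule lb[OF m]) (use True in auto)
    also have "\<dots> \<le> finish H0 + finish H1" using le[OF m] by (rule add_mono)
    finally show ?thesis ..
  next
    case False
    have st0: "x \<le> c" if "j < npieces H0" "x \<in> stretch H0 j" for x j
      using le_c[of j] le_c[of "Suc j"] that by (auto simp: closed_segment_eq_real_ivl split: if_splits)
    have st1: "d \<le> x" if "j < npieces H1" "x \<in> stretch H1 j" for x j
      using ge_d[of j] ge_d[of "Suc j"] that by (auto simp: closed_segment_eq_real_ivl split: if_splits)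
    \<comment> \<open>All pieces of \<open>H1\<close> stay to the right of \<open>c\<close>, so the
      work on \<open>[0, c]\<close> is charged to \<open>H0\<close> alone.\<close>
    have z1: "indicator {0..c} x * cost_at (speed I) H1 x = 0" for x
    proof (cases "x \<le> c")
      case True
      then have "x \<notin> stretch H1 j" if "j < npieces H1" for j using st1[OF that, of x] False by linarith
      then show ?thesis by (simp add: cost_at_def)
    qed simp
    have "?W {0..c} H1 = 0" by (simp only: z1 Bochner_Integration.integral_zero)
    moreover have m: "{0..c} \<in> lmeasurable" by (rule lmeasurable_interval)
    have "work I {0..c} \<le> ?W {0..c} H0 + ?W {0..c} H1"
      by (rule lb[OF m]) (use cr in auto)
    ultimately have a: "work I {0..c} \<le> finish H0" using le(1)[OF m] by linarith
    have z0: "indicator {d..?L} x * cost_at (speed I) H0 x = 0" for x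
    proof (cases "d \<le> x")
      case True
      then have "x \<notin> stretch H0 j" if "j < npieces H0" for j using st0[OF that, of x] False by linarith
      then show ?thesis by (simp add: cost_at_def)
    qed simp
    have "?W {d..?L} H0 = 0" by (simp only: z0 Bochner_Integration.integral_zero)
    moreover have m: "{d..?L} \<in> lmeasurable" by (rule lmeasurable_interval)
    have "work I {d..?L} \<le> ?W {d..?L} H0 + ?W {d..?L} H1"
      by (rule lb[OF m]) (use dr in auto)
    ultimately have b: "work I {d..?L} \<le> finish H1" using le(2)[OF m] by linarith
    have "x \<notin> {c<..<d}" if x: "x \<in> stock I p" for x p
    proof -
      have "reclaims H0 p x \<or> reclaims H1 p x" using H x by simp
      then show ?thesis
      proof
        assume "reclaims H0 p x"
        then obtain j where "j < npieces H0" "x \<in> pos H0 ` piece H0 j" unfolding reclaims_def by blast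
        then show ?thesis using pos_image_piece[OF S0] st0[of j x] by simp
      next
        assume "reclaims H1 p x"
        then obtain j where "j < npieces H1" "x \<in> pos H1 ` piece H1 j" unfolding reclaims_def by blast
        then show ?thesis using pos_image_piece[OF S1] st1[of j x] by simp
      qed
    qed
    then have "\<forall>p. {c<..<d} \<inter> stock I p = {}" by (simp only: disjoint_iff) metis
    with a b False cr dr show ?thesis by (intro disjI2 exI[of _ c] exI[of _ d]) simp
  qed
qed

subsection \<open>Balanced splits and the formula for the optimum\<close>

text \<open>For \<open>u = v\<close> this is a point at which both trips take time
  \<open>K0\<close>; for \<open>u < v\<close> it is a gap across which the work passes
  \<open>K0\<close>. Requiring \<open>u\<close> and \<open>v\<close> to lie in the stock or at an
  end of the rail keeps them out of every stock-free open interval within the rail and makes a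
  nonempty \<open>{u<..<v}\<close> maximal among these.\<close>

definition balanced_split :: "instance_data \<Rightarrow> real \<Rightarrow> real \<Rightarrow> bool" where
  "balanced_split I u v \<longleftrightarrow> 0 \<le> u \<and> u \<le> v \<and> v \<le> of_int (rail I) \<and>
     u \<in> stock I P1 \<union> stock I P2 \<union> {0, of_int (rail I)} \<and>
     v \<in> stock I P1 \<union> stock I P2 \<union> {0, of_int (rail I)} \<and>
     (\<forall>p. {u<..<v} \<inter> stock I p = {}) \<and>
     work I {0..u} \<le> K0 I \<and> K0 I \<le> work I {0..v}"

lemma work_complement:
  assumes "valid_instance I" "0 \<le> v" "v \<le> of_int (rail I)"
  shows "work I {v..of_int (rail I)} = 2 * K0 I - work I {0..v}"
  using work_add[OF assms(1), of 0 v "of_int (rail I)"] assms(2,3)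
  unfolding K0_def by linarith

lemma split_le_K0:
  assumes "valid_instance I" "balanced_split I u v"
  shows "max (work I {0..u}) (work I {v..of_int (rail I)}) \<le> K0 I"
  using assms(2) work_complement[OF assms(1), of v] unfolding balanced_split_def by simp

text \<open>
  Applied both to the gaps, where \<open>(c, d) = (a\<^sub>i, b\<^sub>i)\<close>, and to the interval left out by a schedule.
\<close>

lemma split_le_empty_interval:
  assumes I: "valid_instance I" and S: "balanced_split I u v"
    and cd: "0 \<le> c" "c < d" "d \<le> of_int (rail I)" "\<And>p. {c<..<d} \<inter> stock I p = {}"
  shows "max (work I {0..u}) (work I {v..of_int (rail I)})
     \<le> max (work I {0..c}) (work I {d..of_int (rail I)})"
proof -
  let ?L = "of_int (rail I) :: real"
  note V = split_le_K0[OF I S]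
  note S' = S[unfolded balanced_split_def]
  have outside: "x \<notin> {c<..<d}" if "x \<in> stock I P1 \<union> stock I P2 \<union> {0, ?L}" for x
    using that cd(1,3) cd(4)[of P1] cd(4)[of P2] by fastforce
  have uo: "u \<notin> {c<..<d}" and vo: "v \<notin> {c<..<d}" using outside S' by blast+
  \<comment> \<open>If \<open>{c<..<d}\<close> is inside the gap of the split, both trips of the
    split are the shorter ones. If it is to the left of \<open>u\<close>, then \<open>[d, L]\<close>
    contains \<open>[u, L]\<close>, whose work is at least \<open>K0\<close>; symmetrically to the
    right of \<open>v\<close>. The trips of the split never exceed \<open>K0\<close>.\<close>
  consider "u \<le> c" "d \<le> v" | "d \<le> u" | "v \<le> c" using uo vo S' by fastforce
  then show ?thesis
  proof cases
    case 1
    then have "work I {0..u} \<le> work I {0..c}" "work I {v..?L} \<le> work I {d..?L}"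
      using S' cd by (auto intro!: work_mono[OF I])
    then show ?thesis by linarith
  next
    case 2
    then have "work I {u..?L} \<le> work I {d..?L}" using S' cd by (auto intro!: work_mono[OF I])
    then show ?thesis using work_complement[OF I, of u] S' V by linarith
  next
    case 3
    then have "work I {0..v} \<le> work I {0..c}" using S' cd by (auto intro!: work_mono[OF I])
    then show ?thesis using S' V by linarith
  qed
qed

lemma split_le_makespan:
  assumes I: "valid_instance I" and S: "balanced_split I u v" and H: "preemptive_schedule I H"
  shows "max (work I {0..u}) (work I {v..of_int (rail I)}) \<le> makespan H"
proof -
  obtain H0 H1 where HH: "H = (H0, H1)" by (cases H)
  from preemptive_lower_bound[OF I H[unfolded HH]] show ?thesis
  proof
    assume "work I {0..of_int (rail I)} \<le> finish H0 + finish H1"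
    then show ?thesis using split_le_K0[OF I S] unfolding HH K0_def makespan.simps by linarith
  next
    assume "\<exists>c d. 0 \<le> c \<and> c < d \<and> d \<le> of_int (rail I) \<and> (\<forall>p. {c<..<d} \<inter> stock I p = {}) \<and>
       work I {0..c} \<le> finish H0 \<and> work I {d..of_int (rail I)} \<le> finish H1"
    then obtain c d where cd: "0 \<le> c" "c < d" "d \<le> of_int (rail I)" "\<forall>p. {c<..<d} \<inter> stock I p = {}"
      "work I {0..c} \<le> finish H0" "work I {d..of_int (rail I)} \<le> finish H1" by (elim exE conjE)
    have "max (work I {0..u}) (work I {v..of_int (rail I)}) \<le> max (work I {0..c}) (work I {d..of_int (rail I)})"
      by (rule split_le_empty_interval[OF I S cd(1-3)]) (use cd(4) in simp)
    also have "\<dots> \<le> makespan H" using cd(5,6) unfolding HH makespan.simps by linarith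
    finally show ?thesis .
  qed
qed

text \<open>\<open>empty_part\<close> is open relative to the rail. Hence a small ball around
  \<open>x\<close>, cut down to the rail, is a connected part of it that meets \<open>C\<close>, and
  \<open>C\<close> is a maximal connected set.\<close>

lemma component_contains_nbhd:
  assumes C: "C \<in> components (empty_part I)" and x: "x \<in> closure C" "x \<notin> stock I P1 \<union> stock I P2"
  obtains e where "e > 0" "ball x e \<inter> {0..of_int (rail I)} \<subseteq> C"
proof -
  have "open (- (stock I P1 \<union> stock I P2))"
    by (intro open_Compl closed_Un closed_stock)
  then obtain e where e: "e > 0" "ball x e \<subseteq> - (stock I P1 \<union> stock I P2)"
    using x(2) by (meson ComplI open_contains_ball)
  let ?T = "ball x e \<inter> {0..of_int (rail I)}"
  have "convex ?T" by (intro convex_Int convex_ball) simp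
  then have conn: "connected ?T" by (rule convex_connected)
  have sub: "?T \<subseteq> empty_part I" using e(2) by (auto simp: empty_part_def)
  obtain y where y: "y \<in> C" "dist y x < e" using x(1) e(1) by (meson closure_approachable)
  have "C \<subseteq> empty_part I" using C by (rule in_components_subset)
  then have "y \<in> C \<inter> ?T" using y by (auto simp: empty_part_def dist_commute)
  then have "C \<inter> ?T \<noteq> {}" by blast
  then have "?T \<subseteq> C" using components_maximal[OF C conn sub] by simp
  with e(1) that show thesis by blast
qed

text \<open>Besides the properties that make a gap comparable with a split, this locates its ends
  among finitely many numbers. An end that is not in the stock has a relative neighbourhood within
  the gap and must be an end of the rail.\<close>

lemma gapsD:
  assumes I: "valid_instance I" and ab: "(a, b) \<in> gaps I"
  shows "0 \<le> a" "a < b" "b \<le> of_int (rail I)" "{a<..<b} \<inter> stock I p = {}"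
    "a \<in> {0} \<union> (\<lambda>j. of_int (right I j)) ` (stockpiles I P1 \<union> stockpiles I P2)"
    "b \<in> {of_int (rail I)} \<union> (\<lambda>j. of_int (left I j)) ` (stockpiles I P1 \<union> stockpiles I P2)"
proof -
  let ?L = "of_int (rail I) :: real"
  have L: "?L > 0" using rail_pos[OF I] by simp
  obtain C where C: "C \<in> components (empty_part I)" "closure C = {a..b}"
    using ab unfolding gaps_def by auto
  have ne: "C \<noteq> {}" using C(1) by (rule in_components_nonempty)
  have CE: "C \<subseteq> empty_part I" using C(1) by (rule in_components_subset)
  then have "C \<subseteq> {0..?L}" by (auto simp: empty_part_def)
  then have "{a..b} \<subseteq> {0..?L}" using C(2) by (metis closed_atLeastAtMost closure_minimal)
  moreover have le: "a \<le> b" using ne C(2) by (metis atLeastatMost_empty_iff closure_eq_empty)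
  ultimately show a0: "0 \<le> a" and bL: "b \<le> ?L" by auto
  have Cab: "C \<subseteq> {a..b}" using C(2) closure_subset by metis
  have nbhd: "\<exists>e>0. ball x e \<inter> {0..?L} \<subseteq> {a..b}" if "x \<in> {a..b}" "x \<notin> stock I P1 \<union> stock I P2" for x
  proof -
    have "x \<in> closure C" using that(1) C(2) by simp
    from component_contains_nbhd[OF C(1) this that(2)] obtain e
      where "e > 0" "ball x e \<inter> {0..?L} \<subseteq> C" .
    with Cab show ?thesis by (intro exI[of _ e]) auto
  qed
  show lt: "a < b"
  proof (rule ccontr)
    assume "\<not> a < b"
    then have eq: "a = b" using le by simp
    then have "C = {a}" using ne Cab by auto
    then have "a \<notin> stock I P1 \<union> stock I P2" using CE by (auto simp: empty_part_def)
    with nbhd[of a] eq obtain e where e: "e > 0" "ball a e \<inter> {0..?L} \<subseteq> {a}" by auto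
    \<comment> \<open>A second point of the ball, on whichever side the rail continues; it exists
      because the rail has positive length.\<close>
    define y where "y = (if a < ?L then min ?L (a + e / 2) else max 0 (a - e / 2))"
    have "y \<in> ball a e \<inter> {0..?L}" "y \<noteq> a"
      using e(1) L a0 bL eq by (auto simp: y_def dist_real_def min_def max_def abs_if)
    with e(2) show False by auto
  qed
  \<comment> \<open>\<open>gaps\<close> speaks of closures only. For a convex set, closing adds no
    interior points, so the open interval belongs to \<open>C\<close> itself.\<close>
  have "convex C" using in_components_connected[OF C(1)] by (simp add: connected_convex_1)
  then have "interior (closure C) = interior C" by (rule convex_interior_closure)
  then have "{a<..<b} \<subseteq> C" using C(2) interior_subset[of C] by simp
  then have abE: "{a<..<b} \<inter> (stock I P1 \<union> stock I P2) = {}" using CE by (auto simp: empty_part_def)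
  then show "{a<..<b} \<inter> stock I p = {}" by (cases p) auto
  have inS: "x \<notin> {a<..<b}" if "j \<in> stockpiles I P1 \<union> stockpiles I P2"
      "of_int (left I j) \<le> x" "x \<le> of_int (right I j)" for x j
    using that abE unfolding stock_def by fastforce
  have stockE: "\<exists>j\<in>stockpiles I P1 \<union> stockpiles I P2. of_int (left I j) \<le> x \<and> x \<le> of_int (right I j)"
    if "x \<in> stock I P1 \<union> stock I P2" for x
    using that unfolding stock_def by auto
  have lr: "left I j < right I j" if "j \<in> stockpiles I P1 \<union> stockpiles I P2" for j
    using that stockpile_bounds(2)[OF I] by blast
  show "a \<in> {0} \<union> (\<lambda>j. of_int (right I j)) ` (stockpiles I P1 \<union> stockpiles I P2)"
  proof (cases "a \<in> stock I P1 \<union> stock I P2")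
    case True
    from stockE[OF this] obtain j where j: "j \<in> stockpiles I P1 \<union> stockpiles I P2"
      "of_int (left I j) \<le> a" "a \<le> of_int (right I j)" by blast
    have "\<not> a < of_int (right I j)"
    proof
      assume r: "a < of_int (right I j)"
      \<comment> \<open>If the stockpile extended beyond \<open>a\<close>, this midpoint would lie
        both in it and in the stock-free interior of the gap.\<close>
      define x where "x = (a + min b (of_int (right I j))) / 2"
      have "a < x" "x < b" "x \<le> of_int (right I j)" using r lt by (simp_all add: x_def min_def)
      with inS[OF j(1), of x] j(2) show False by simp
    qed
    then show ?thesis using j by auto
  next
    case False
    from nbhd[OF _ this] le obtain e where e: "e > 0" "ball a e \<inter> {0..?L} \<subseteq> {a..b}" by auto
    have "a = 0"
    proof (rule ccontr)
      assume "a \<noteq> 0"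
      then have in_ball: "max 0 (a - e / 2) \<in> ball a e \<inter> {0..?L}" and "max 0 (a - e / 2) < a"
        using e(1) a0 lt bL by (auto simp: dist_real_def max_def)
      with subsetD[OF e(2) in_ball] show False unfolding atLeastAtMost_iff by linarith
    qed
    then show ?thesis by simp
  qed
  show "b \<in> {?L} \<union> (\<lambda>j. of_int (left I j)) ` (stockpiles I P1 \<union> stockpiles I P2)"
  proof (cases "b \<in> stock I P1 \<union> stock I P2")
    case True
    from stockE[OF this] obtain j where j: "j \<in> stockpiles I P1 \<union> stockpiles I P2"
      "of_int (left I j) \<le> b" "b \<le> of_int (right I j)" by blast
    have "\<not> of_int (left I j) < b"
    proof
      assume r: "of_int (left I j) < b"
      define x where "x = (b + max a (of_int (left I j))) / 2"
      have "a < x" "x < b" "of_int (left I j) \<le> x" using r lt by (simp_all add: x_def max_def)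
      with inS[OF j(1), of x] j(3) show False by simp
    qed
    then show ?thesis using j by auto
  next
    case False
    from nbhd[OF _ this] le obtain e where e: "e > 0" "ball b e \<inter> {0..?L} \<subseteq> {a..b}" by auto
    have "b = ?L"
    proof (rule ccontr)
      assume "b \<noteq> ?L"
      then have in_ball: "min ?L (b + e / 2) \<in> ball b e \<inter> {0..?L}" and "b < min ?L (b + e / 2)"
        using e(1) a0 lt bL by (auto simp: dist_real_def min_def)
      with subsetD[OF e(2) in_ball] show False unfolding atLeastAtMost_iff by linarith
    qed
    then show ?thesis by simp
  qed
qed

text \<open>Ensures that the \<open>Min\<close> in \<open>K_star\<close> is a true minimum.\<close>

lemma finite_gaps:
  assumes "valid_instance I" shows "finite (gaps I)"
proof (rule finite_subset)
  let ?J = "stockpiles I P1 \<union> stockpiles I P2"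
  show "gaps I \<subseteq> ({0} \<union> (\<lambda>j. of_int (right I j)) ` ?J) \<times> ({of_int (rail I)} \<union> (\<lambda>j. of_int (left I j)) ` ?J)"
    using gapsD(5,6)[OF assms] by (intro subrelI SigmaI)
qed auto

text \<open>The component containing the open interval cannot extend past \<open>u\<close>: being an
  interval, it would contain \<open>u\<close>, which is in the stock or at an end of the rail. The
  same holds for \<open>v\<close>.\<close>

lemma split_gap:
  assumes S: "balanced_split I u v" and lt: "u < v"
  shows "(u, v) \<in> gaps I"
proof -
  let ?L = "of_int (rail I) :: real" and ?S = "stock I P1 \<union> stock I P2"
  note S' = S[unfolded balanced_split_def]
  have sub: "{u<..<v} \<subseteq> empty_part I"
    using S' unfolding empty_part_def by auto
  define C where "C = connected_component_set (empty_part I) ((u + v) / 2)"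
  have mid: "(u + v) / 2 \<in> {u<..<v}" using lt by simp
  then have mE: "(u + v) / 2 \<in> empty_part I" using sub by blast
  have C: "C \<in> components (empty_part I)" unfolding C_def using mE by (rule componentsI)
  have uvC: "{u<..<v} \<subseteq> C"
    unfolding C_def by (rule connected_component_maximal[OF mid connected_Ioo sub])
  have conn: "is_interval C"
    using in_components_connected[OF C] by (simp add: is_interval_connected_1)
  have CE: "C \<subseteq> empty_part I" using C by (rule in_components_subset)
  have mC: "(u + v) / 2 \<in> C" using mid uvC by blast
  have CL: "x \<in> C \<Longrightarrow> 0 \<le> x \<and> x \<le> ?L \<and> x \<notin> ?S" for x using CE by (auto simp: empty_part_def)
  have "u \<le> x" if "x \<in> C" for x
  proof (rule ccontr)
    assume "\<not> u \<le> x"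
    then have "u \<in> C" using mem_is_interval_1_I[OF conn that mC, of u] lt by simp
    then show False using CL[of u] CL[OF that] S' lt \<open>\<not> u \<le> x\<close> by auto
  qed
  moreover have "x \<le> v" if "x \<in> C" for x
  proof (rule ccontr)
    assume "\<not> x \<le> v"
    then have "v \<in> C" using mem_is_interval_1_I[OF conn mC that, of v] lt by simp
    then show False using CL[of v] CL[OF that] S' lt \<open>\<not> x \<le> v\<close> by auto
  qed
  ultimately have "C \<subseteq> {u..v}" by auto
  then have "closure C \<subseteq> {u..v}" by (rule closure_minimal) simp
  moreover have "{u..v} \<subseteq> closure C" using closure_mono[OF uvC] lt by simp
  ultimately have "closure C = {u..v}" by (rule equalityI)
  then show ?thesis unfolding gaps_def using C by (metis (mono_tags) case_prodI imageI mem_Collect_eq)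
qed

text \<open>The value of the split is below every candidate and is one itself: \<open>K_gap\<close>
  of its gap if \<open>u < v\<close>, and \<open>K0\<close> if \<open>u = v\<close>.\<close>

lemma split_eq_K_star:
  assumes I: "valid_instance I" and S: "balanced_split I u v"
  shows "max (work I {0..u}) (work I {v..of_int (rail I)}) = K_star I" (is "?V = _")
  unfolding K_star_def
proof (rule Min_eqI[symmetric])
  show "finite (insert (K0 I) (K_gap I ` gaps I))" using finite_gaps[OF I] by simp
next
  fix y assume "y \<in> insert (K0 I) (K_gap I ` gaps I)"
  then consider "y = K0 I" | g where "g \<in> gaps I" "y = K_gap I g" by blast
  then show "?V \<le> y"
  proof cases
    case 1 then show ?thesis using split_le_K0[OF I S] by simp
  next
    case (2 g)
    obtain a b where g: "g = (a, b)" by (cases g)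
    show ?thesis
      using split_le_empty_interval[OF I S gapsD(1-4)[OF I]] 2 unfolding g by simp
  qed
next
  show "?V \<in> insert (K0 I) (K_gap I ` gaps I)"
  proof (cases "u < v")
    case True
    then have "K_gap I (u, v) \<in> K_gap I ` gaps I" using split_gap[OF S] by (intro imageI)
    then show ?thesis by simp
  next
    case False
    then have "u = v" using S by (simp add: balanced_split_def)
    then have "work I {0..u} = K0 I" "work I {v..of_int (rail I)} = K0 I"
      using S work_complement[OF I, of v] by (simp_all add: balanced_split_def)
    then show ?thesis by simp
  qed
qed

subsection \<open>Trips and the schedules they define\<close>

fun dir :: "pad \<Rightarrow> direction" where
  "dir P1 = Rightward"
| "dir P2 = Leftward"

fun other :: "pad \<Rightarrow> pad" where
  "other P1 = P2"
| "other P2 = P1"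

text \<open>The end of \<open>[lo, hi]\<close> where a leg in direction \<open>dir p\<close> begins.
  A trip of the left reclaimer thus starts with \<open>P1\<close>, one of the right reclaimer with
  \<open>P2\<close>.\<close>

fun origin :: "pad \<Rightarrow> real \<Rightarrow> real \<Rightarrow> real" where
  "origin P1 lo hi = lo"
| "origin P2 lo hi = hi"

text \<open>
  The arrays \<open>b\<close>, \<open>y\<close> and \<open>a\<close> hold breakpoints, positions and action codes, as in the output format.
\<close>

definition stage ::
  "instance_data \<Rightarrow> real \<Rightarrow> real \<Rightarrow> pad \<Rightarrow> (nat \<Rightarrow> real) \<Rightarrow> (nat \<Rightarrow> real) \<Rightarrow> (nat \<Rightarrow> real) \<Rightarrow> nat \<Rightarrow> bool" where
  "stage I lo hi p b y a k \<longleftrightarrow>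
     b k < b (Suc k) \<and> y (Suc k) \<in> {lo..hi} \<and> y (Suc k) \<in> stock I p \<union> {lo, hi} \<and>
     (\<exists>act. a k = action_code act \<and> y (Suc k) = y k + slope (speed I) act * (b (Suc k) - b k) \<and>
        (act = Reclaim p (dir p) \<and> closed_segment (y k) (y (Suc k)) \<subseteq> stock I p \<or>
         act = Travel (dir p) \<and> open_segment (y k) (y (Suc k)) \<inter> stock I p = {}))"

text \<open>Node \<open>k\<close> is the turning point. The way out serves \<open>p\<close> and the
  way back the other pad, so that each pad is swept exactly once.\<close>

definition trip ::
  "instance_data \<Rightarrow> real \<Rightarrow> real \<Rightarrow> pad \<Rightarrow> nat \<Rightarrow> nat \<Rightarrow> (nat \<Rightarrow> real) \<Rightarrow> (nat \<Rightarrow> real) \<Rightarrow> (nat \<Rightarrow> real) \<Rightarrow> bool" where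
  "trip I lo hi p k m b y a \<longleftrightarrow> k \<le> m \<and> b 0 = 0 \<and>
     y 0 = origin p lo hi \<and> y k = origin (other p) lo hi \<and> y m = origin p lo hi \<and>
     (\<forall>i<k. stage I lo hi p b y a i) \<and> (\<forall>i\<in>{k..<m}. stage I lo hi (other p) b y a i)"

section \<open>Duration and coverage of a leg\<close>

lemma sign_sq: "sign d * sign d = 1" by (cases d) auto

lemma stage_forward:
  assumes "valid_instance I" "stage I lo hi p b y a k"
  shows "sign (dir p) * (y (Suc k) - y k) > 0"
proof -
  from assms(2) obtain act where act: "b k < b (Suc k)"
    "y (Suc k) = y k + slope (speed I) act * (b (Suc k) - b k)"
    "act = Reclaim p (dir p) \<or> act = Travel (dir p)" unfolding stage_def by blast
  have s: "speed I > 0" using speed_ge_1[OF assms(1)] by simp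
  from act(3) have "sign (dir p) * slope (speed I) act > 0"
    using s by (auto simp: sign_sq mult.assoc[symmetric])
  then have "sign (dir p) * slope (speed I) act * (b (Suc k) - b k) > 0"
    by (rule mult_pos_pos) (use act(1) in simp)
  then show ?thesis unfolding act(2) by (simp add: algebra_simps)
qed

lemma ptime_segment_inside:
  "closed_segment x y \<subseteq> stock I p \<Longrightarrow> ptime I p (closed_segment x y) = \<bar>y - x\<bar>"
  using ptime_inside[of x y I p] ptime_inside[of y x I p]
  by (cases "x \<le> y") (simp_all add: closed_segment_eq_real_ivl)

lemma ptime_segment_outside:
  "open_segment x y \<inter> stock I p = {} \<Longrightarrow> ptime I p (closed_segment x y) = \<bar>y - x\<bar> / speed I"
  using ptime_outside[of x y I p] ptime_outside[of y x I p]
  by (cases "x \<le> y") (simp_all add: closed_segment_eq_real_ivl open_segment_eq_real_ivl)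

text \<open>There is no slack because every piece is homogeneous for its pad: it reclaims inside the
  stock or travels outside it.\<close>

lemma stage_duration:
  assumes "valid_instance I" "stage I lo hi p b y a k"
  shows "b (Suc k) - b k = ptime I p (closed_segment (y k) (y (Suc k)))"
proof -
  from assms(2) obtain act where act: "b k < b (Suc k)"
    "y (Suc k) = y k + slope (speed I) act * (b (Suc k) - b k)"
    "act = Reclaim p (dir p) \<and> closed_segment (y k) (y (Suc k)) \<subseteq> stock I p \<or>
         act = Travel (dir p) \<and> open_segment (y k) (y (Suc k)) \<inter> stock I p = {}"
    unfolding stage_def by blast
  have s: "speed I > 0" using speed_ge_1[OF assms(1)] by simp
  have d: "\<bar>y (Suc k) - y k\<bar> = \<bar>slope (speed I) act\<bar> * (b (Suc k) - b k)"
    using act(1,2) by (simp add: abs_mult)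
  from act(3) show ?thesis
  proof (elim disjE conjE)
    assume "act = Reclaim p (dir p)" "closed_segment (y k) (y (Suc k)) \<subseteq> stock I p"
    then show ?thesis using d by (simp add: ptime_segment_inside)
  next
    assume "act = Travel (dir p)" "open_segment (y k) (y (Suc k)) \<inter> stock I p = {}"
    then show ?thesis using d s by (simp add: ptime_segment_outside abs_mult)
  qed
qed

lemma ptime_segment_add:
  assumes "e * (y - x) \<ge> 0" "e * (z - y) \<ge> 0" "e = 1 \<or> e = -1"
  shows "ptime I p (closed_segment x z) = ptime I p (closed_segment x y) + ptime I p (closed_segment y z)"
proof (cases "e = 1")
  case True
  then have "x \<le> y" "y \<le> z" using assms by auto
  then show ?thesis using ptime_add[of x y z I p] by (simp add: closed_segment_eq_real_ivl)
next
  case False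
  then have "z \<le> y" "y \<le> x" using assms by auto
  then have "closed_segment x z = {z..x}" "closed_segment x y = {y..x}" "closed_segment y z = {z..y}"
    by (auto simp: closed_segment_eq_real_ivl)
  then show ?thesis using ptime_add[OF \<open>z \<le> y\<close> \<open>y \<le> x\<close>, of I p] by simp
qed

text \<open>The sign condition is carried through the induction since \<open>ptime\<close> adds up
  over consecutive segments only if they run in the same direction.\<close>

lemma leg_duration:
  assumes I: "valid_instance I" and "i \<le> j" "\<forall>k\<in>{i..<j}. stage I lo hi p b y a k"
  shows "b j - b i = ptime I p (closed_segment (y i) (y j)) \<and> sign (dir p) * (y j - y i) \<ge> 0"
  using assms(2,3)
proof (induction j rule: dec_induct)
  case base
  show ?case by (simp add: ptime_def negligible_imp_measure0[OF negligible_Int])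
next
  case (step j)
  then have IH: "b j - b i = ptime I p (closed_segment (y i) (y j))" "sign (dir p) * (y j - y i) \<ge> 0"
    and st: "stage I lo hi p b y a j" by simp_all
  have fw: "sign (dir p) * (y (Suc j) - y j) \<ge> 0" using stage_forward[OF I st] by simp
  have "sign (dir p) = 1 \<or> sign (dir p) = -1" by (cases "dir p") auto
  from ptime_segment_add[OF IH(2) fw this, of I p] IH stage_duration[OF I st] fw
  show ?case by (simp add: algebra_simps)
qed

text \<open>A point that is not a node is interior to some piece, and the interior of a travelling
  piece is free of stock.\<close>

lemma leg_reclaims:
  assumes I: "valid_instance I" and "i \<le> j" "\<forall>k\<in>{i..<j}. stage I lo hi p b y a k"
    and x: "x \<in> closed_segment (y i) (y j)" "x \<in> stock I p" "\<forall>k\<in>{i..j}. x \<noteq> y k"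
  shows "\<exists>k\<in>{i..<j}. a k = action_code (Reclaim p (dir p)) \<and> x \<in> closed_segment (y k) (y (Suc k))"
proof -
  have "(y i < x) \<noteq> (y j < x)"
    using x(1) x(3) assms(2) by (cases "y i \<le> y j") (force simp: closed_segment_eq_real_ivl)+
  from change_between[OF assms(2), of "\<lambda>k. y k < x", OF this]
  obtain k where k: "i \<le> k" "k < j" "(y k < x) \<noteq> (y (Suc k) < x)" by (elim exE conjE)
  have ne: "x \<noteq> y k" "x \<noteq> y (Suc k)" using x(3) k(1,2) by auto
  have os: "x \<in> open_segment (y k) (y (Suc k))"
    using k(3) ne by (cases "y k < x") (simp_all add: open_segment_eq_real_ivl)
  have "stage I lo hi p b y a k" using assms(3) k by simp
  then have "a k = action_code (Reclaim p (dir p)) \<or> open_segment (y k) (y (Suc k)) \<inter> stock I p = {}"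
    unfolding stage_def by blast
  then have "a k = action_code (Reclaim p (dir p))" using os x(2) by blast
  then show ?thesis using os k by (intro bexI[of _ k]) (simp_all add: open_segment_def)
qed

section \<open>Schedules from arrays of nodes\<close>

lemma breaks_mono:
  fixes b :: "nat \<Rightarrow> real"
  assumes "\<forall>k<m. b k < b (Suc k)" "i \<le> j" "j \<le> m" shows "b i \<le> b j"
  using assms(2,3)
proof (induction j rule: dec_induct)
  case (step n)
  then have "b n < b (Suc n)" using assms(1) by simp
  with step show ?case by simp
qed simp

text \<open>
  The position is written as a sum of clamped linear terms, which makes continuity evident.
\<close>

definition path_schedule :: "real \<Rightarrow> nat \<Rightarrow> (nat \<Rightarrow> real) \<Rightarrow> (nat \<Rightarrow> real) \<Rightarrow> (nat \<Rightarrow> action) \<Rightarrow> schedule" where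
  "path_schedule s m b y act = \<lparr>finish = b m,
     pos = (\<lambda>t. y 0 + (\<Sum>k<m. slope s (act k) * max 0 (min t (b (Suc k)) - b k))),
     breaks = map b [0..<Suc m], actions = map act [0..<m]\<rparr>"

text \<open>At a time in piece \<open>j\<close> the terms of earlier pieces are saturated and those
  of later pieces are still 0.\<close>

lemma pos_path:
  assumes b: "\<forall>k<m. b k < b (Suc k)" and y: "\<forall>k<m. y (Suc k) = y k + slope s (act k) * (b (Suc k) - b k)"
    and j: "j < m" and t: "t \<in> {b j..b (Suc j)}"
  shows "pos (path_schedule s m b y act) t = y j + slope s (act j) * (t - b j)"
proof -
  let ?f = "\<lambda>k. slope s (act k) * max 0 (min t (b (Suc k)) - b k)"
  have yj: "y i = y 0 + (\<Sum>k<i. slope s (act k) * (b (Suc k) - b k))" if "i \<le> m" for i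
    using that y by (induction i) auto
  have "sum ?f {..<m} = sum ?f {..<j} + ?f j + sum ?f {Suc j..<m}"
    using sum.atLeastLessThan_concat[of 0 j m ?f] sum.atLeast_Suc_lessThan[OF j, of ?f] j
    by (simp add: lessThan_atLeast0 algebra_simps)
  moreover have "sum ?f {..<j} = (\<Sum>k<j. slope s (act k) * (b (Suc k) - b k))"
  proof (rule sum.cong[OF refl])
    fix k assume "k \<in> {..<j}"
    then have "b (Suc k) \<le> t" "b k < b (Suc k)" using breaks_mono[OF b, of "Suc k" j] b j t by auto
    then show "?f k = slope s (act k) * (b (Suc k) - b k)" by simp
  qed
  moreover have "sum ?f {Suc j..<m} = 0"
  proof (rule sum.neutral, rule ballI)
    fix k assume "k \<in> {Suc j..<m}"
    then have "t \<le> b k" using breaks_mono[OF b, of "Suc j" k] t by auto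
    then show "?f k = 0" by simp
  qed
  moreover have "?f j = slope s (act j) * (t - b j)" using t by simp
  ultimately show ?thesis using yj[of j] j by (simp add: path_schedule_def)
qed

lemma pos_path_node:
  assumes b: "\<forall>k<m. b k < b (Suc k)" and y: "\<forall>k<m. y (Suc k) = y k + slope s (act k) * (b (Suc k) - b k)"
    and j: "j \<le> m"
  shows "pos (path_schedule s m b y act) (b j) = y j"
proof (cases j)
  case 0
  have "max 0 (min (b 0) (b (Suc k)) - b k) = 0" if "k < m" for k
    using breaks_mono[OF b, of 0 k] that by simp
  then show ?thesis using 0 by (simp add: path_schedule_def)
next
  case (Suc i)
  then show ?thesis
    using pos_path[OF b y, of i "b (Suc i)"] b y j by (simp add: less_imp_le)
qed

lemma pos_path_after:
  assumes b: "\<forall>k<m. b k < b (Suc k)" and y: "\<forall>k<m. y (Suc k) = y k + slope s (act k) * (b (Suc k) - b k)"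
    and t: "b m \<le> t"
  shows "pos (path_schedule s m b y act) t = y m"
proof -
  have "pos (path_schedule s m b y act) t = pos (path_schedule s m b y act) (b m)"
  proof -
    have "min t (b (Suc k)) = min (b m) (b (Suc k))" if "k < m" for k
      using breaks_mono[OF b, of "Suc k" m] that t by simp
    then show ?thesis by (simp add: path_schedule_def)
  qed
  then show ?thesis using pos_path_node[OF b y, of m] by simp
qed

lemma path_piece_exists:
  fixes b :: "nat \<Rightarrow> real"
  assumes "b 0 \<le> t" "t \<le> b m" "0 < m"
  shows "\<exists>j<m. t \<in> {b j..b (Suc j)}"
  using assms
proof (induction m)
  case (Suc m)
  then show ?case
  proof (cases "t \<le> b m \<and> 0 < m")
    case True
    with Suc show ?thesis using less_SucI by blast
  next
    case False
    with Suc.prems have "b m \<le> t" by (cases m) auto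
    with Suc.prems show ?thesis by (intro exI[of _ m]) simp
  qed
qed simp

lemma pos_path_piece_image:
  assumes b: "\<forall>k<m. b k < b (Suc k)" and y: "\<forall>k<m. y (Suc k) = y k + slope s (act k) * (b (Suc k) - b k)"
    and j: "j < m"
  shows "pos (path_schedule s m b y act) ` {b j..b (Suc j)} = closed_segment (y j) (y (Suc j))"
proof -
  have le: "b j \<le> b (Suc j)" using b j by (simp add: less_imp_le)
  have "pos (path_schedule s m b y act) t = pos (path_schedule s m b y act) (b j) + slope s (act j) * (t - b j)"
    if "t \<in> {b j..b (Suc j)}" for t
    using pos_path[OF b y j that] pos_path_node[OF b y, of j] j by simp
  from linear_image_segment[OF le this] show ?thesis
    using pos_path_node[OF b y, of j] pos_path_node[OF b y, of "Suc j"] j by simp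
qed

lemma path_range:
  assumes b: "\<forall>k<m. b k < b (Suc k)" and y: "\<forall>k<m. y (Suc k) = y k + slope s (act k) * (b (Suc k) - b k)"
    and r: "\<forall>k\<le>m. y k \<in> {lo..hi}" and t: "t \<in> {b 0..b m}"
  shows "pos (path_schedule s m b y act) t \<in> {lo..hi}"
proof (cases "m = 0")
  case True
  then show ?thesis using r by (simp add: path_schedule_def)
next
  case False
  with t path_piece_exists[of b t m] obtain j where j: "j < m" "t \<in> {b j..b (Suc j)}" by auto
  have "pos (path_schedule s m b y act) t \<in> closed_segment (y j) (y (Suc j))"
    using pos_path_piece_image[OF b y j(1)] j(2) by blast
  moreover have "closed_segment (y j) (y (Suc j)) \<subseteq> {lo..hi}"
    by (rule closed_segment_subset) (use r j(1) in auto)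
  ultimately show ?thesis by blast
qed

lemma schedule_of_path:
  assumes b: "\<forall>k<m. b k < b (Suc k)"
    and y: "\<forall>k<m. y (Suc k) = y k + slope (speed I) (act k) * (b (Suc k) - b k)"
    and r: "\<forall>k\<le>m. y k \<in> {0..of_int (rail I)}" and b0: "b 0 = 0"
    and e: "y 0 = real q * of_int (rail I)" "y m = real q * of_int (rail I)"
  shows "schedule_of I q (path_schedule (speed I) m b y act)"
proof -
  let ?H = "path_schedule (speed I) m b y act"
  have fin: "finish ?H = b m" and brk: "breaks ?H = map b [0..<Suc m]" and acts: "actions ?H = map act [0..<m]"
    by (simp_all only: path_schedule_def schedule.simps)
  have nth: "breaks ?H ! j = b j" if "j \<le> m" for j using that unfolding brk by (simp del: upt_Suc)
  have len: "length (actions ?H) = m" "length (breaks ?H) = m + 1" unfolding brk acts by simp_all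
  have pc: "breaks ?H ! j < breaks ?H ! (j + 1) \<and>
        (\<forall>t\<in>piece ?H j. pos ?H t = pos ?H (breaks ?H ! j) + slope (speed I) (actions ?H ! j) * (t - breaks ?H ! j))"
    if j: "j < m" for j
  proof -
    have a: "actions ?H ! j = act j" using j unfolding acts by simp
    have n: "breaks ?H ! j = b j" "breaks ?H ! (j + 1) = b (Suc j)" using nth[of j] nth[of "Suc j"] j by simp_all
    show ?thesis unfolding a n using b j pos_path[OF b y j] pos_path_node[OF b y, of j] by simp
  qed
  show ?thesis unfolding schedule_of_def
  proof (intro conjI allI impI)
    show "0 \<le> finish ?H" using breaks_mono[OF b, of 0 m] b0 fin by simp
    show "continuous_on {0..finish ?H} (pos ?H)"
      by (simp only: path_schedule_def schedule.simps) (intro continuous_intros)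
    show "pos ?H ` {0..finish ?H} \<subseteq> {0..of_int (rail I)}"
      using path_range[OF b y r] unfolding fin b0 by blast
    show "pos ?H 0 = real q * of_int (rail I)" using pos_path_node[OF b y, of 0] b0 e by simp
    show "pos ?H t = real q * of_int (rail I)" if "finish ?H \<le> t" for t
      using pos_path_after[OF b y, of t] that e fin by simp
    show "length (breaks ?H) = length (actions ?H) + 1" using len by simp
    show "breaks ?H ! 0 = 0" using nth[of 0] b0 by simp
    show "breaks ?H ! length (actions ?H) = finish ?H" using nth[of m] len fin by simp
    fix j assume "j < length (actions ?H)"
    then have j: "j < m" using len by simp
    show "breaks ?H ! j < breaks ?H ! (j + 1)" by (rule conjunct1[OF pc[OF j]])
    show "\<forall>t\<in>piece ?H j. pos ?H t = pos ?H (breaks ?H ! j) + slope (speed I) (actions ?H ! j) * (t - breaks ?H ! j)"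
      by (rule conjunct2[OF pc[OF j]])
  qed
qed

section \<open>From trips to optimal schedules\<close>

lemma action_code_inject: "action_code x = action_code y \<Longrightarrow> x = y"
  by (cases x rule: action_code.cases; cases y rule: action_code.cases) simp_all

lemma stageD:
  assumes "stage I lo hi p b y a k"
  shows "b k < b (Suc k)" "y (Suc k) \<in> {lo..hi}"
    "\<exists>act. action_code act = a k \<and> y (Suc k) = y k + slope (speed I) act * (b (Suc k) - b k)"
  using assms unfolding stage_def by auto

text \<open>Serves to extend coverage from generic points to the nodes.\<close>

lemma Icc_subset_closure_minus_finite:
  fixes c e :: real
  assumes "c < e" "finite N"
  shows "{c..e} \<subseteq> closure ({c<..<e} - N)"
proof -
  have "interior N = {}" using assms(2) by (simp add: empty_interior_finite)
  then have "closure (- N) = UNIV" by (simp add: closure_complement)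
  then have "closure ({c<..<e} \<inter> - N) = closure {c<..<e}"
    by (intro closure_open_Int_superset) simp_all
  with assms(1) show ?thesis by (simp add: Diff_eq)
qed

text \<open>Coverage is stated for nondegenerate intervals, since a stockpile that meets
  \<open>[lo, hi]\<close> in one end point need not be reclaimed there. Within such an interval all
  points but the nodes lie in reclaiming pieces, and the union of these pieces is closed.\<close>

lemma trip_schedule:
  assumes I: "valid_instance I" and T: "trip I lo hi p k m b y a"
    and lh: "0 \<le> lo" "lo \<le> hi" "hi \<le> of_int (rail I)" and q: "origin p lo hi = real q * of_int (rail I)"
  obtains H where "schedule_of I q H" "finish H = work I {lo..hi}" "length (actions H) = m"
    "\<And>j. j \<le> m \<Longrightarrow> breaks H ! j = b j \<and> pos H (breaks H ! j) = y j"
    "\<And>j. j < m \<Longrightarrow> action_code (actions H ! j) = a j"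
    "\<And>t. t \<in> {0..finish H} \<Longrightarrow> pos H t \<in> {lo..hi}"
    "\<And>r c e x. c < e \<Longrightarrow> {c..e} \<subseteq> {lo..hi} \<Longrightarrow> {c..e} \<subseteq> stock I r \<Longrightarrow> x \<in> {c..e} \<Longrightarrow> reclaims H r x"
proof -
  note T' = T[unfolded trip_def]
  have km: "k \<le> m" and b0: "b 0 = 0" and y0: "y 0 = origin p lo hi" and yk: "y k = origin (other p) lo hi"
    and ym: "y m = origin p lo hi" using T' by simp_all
  have leg1: "\<forall>i\<in>{0..<k}. stage I lo hi p b y a i" and leg2: "\<forall>i\<in>{k..<m}. stage I lo hi (other p) b y a i"
    using T' by simp_all
  have st: "\<exists>p. stage I lo hi p b y a i" if "i < m" for i
    using leg1 leg2 that by (cases "i < k") auto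
  have bm: "\<forall>i<m. b i < b (Suc i)" using st stageD(1) by blast
  have "\<forall>i. \<exists>act. i < m \<longrightarrow> action_code act = a i \<and> y (Suc i) = y i + slope (speed I) act * (b (Suc i) - b i)"
    using st stageD(3) by blast
  then obtain act where act: "\<And>i. i < m \<Longrightarrow> action_code (act i) = a i"
    "\<forall>i<m. y (Suc i) = y i + slope (speed I) (act i) * (b (Suc i) - b i)" by metis
  have orr: "origin p lo hi \<in> {lo..hi}" using lh by (cases p) auto
  have yr: "\<forall>i\<le>m. y i \<in> {lo..hi}"
  proof (intro allI impI)
    fix i assume i: "i \<le> m"
    show "y i \<in> {lo..hi}"
    proof (cases i)
      case 0 then show ?thesis using y0 orr by simp
    next
      case (Suc j)
      then obtain p where "stage I lo hi p b y a j" using st i by fastforce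
      then show ?thesis using stageD(2) Suc by simp
    qed
  qed
  define H where "H = path_schedule (speed I) m b y act"
  have "\<forall>i\<le>m. y i \<in> {0..of_int (rail I)}" using yr lh by fastforce
  then have sch: "schedule_of I q H"
    unfolding H_def by (intro schedule_of_path bm act(2) b0) (simp_all add: y0 ym q)
  have acts: "actions H = map act [0..<m]" and brk: "breaks H = map b [0..<Suc m]" and fin: "finish H = b m"
    unfolding H_def path_schedule_def by (simp_all only: schedule.simps)
  have len: "length (actions H) = m" unfolding acts by simp
  have nodes: "breaks H ! j = b j \<and> pos H (breaks H ! j) = y j" if j: "j \<le> m" for j
  proof -
    have "breaks H ! j = b j" using j unfolding brk by (simp del: upt_Suc)
    then show ?thesis using pos_path_node[OF bm act(2) j] by (simp add: H_def)
  qed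
  have codes: "action_code (actions H ! j) = a j" if "j < m" for j
    using act(1) that unfolding acts by simp
  have range: "pos H t \<in> {lo..hi}" if "t \<in> {0..finish H}" for t
    unfolding H_def by (rule path_range[OF bm act(2) yr]) (use that fin b0 in simp)
  have seg: "closed_segment (origin r lo hi) (origin (other r) lo hi) = {lo..hi}" for r
    using lh(2) by (cases r) (auto simp: closed_segment_eq_real_ivl)
  have oo: "other (other p) = p" by (cases p) auto
  have d1: "b k - b 0 = ptime I p {lo..hi}"
    using leg_duration[OF I le0 leg1] unfolding y0 yk seg by simp
  have d2: "b m - b k = ptime I (other p) {lo..hi}"
    using leg_duration[OF I km leg2] seg[of "other p"] unfolding ym yk oo by simp
  have fw: "finish H = work I {lo..hi}"
    using d1 d2 b0 lh unfolding fin by (cases p) (simp_all add: work_ivl[OF I])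
  have rec: "reclaims H r x" if ce: "c < e" "{c..e} \<subseteq> {lo..hi}" "{c..e} \<subseteq> stock I r" and x: "x \<in> {c..e}" for r c e x
  proof -
    let ?R = "\<Union>j\<in>{j. j < m \<and> (\<exists>d. actions H ! j = Reclaim r d)}. stretch H j"
    have R: "reclaims H r x \<longleftrightarrow> x \<in> ?R" for x
    proof -
      have "x \<in> pos H ` piece H j \<longleftrightarrow> x \<in> stretch H j" if "j < m" for j
        using pos_image_piece[OF sch, of j] len that by simp
      then show ?thesis unfolding reclaims_def len by blast
    qed
    have "closed ?R" by (intro closed_UN closed_segment) auto
    moreover have "{c<..<e} - y ` {..m} \<subseteq> ?R"
    proof
      fix z assume z: "z \<in> {c<..<e} - y ` {..m}"
      then have zl: "z \<in> {lo..hi}" and zs: "z \<in> stock I r" using ce by auto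
      have "\<exists>j<m. a j = action_code (Reclaim r (dir r)) \<and> z \<in> closed_segment (y j) (y (Suc j))"
      proof (cases "r = p")
        case True
        have "z \<in> closed_segment (y 0) (y k)" unfolding y0 yk seg by (rule zl)
        from leg_reclaims[OF I le0 leg1 this] zs z km True show ?thesis by fastforce
      next
        case False
        then have r: "r = other p" by (cases p; cases r) auto
        have "z \<in> closed_segment (y k) (y m)" using zl seg[of "other p"] unfolding ym yk oo by simp
        from leg_reclaims[OF I km leg2 this] zs z r show ?thesis by fastforce
      qed
      then obtain j where j: "j < m" "a j = action_code (Reclaim r (dir r))" "z \<in> closed_segment (y j) (y (Suc j))"
        by blast
      have "actions H ! j = Reclaim r (dir r)" using codes[OF j(1)] j(2) by (intro action_code_inject) simp
      then show "z \<in> ?R" using j nodes[of j] nodes[of "Suc j"] by auto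
    qed
    ultimately have "closure ({c<..<e} - y ` {..m}) \<subseteq> ?R" by (rule closure_minimal[rotated])
    moreover have "x \<in> closure ({c<..<e} - y ` {..m})"
      using Icc_subset_closure_minus_finite[OF ce(1), of "y ` {..m}"] x by auto
    ultimately show ?thesis unfolding R by (rule subsetD)
  qed
  show thesis by (rule that[OF sch fw len nodes codes range rec])
qed

lemma trips_optimal:
  assumes I: "valid_instance I" and S: "balanced_split I u v"
    and T0: "trip I 0 u P1 k0 m0 b0 y0 a0" and T1: "trip I v (of_int (rail I)) P2 k1 m1 b1 y1 a1"
  obtains H0 H1 where "optimal I (H0, H1)" "makespan (H0, H1) = K_star I"
    "length (actions H0) = m0" "length (actions H1) = m1"
    "\<And>j. j \<le> m0 \<Longrightarrow> breaks H0 ! j = b0 j \<and> pos H0 (breaks H0 ! j) = y0 j"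
    "\<And>j. j < m0 \<Longrightarrow> action_code (actions H0 ! j) = a0 j"
    "\<And>j. j \<le> m1 \<Longrightarrow> breaks H1 ! j = b1 j \<and> pos H1 (breaks H1 ! j) = y1 j"
    "\<And>j. j < m1 \<Longrightarrow> action_code (actions H1 ! j) = a1 j"
proof -
  let ?L = "of_int (rail I) :: real"
  note S' = S[unfolded balanced_split_def]
  have uv: "0 \<le> u" "u \<le> v" "v \<le> ?L" and L: "?L > 0" using S' rail_pos[OF I] by simp_all
  have u: "u \<le> ?L" and v: "0 \<le> v" using uv by linarith+
  have or0: "origin P1 0 u = real 0 * ?L" and or1: "origin P2 v ?L = real 1 * ?L" by simp_all
  obtain H0 where H0: "schedule_of I 0 H0" "finish H0 = work I {0..u}" "length (actions H0) = m0"
    "\<And>j. j \<le> m0 \<Longrightarrow> breaks H0 ! j = b0 j \<and> pos H0 (breaks H0 ! j) = y0 j"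
    "\<And>j. j < m0 \<Longrightarrow> action_code (actions H0 ! j) = a0 j"
    "\<And>t. t \<in> {0..finish H0} \<Longrightarrow> pos H0 t \<in> {0..u}"
    "\<And>r c e x. c < e \<Longrightarrow> {c..e} \<subseteq> {0..u} \<Longrightarrow> {c..e} \<subseteq> stock I r \<Longrightarrow> x \<in> {c..e} \<Longrightarrow> reclaims H0 r x"
    by (rule trip_schedule[OF I T0 order_refl uv(1) u or0]) (assumption | blast)+
  obtain H1 where H1: "schedule_of I 1 H1" "finish H1 = work I {v..?L}" "length (actions H1) = m1"
    "\<And>j. j \<le> m1 \<Longrightarrow> breaks H1 ! j = b1 j \<and> pos H1 (breaks H1 ! j) = y1 j"
    "\<And>j. j < m1 \<Longrightarrow> action_code (actions H1 ! j) = a1 j"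
    "\<And>t. t \<in> {0..finish H1} \<Longrightarrow> pos H1 t \<in> {v..?L}"
    "\<And>r c e x. c < e \<Longrightarrow> {c..e} \<subseteq> {v..?L} \<Longrightarrow> {c..e} \<subseteq> stock I r \<Longrightarrow> x \<in> {c..e} \<Longrightarrow> reclaims H1 r x"
    by (rule trip_schedule[OF I T1 v uv(3) order_refl or1]) (assumption | blast)+
  have after: "pos H t = real q * ?L" if "schedule_of I q H" "finish H \<le> t" for q H t
    using that unfolding schedule_of_def by simp
  have nc: "pos H0 t \<le> pos H1 t" if "0 \<le> t" for t
  proof -
    have "pos H0 t \<le> u"
      using H0(6)[of t] after[OF H0(1), of t] that uv(1) by (cases "t \<le> finish H0") auto
    moreover have "v \<le> pos H1 t"
      using H1(6)[of t] after[OF H1(1), of t] that uv(3) by (cases "t \<le> finish H1") auto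
    ultimately show ?thesis using uv(2) by linarith
  qed
  have cov: "reclaims H0 p x \<or> reclaims H1 p x" if xs: "x \<in> stock I p" for p x
  proof -
    obtain j where j: "j \<in> stockpiles I p" "x \<in> {of_int (left I j)..of_int (right I j)}"
      using xs unfolding stock_def by blast
    define l r where "l = (of_int (left I j) :: real)" and "r = (of_int (right I j) :: real)"
    have lr: "0 \<le> l" "l < r" "r \<le> ?L" and x: "l \<le> x" "x \<le> r"
      using stockpile_bounds[OF I j(1)] j(2) unfolding l_def r_def by simp_all
    have sub: "{l..r} \<subseteq> stock I p" unfolding stock_def l_def r_def using j(1) by blast
    have "x \<notin> {u<..<v}" using xs S' by blast
    moreover have gap: "\<not> (u < z \<and> z < v)" if "l \<le> z" "z \<le> r" for z
    proof
      assume "u < z \<and> z < v"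
      then have "z \<in> {u<..<v} \<inter> stock I p" using sub that by auto
      then show False using S' by blast
    qed
    ultimately have "x \<le> u \<or> v \<le> x" by auto
    \<comment> \<open>Picks a side on which the stockpile has positive length. If
      \<open>x \<le> u\<close> but the stockpile does not begin before \<open>u\<close>, then
      \<open>x = l = u\<close>; either \<open>u = v\<close>, and the right reclaimer serves it, or
      the points just right of \<open>l\<close> would be stock inside the gap.\<close>
    then have "x \<le> u \<and> l < u \<or> v \<le> x \<and> v < r"
    proof
      assume xu: "x \<le> u"
      show ?thesis
      proof (rule ccontr)
        assume n: "\<not> ?thesis"
        then have eq: "u = l" "x = l" using x xu by auto
        then have "u < v" using n lr uv(2) by auto
        then have "l < (l + min v r) / 2" "(l + min v r) / 2 \<le> r" "(l + min v r) / 2 < v"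
          using lr eq by (simp_all add: min_def)
        then show False using gap[of "(l + min v r) / 2"] eq by simp
      qed
    next
      assume xv: "v \<le> x"
      show ?thesis
      proof (rule ccontr)
        assume n: "\<not> ?thesis"
        then have eq: "v = r" "x = r" using x xv by auto
        then have "u < v" using n lr uv(2) by auto
        then have "(r + max l u) / 2 < r" "l \<le> (r + max l u) / 2" "u < (r + max l u) / 2"
          using lr eq by (simp_all add: max_def)
        then show False using gap[of "(r + max l u) / 2"] eq by simp
      qed
    qed
    then consider "x \<le> u" "l < u" | "v \<le> x" "v < r" by blast
    then show ?thesis
    proof cases
      case 1
      then have "reclaims H0 p x"
        using lr x sub by (intro H0(7)[of l "min r u"]) auto
      then show ?thesis ..
    next
      case 2
      then have "reclaims H1 p x"
        using lr x sub by (intro H1(7)[of "max l v" r]) auto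
      then show ?thesis ..
    qed
  qed
  have feas: "preemptive_schedule I (H0, H1)" using H0(1) H1(1) nc cov by simp
  have mk: "makespan (H0, H1) = max (work I {0..u}) (work I {v..?L})" using H0(2) H1(2) by simp
  have opt: "optimal I (H0, H1)"
    unfolding optimal_def is_arg_min_linorder
    using feas split_le_makespan[OF I S] unfolding mk by blast
  show thesis
    by (rule that[OF opt mk[unfolded split_eq_K_star[OF I S]] H0(3) H1(3) H0(4,5) H1(4,5)])
qed

subsection \<open>While programs\<close>

fun loop_free :: "com \<Rightarrow> bool" where
  "loop_free (Seq c d) \<longleftrightarrow> loop_free c \<and> loop_free d"
| "loop_free (If b c d) \<longleftrightarrow> loop_free c \<and> loop_free d"
| "loop_free (While b c) \<longleftrightarrow> False"
| "loop_free _ \<longleftrightarrow> True"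

text \<open>A functional semantics for loop-free programs, which simplification can evaluate
  symbolically; \<open>While\<close> gets a dummy value.\<close>

fun exec :: "com \<Rightarrow> state \<Rightarrow> state" where
  "exec Skip st = st"
| "exec (SetReg x e) st = st\<lparr>reg := (reg st)(x := ival e st)\<rparr>"
| "exec (SetArr a e f) st = st\<lparr>arr := (arr st)(a := (arr st a)(ival e st := rval f st))\<rparr>"
| "exec (Seq c d) st = exec d (exec c st)"
| "exec (If b c d) st = (if bval b st then exec c st else exec d st)"
| "exec (While b c) st = st"

text \<open>An upper bound for the running time of loop-free programs, with the sum over both
  branches of \<open>If\<close> in place of their maximum.\<close>

fun com_size :: "com \<Rightarrow> nat" where
  "com_size (Seq c d) = com_size c + com_size d"
| "com_size (If b c d) = com_size c + com_size d + 1"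
| "com_size _ = 1"

lemma run_exec: "loop_free c \<Longrightarrow> \<exists>t\<le>com_size c. run c st t (exec c st)"
proof (induction c arbitrary: st)
  case (Seq c d)
  then obtain t u where "t \<le> com_size c" "run c st t (exec c st)"
    "u \<le> com_size d" "run d (exec c st) u (exec d (exec c st))" by (auto, meson)
  then show ?case by (intro exI[of _ "t + u"]) (auto intro: run_Seq)
next
  case (If b c d)
  then obtain t u where t: "t \<le> com_size c" "run c st t (exec c st)"
    "u \<le> com_size d" "run d st u (exec d st)" by (auto, meson)
  show ?case
  proof (cases "bval b st")
    case True
    then show ?thesis using t by (intro exI[of _ "t + 1"]) (auto intro: run_IfTrue[simplified])
  next
    case False
    then show ?thesis using t by (intro exI[of _ "u + 1"]) (auto intro: run_IfFalse[simplified])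
  qed
qed (auto intro!: exI[of _ "Suc 0"] run.intros[unfolded One_nat_def])

text \<open>Total correctness with a time budget. The start state is explicit instead of a
  precondition, so that \<open>Q\<close> can refer to it.\<close>

definition halts :: "com \<Rightarrow> state \<Rightarrow> nat \<Rightarrow> (state \<Rightarrow> bool) \<Rightarrow> bool" where
  "halts c st T Q \<longleftrightarrow> (\<exists>t st'. run c st t st' \<and> t \<le> T \<and> Q st')"

lemma halts_exec: "loop_free c \<Longrightarrow> Q (exec c st) \<Longrightarrow> halts c st (com_size c) Q"
  using run_exec[of c st] unfolding halts_def by blast

lemma halts_weaken:
  assumes "halts c st T Q" "T \<le> T'" "\<And>st'. Q st' \<Longrightarrow> Q' st'" shows "halts c st T' Q'"
  using assms unfolding halts_def by (meson order.trans)

lemma halts_Seq: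
  assumes "halts c st T R" "\<And>st'. R st' \<Longrightarrow> halts d st' U Q"
  shows "halts (Seq c d) st (T + U) Q"
proof -
  obtain t st' where t: "run c st t st'" "t \<le> T" "R st'" using assms(1) unfolding halts_def by blast
  then obtain u st'' where "run d st' u st''" "u \<le> U" "Q st''" using assms(2) unfolding halts_def by blast
  with t show ?thesis unfolding halts_def by (intro exI[of _ "t + u"] exI[of _ st'']) (auto intro: run_Seq)
qed

text \<open>\<open>k\<close> counts the rounds done and \<open>N\<close> bounds them. The extra unit
  in \<open>Suc (N - k)\<close> pays for the last evaluation of the guard.\<close>

lemma halts_While:
  assumes "loop_free c" and "Inv k st"
    and step: "\<And>k st. Inv k st \<Longrightarrow> bval b st \<Longrightarrow> k < N \<and> Inv (Suc k) (exec c st)"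
  shows "halts (While b c) st (Suc (N - k) * (com_size c + 1)) (\<lambda>st. (\<exists>k. Inv k st) \<and> \<not> bval b st)"
  using assms(2)
proof (induction "N - k" arbitrary: k st)
  case 0
  then have "\<not> bval b st" using step by fastforce
  then have "run (While b c) st 1 st" by (rule run_WhileFalse)
  then show ?case using 0 \<open>\<not> bval b st\<close> unfolding halts_def by (intro exI[of _ 1] exI[of _ st]) auto
next
  case (Suc n)
  show ?case
  proof (cases "bval b st")
    case True
    then have "halts (While b c) (exec c st) (Suc (N - Suc k) * (com_size c + 1)) (\<lambda>st. (\<exists>k. Inv k st) \<and> \<not> bval b st)"
      using Suc step by (intro Suc.hyps(1)) auto
    then obtain u st'' where u: "run (While b c) (exec c st) u st''" "u \<le> Suc (N - Suc k) * (com_size c + 1)"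
      "\<exists>k. Inv k st''" "\<not> bval b st''" unfolding halts_def by blast
    obtain t where t: "t \<le> com_size c" "run c st t (exec c st)" using run_exec[OF assms(1)] by blast
    have n: "N - Suc k = n" "N - k = Suc n" using Suc.hyps(2) by arith+
    have "t + u + 1 \<le> Suc (N - k) * (com_size c + 1)"
      using u(2) t(1) unfolding n by simp
    then show ?thesis unfolding halts_def using run_WhileTrue[OF True t(2) u(1)] u(3,4) by blast
  next
    case False
    then have "run (While b c) st 1 st" by (rule run_WhileFalse)
    then show ?thesis using Suc.prems False unfolding halts_def by (intro exI[of _ 1] exI[of _ st]) auto
  qed
qed

section \<open>Frame conditions and clipped pieces\<close>

definition same_except :: "string set \<Rightarrow> string set \<Rightarrow> state \<Rightarrow> state \<Rightarrow> bool" where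
  "same_except A R st st' \<longleftrightarrow> (\<forall>z. z \<notin> A \<longrightarrow> arr st' z = arr st z) \<and> (\<forall>z. z \<notin> R \<longrightarrow> reg st' z = reg st z)"

lemma same_except_trans:
  "same_except A R st st' \<Longrightarrow> same_except A R st' st'' \<Longrightarrow> same_except A R st st''"
  by (simp add: same_except_def)

fun clip :: "real \<Rightarrow> real \<Rightarrow> real \<Rightarrow> real" where
  "clip lo hi z = min hi (max lo z)"

abbreviation scalar :: "string \<Rightarrow> rexp" where
  "scalar z \<equiv> Arr z (INum 0)"

fun slope_exp :: "action \<Rightarrow> rexp" where
  "slope_exp Wait = RNum 0"
| "slope_exp (Travel Rightward) = scalar ''s''"
| "slope_exp (Travel Leftward) = RMinus (RNum 0) (scalar ''s'')"
| "slope_exp (Reclaim p Rightward) = RNum 1"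
| "slope_exp (Reclaim p Leftward) = RNum (-1)"

text \<open>The counter is increased last because the array cells are addressed by its old value.
  \<open>RNum\<close> takes an integer, hence the floor of the code, which is itself
  integral.\<close>

definition append_piece :: "string \<Rightarrow> action \<Rightarrow> com" where
  "append_piece \<kappa> act =
     Seq (SetArr (''t'' @ \<kappa>) (IPlus (Reg (''m'' @ \<kappa>)) (INum 1)) (RPlus (Arr (''t'' @ \<kappa>) (Reg (''m'' @ \<kappa>))) (scalar ''d'')))
    (Seq (SetArr (''x'' @ \<kappa>) (IPlus (Reg (''m'' @ \<kappa>)) (INum 1)) (scalar ''w''))
    (Seq (SetArr (''a'' @ \<kappa>) (Reg (''m'' @ \<kappa>)) (RNum \<lfloor>action_code act\<rfloor>))
         (SetReg (''m'' @ \<kappa>) (IPlus (Reg (''m'' @ \<kappa>)) (INum 1)))))"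

text \<open>
  Moves reclaimer \<open>\<kappa>\<close> (the suffix of its array names) to the point of \<open>[lo, hi]\<close> nearest to \<open>e\<close>.
  The sign of the duration \<open>d\<close> does not depend on the direction, so a single test \<open>0 < d\<close> skips
  pieces of length zero.
\<close>

definition emit :: "string \<Rightarrow> rexp \<Rightarrow> action \<Rightarrow> com" where
  "emit \<kappa> e act =
     Seq (SetArr ''w'' (INum 0) e)
    (Seq (If (RLess (scalar ''w'') (scalar ''lo'')) (SetArr ''w'' (INum 0) (scalar ''lo'')) Skip)
    (Seq (If (RLess (scalar ''hi'') (scalar ''w'')) (SetArr ''w'' (INum 0) (scalar ''hi'')) Skip)
    (Seq (SetArr ''d'' (INum 0) (RDivide (RMinus (scalar ''w'') (Arr (''x'' @ \<kappa>) (Reg (''m'' @ \<kappa>)))) (slope_exp act)))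
         (If (RLess (RNum 0) (scalar ''d'')) (append_piece \<kappa> act) Skip))))"

lemma loop_free_emit [simp]: "loop_free (emit \<kappa> e act)"
  by (simp add: emit_def append_piece_def)

lemma of_int_floor_action_code: "of_int \<lfloor>action_code act\<rfloor> = action_code act"
  by (cases act rule: action_code.cases) simp_all

abbreviation trip_arrays :: "string \<Rightarrow> string set" where
  "trip_arrays \<kappa> \<equiv> {''t'' @ \<kappa>, ''x'' @ \<kappa>, ''a'' @ \<kappa>, ''w'', ''d''}"

abbreviation trip_regs :: "string \<Rightarrow> string set" where
  "trip_regs \<kappa> \<equiv> {''m'' @ \<kappa>, ''i''}"

lemma rval_slope_exp: "rval (slope_exp act) st = slope (arr st ''s'' 0) act"
  by (cases act rule: slope_exp.cases) simp_all

lemma exec_emit: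
  fixes \<kappa> :: string and e :: rexp and act :: action and st :: state
  assumes lh: "arr st ''lo'' 0 \<le> arr st ''hi'' 0"
  defines "m \<equiv> reg st (''m'' @ \<kappa>)"
  defines "w \<equiv> clip (arr st ''lo'' 0) (arr st ''hi'' 0) (rval e st)"
  defines "\<delta> \<equiv> (w - arr st (''x'' @ \<kappa>) m) / slope (arr st ''s'' 0) act"
  shows "same_except (trip_arrays \<kappa>) {''m'' @ \<kappa>} st (exec (emit \<kappa> e act) st)"
    and "0 < \<delta> \<Longrightarrow> reg (exec (emit \<kappa> e act) st) (''m'' @ \<kappa>) = Suc m \<and>
         arr (exec (emit \<kappa> e act) st) (''t'' @ \<kappa>) = (arr st (''t'' @ \<kappa>))(Suc m := arr st (''t'' @ \<kappa>) m + \<delta>) \<and>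
         arr (exec (emit \<kappa> e act) st) (''x'' @ \<kappa>) = (arr st (''x'' @ \<kappa>))(Suc m := w) \<and>
         arr (exec (emit \<kappa> e act) st) (''a'' @ \<kappa>) = (arr st (''a'' @ \<kappa>))(m := action_code act)"
    and "\<not> 0 < \<delta> \<Longrightarrow> reg (exec (emit \<kappa> e act) st) (''m'' @ \<kappa>) = m \<and>
         arr (exec (emit \<kappa> e act) st) (''t'' @ \<kappa>) = arr st (''t'' @ \<kappa>) \<and>
         arr (exec (emit \<kappa> e act) st) (''x'' @ \<kappa>) = arr st (''x'' @ \<kappa>) \<and>
         arr (exec (emit \<kappa> e act) st) (''a'' @ \<kappa>) = arr st (''a'' @ \<kappa>)"
proof -
  define pre where "pre = Seq (SetArr ''w'' (INum 0) e)
    (Seq (If (RLess (scalar ''w'') (scalar ''lo'')) (SetArr ''w'' (INum 0) (scalar ''lo'')) Skip)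
         (If (RLess (scalar ''hi'') (scalar ''w'')) (SetArr ''w'' (INum 0) (scalar ''hi'')) Skip))"
  define st1 where "st1 = exec pre st"
  have a1: "arr st1 z = arr st z" if "z \<noteq> ''w''" for z
    using that by (auto simp: st1_def pre_def)
  have r1: "reg st1 = reg st" by (auto simp: st1_def pre_def)
  have w1: "arr st1 ''w'' 0 = w" using lh by (auto simp: st1_def pre_def w_def min_def max_def)
  define st2 where "st2 = exec (SetArr ''d'' (INum 0) (RDivide (RMinus (scalar ''w'') (Arr (''x'' @ \<kappa>) (Reg (''m'' @ \<kappa>)))) (slope_exp act))) st1"
  have a2: "arr st2 z = arr st z" if "z \<noteq> ''w''" "z \<noteq> ''d''" for z
    using that a1 by (auto simp: st2_def)
  have r2: "reg st2 = reg st" using r1 by (simp add: st2_def)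
  have w2: "arr st2 ''w'' 0 = w" using w1 by (simp add: st2_def)
  have d2: "arr st2 ''d'' 0 = \<delta>"
    using w1 a1 by (simp add: st2_def rval_slope_exp r1 \<delta>_def m_def)
  have ex: "exec (emit \<kappa> e act) st = (if 0 < \<delta> then exec (append_piece \<kappa> act) st2 else st2)"
    using d2 by (simp add: emit_def st2_def st1_def pre_def)
  show "same_except (trip_arrays \<kappa>) {''m'' @ \<kappa>} st (exec (emit \<kappa> e act) st)"
    unfolding ex same_except_def using a2 r2 by (auto simp: append_piece_def)
  show "0 < \<delta> \<Longrightarrow> reg (exec (emit \<kappa> e act) st) (''m'' @ \<kappa>) = Suc m \<and>
         arr (exec (emit \<kappa> e act) st) (''t'' @ \<kappa>) = (arr st (''t'' @ \<kappa>))(Suc m := arr st (''t'' @ \<kappa>) m + \<delta>) \<and>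
         arr (exec (emit \<kappa> e act) st) (''x'' @ \<kappa>) = (arr st (''x'' @ \<kappa>))(Suc m := w) \<and>
         arr (exec (emit \<kappa> e act) st) (''a'' @ \<kappa>) = (arr st (''a'' @ \<kappa>))(m := action_code act)"
    unfolding ex using a2 r2 w2 d2 by (simp add: append_piece_def m_def of_int_floor_action_code)
  show "\<not> 0 < \<delta> \<Longrightarrow> reg (exec (emit \<kappa> e act) st) (''m'' @ \<kappa>) = m \<and>
         arr (exec (emit \<kappa> e act) st) (''t'' @ \<kappa>) = arr st (''t'' @ \<kappa>) \<and>
         arr (exec (emit \<kappa> e act) st) (''x'' @ \<kappa>) = arr st (''x'' @ \<kappa>) \<and>
         arr (exec (emit \<kappa> e act) st) (''a'' @ \<kappa>) = arr st (''a'' @ \<kappa>)"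
    unfolding ex using a2 r2 by (simp add: m_def)
qed

subsection \<open>Emitting the pieces of a trip\<close>

text \<open>The order in which a leg for pad \<open>p\<close> passes the points of the rail. It
  allows one proof for both directions.\<close>

definition le_dir :: "pad \<Rightarrow> real \<Rightarrow> real \<Rightarrow> bool" where
  "le_dir p u v \<longleftrightarrow> sign (dir p) * u \<le> sign (dir p) * v"

lemma le_dir_simps [simp]: "le_dir P1 u v \<longleftrightarrow> u \<le> v" "le_dir P2 u v \<longleftrightarrow> v \<le> u"
  by (simp_all add: le_dir_def)

lemma le_dir_clip: "le_dir p u v \<Longrightarrow> le_dir p (clip lo hi u) (clip lo hi v)"
  by (cases p) (auto simp: min_def max_def)

lemma le_dir_trans: "le_dir p u v \<Longrightarrow> le_dir p v w \<Longrightarrow> le_dir p u w"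
  by (cases p) auto

lemma le_dir_segment: "le_dir p u v \<Longrightarrow> x \<in> open_segment u v \<Longrightarrow> \<not> le_dir p x u \<and> \<not> le_dir p v x"
  by (cases p; cases "u = v") (auto simp: open_segment_eq_real_ivl split: if_splits)

lemma le_dir_closed_segment: "le_dir p u v \<Longrightarrow> x \<in> closed_segment u v \<longleftrightarrow> le_dir p u x \<and> le_dir p x v"
  by (cases p; cases "u = v") (auto simp: closed_segment_eq_real_ivl split: if_splits)

lemma clip_in: "lo \<le> hi \<Longrightarrow> clip lo hi z \<in> {lo..hi}"
  by auto

lemma clip_id: "z \<in> {lo..hi} \<Longrightarrow> clip lo hi z = z"
  by auto

fun visits :: "instance_data \<Rightarrow> pad \<Rightarrow> nat" where
  "visits I P1 = num1 I"
| "visits I P2 = num I - num1 I"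

text \<open>Stockpiles are renumbered from 0 in the order of visit: upwards on \<open>P1\<close>,
  entered on the left, and downwards on \<open>P2\<close>, entered on the right.\<close>

fun near :: "instance_data \<Rightarrow> pad \<Rightarrow> nat \<Rightarrow> real" where
  "near I P1 j = of_int (left I (j + 1))"
| "near I P2 j = of_int (right I (num I - j))"

fun far :: "instance_data \<Rightarrow> pad \<Rightarrow> nat \<Rightarrow> real" where
  "far I P1 j = of_int (right I (j + 1))"
| "far I P2 j = of_int (left I (num I - j))"

fun goal :: "instance_data \<Rightarrow> pad \<Rightarrow> real" where
  "goal I P1 = of_int (rail I)"
| "goal I P2 = 0"

lemma visit_index:
  assumes "valid_instance I" "j < visits I p"
  shows "(case p of P1 \<Rightarrow> j + 1 | P2 \<Rightarrow> num I - j) \<in> stockpiles I p"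
  using assms by (cases p) (auto simp: valid_instance_def)

lemma near_far:
  assumes I: "valid_instance I" and j: "j < visits I p"
  shows "le_dir p (near I p j) (far I p j)" "near I p j \<in> {0..of_int (rail I)}" "far I p j \<in> {0..of_int (rail I)}"
  using stockpile_bounds[OF I visit_index[OF I j]] by (cases p; simp)+

lemma far_near:
  assumes I: "valid_instance I" and "i < j" "j < visits I p"
  shows "le_dir p (far I p i) (near I p j)"
proof (cases p)
  case P1
  have "\<forall>i j. 1 \<le> i \<and> i < j \<and> j \<le> num1 I \<longrightarrow> right I i \<le> left I j"
    using I unfolding valid_instance_def by (elim conjE)
  from spec[OF spec[OF this, of "i + 1"], of "j + 1"] show ?thesis using P1 assms(2,3) by simp
next
  case P2
  have "\<forall>i j. num1 I + 1 \<le> i \<and> i < j \<and> j \<le> num I \<longrightarrow> right I i \<le> left I j"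
    using I unfolding valid_instance_def by (elim conjE)
  moreover have "num1 I + 1 \<le> num I - j" "num I - j < num I - i" "num I - i \<le> num I"
    using P2 assms(2,3) by auto
  ultimately have "right I (num I - j) \<le> left I (num I - i)" by blast
  then show ?thesis using P2 by simp
qed

lemma stock_visits:
  assumes I: "valid_instance I"
  shows "stock I p = (\<Union>j<visits I p. closed_segment (near I p j) (far I p j))"
proof (cases p)
  case P1
  have "{1..num1 I} = Suc ` {..<num1 I}" by (simp add: image_Suc_lessThan)
  moreover have "closed_segment (near I P1 j) (far I P1 j) = {of_int (left I (Suc j))..of_int (right I (Suc j))}"
    if "j < num1 I" for j
    using near_far(1)[OF I, of j P1] that by (simp add: closed_segment_eq_real_ivl)
  ultimately show ?thesis using P1 by (simp add: stock_def)
next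
  case P2
  have "num1 I \<le> num I" using I by (simp add: valid_instance_def)
  then have "{num1 I + 1..num I} = (\<lambda>j. num I - j) ` {..<num I - num1 I}"
  proof (intro equalityI subsetI)
    fix x assume "x \<in> {num1 I + 1..num I}"
    then show "x \<in> (\<lambda>j. num I - j) ` {..<num I - num1 I}"
      by (intro image_eqI[of _ _ "num I - x"]) auto
  qed auto
  moreover have "closed_segment (near I P2 j) (far I P2 j) = {of_int (left I (num I - j))..of_int (right I (num I - j))}"
    if "j < num I - num1 I" for j
    using near_far(1)[OF I, of j P2] that by (auto simp: closed_segment_eq_real_ivl)
  ultimately show ?thesis using P2 by (simp add: stock_def)
qed

text \<open>Where the reclaimer stands after \<open>j\<close> visits. Stockpiles outside
  \<open>[lo, hi]\<close> are visited as well, but clipping shrinks such a visit to a point.\<close>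

fun reached :: "instance_data \<Rightarrow> real \<Rightarrow> real \<Rightarrow> pad \<Rightarrow> nat \<Rightarrow> real" where
  "reached I lo hi p 0 = origin p lo hi"
| "reached I lo hi p (Suc j) = clip lo hi (far I p j)"

text \<open>The end of the rail acts as a sentinel behind the last stockpile, so that the final
  travelling piece is treated like the others.\<close>

fun target :: "instance_data \<Rightarrow> pad \<Rightarrow> nat \<Rightarrow> real" where
  "target I p j = (if j < visits I p then near I p j else goal I p)"

lemma le_dir_goal:
  assumes "x \<in> {0..of_int (rail I)}" shows "le_dir p x (goal I p)"
  using assms by (cases p) auto

lemma reached_le_target:
  assumes I: "valid_instance I" and lh: "lo \<le> hi" and j: "j \<le> visits I p"
  shows "le_dir p (reached I lo hi p j) (clip lo hi (target I p j))"
proof (cases j)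
  case 0
  then show ?thesis using clip_in[OF lh, of "target I p j"] by (cases p) auto
next
  case (Suc i)
  then have "le_dir p (far I p i) (target I p j)"
    using far_near[OF I, of i j p] le_dir_goal near_far(3)[OF I, of i p] j by auto
  then show ?thesis using Suc le_dir_clip by simp
qed

lemma reached_in: "lo \<le> hi \<Longrightarrow> reached I lo hi p j \<in> {lo..hi}"
  by (cases j; cases p) auto

text \<open>Stockpiles with index below \<open>j\<close> end no later than the reached point, the
  others begin no earlier than the target. Clipping preserves this order and fixes \<open>x\<close>,
  which lies in \<open>[lo, hi]\<close>.\<close>

lemma no_stock_before_target:
  assumes I: "valid_instance I" and lh: "lo \<le> hi" and j: "j \<le> visits I p"
  shows "open_segment (reached I lo hi p j) (clip lo hi (target I p j)) \<inter> stock I p = {}"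
proof (rule equals0I, elim IntE)
  fix x assume x: "x \<in> open_segment (reached I lo hi p j) (clip lo hi (target I p j))" and s: "x \<in> stock I p"
  have "closed_segment (reached I lo hi p j) (clip lo hi (target I p j)) \<subseteq> {lo..hi}"
    by (rule closed_segment_subset) (use clip_in[OF lh] reached_in[OF lh] in auto)
  then have xr: "clip lo hi x = x" using x by (intro clip_id) (auto simp: open_segment_def)
  from le_dir_segment[OF reached_le_target[OF I lh j] x]
  have n: "\<not> le_dir p x (reached I lo hi p j)" "\<not> le_dir p (clip lo hi (target I p j)) x" by auto
  from s obtain i where i: "i < visits I p" "x \<in> closed_segment (near I p i) (far I p i)"
    unfolding stock_visits[OF I] by auto
  then have ix: "le_dir p (near I p i) x" "le_dir p x (far I p i)"
    using le_dir_closed_segment[OF near_far(1)[OF I i(1)]] by auto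
  show False
  proof (cases "i < j")
    case True
    then obtain j' where j': "j = Suc j'" "i \<le> j'" by (cases j) auto
    have "le_dir p (far I p i) (far I p j')"
    proof (cases "i = j'")
      case True then show ?thesis by (cases p) auto
    next
      case False
      then show ?thesis
        using far_near[OF I, of i j' p] near_far(1)[OF I, of j' p] j' j le_dir_trans by auto
    qed
    from le_dir_clip[OF le_dir_trans[OF ix(2) this], of lo hi] show False
      using n(1) j'(1) xr by simp
  next
    case False
    have "le_dir p (near I p j) (near I p i)" if "j \<noteq> i"
      using far_near[OF I, of j i p] near_far(1)[OF I, of j p] that False i le_dir_trans by auto
    then have "le_dir p (near I p j) x" using ix(1) le_dir_trans by (cases "j = i") auto
    from le_dir_clip[OF this, of lo hi] show False
      using n(2) xr False i(1) by simp
  qed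
qed

text \<open>\<open>m\<close> pieces have \<open>m + 1\<close> nodes but \<open>m\<close> labels;
  therefore times and positions are preserved up to index \<open>m\<close> inclusive, codes only
  below it.\<close>

definition extends ::
  "instance_data \<Rightarrow> real \<Rightarrow> real \<Rightarrow> string \<Rightarrow> pad \<Rightarrow> state \<Rightarrow> state \<Rightarrow> bool" where
  "extends I lo hi \<kappa> p st st' \<longleftrightarrow>
     reg st (''m'' @ \<kappa>) \<le> reg st' (''m'' @ \<kappa>) \<and>
     (\<forall>i\<le>reg st (''m'' @ \<kappa>). arr st' (''t'' @ \<kappa>) i = arr st (''t'' @ \<kappa>) i \<and> arr st' (''x'' @ \<kappa>) i = arr st (''x'' @ \<kappa>) i) \<and>
     (\<forall>i<reg st (''m'' @ \<kappa>). arr st' (''a'' @ \<kappa>) i = arr st (''a'' @ \<kappa>) i) \<and>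
     (\<forall>i\<in>{reg st (''m'' @ \<kappa>)..<reg st' (''m'' @ \<kappa>)}.
        stage I lo hi p (arr st' (''t'' @ \<kappa>)) (arr st' (''x'' @ \<kappa>)) (arr st' (''a'' @ \<kappa>)) i)"

lemma stage_cong:
  assumes "b k = b' k" "b (Suc k) = b' (Suc k)" "y k = y' k" "y (Suc k) = y' (Suc k)" "a k = a' k"
  shows "stage I lo hi p b y a k = stage I lo hi p b' y' a' k"
  unfolding stage_def assms ..

lemma extends_trans:
  assumes "extends I lo hi \<kappa> p st st'" "extends I lo hi \<kappa> p st' st''"
  shows "extends I lo hi \<kappa> p st st''"
proof -
  note A = assms(1)[unfolded extends_def] and B = assms(2)[unfolded extends_def]
  have "stage I lo hi p (arr st'' (''t'' @ \<kappa>)) (arr st'' (''x'' @ \<kappa>)) (arr st'' (''a'' @ \<kappa>)) i"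
    if "i \<in> {reg st (''m'' @ \<kappa>)..<reg st'' (''m'' @ \<kappa>)}" for i
  proof (cases "i < reg st' (''m'' @ \<kappa>)")
    case True
    then have "stage I lo hi p (arr st' (''t'' @ \<kappa>)) (arr st' (''x'' @ \<kappa>)) (arr st' (''a'' @ \<kappa>)) i"
      using A that by simp
    moreover have "stage I lo hi p (arr st'' (''t'' @ \<kappa>)) (arr st'' (''x'' @ \<kappa>)) (arr st'' (''a'' @ \<kappa>)) i
        = stage I lo hi p (arr st' (''t'' @ \<kappa>)) (arr st' (''x'' @ \<kappa>)) (arr st' (''a'' @ \<kappa>)) i"
      by (rule stage_cong) (use B True in auto)
    ultimately show ?thesis by simp
  next
    case False
    then show ?thesis using B that by simp
  qed
  then show ?thesis unfolding extends_def using A B by auto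
qed

text \<open>By \<open>fw\<close> the computed duration is positive exactly if \<open>w\<close>
  differs from \<open>c\<close>, so what is skipped has length zero. Containment in the stock is
  required only for \<open>c \<noteq> w\<close>: a visit outside the range shrinks to
  \<open>lo\<close> or \<open>hi\<close>, which may not be in the stock.\<close>

lemma emit_extends:
  fixes \<kappa> :: string and act :: action and e :: rexp
  assumes I: "valid_instance I" and lh: "lo \<le> hi" and st: "arr st ''lo'' 0 = lo" "arr st ''hi'' 0 = hi" "arr st ''s'' 0 = speed I"
    and act: "act = Reclaim p (dir p) \<or> act = Travel (dir p)"
  defines "c \<equiv> arr st (''x'' @ \<kappa>) (reg st (''m'' @ \<kappa>))" and "w \<equiv> clip lo hi (rval e st)"
    and "st' \<equiv> exec (emit \<kappa> e act) st"
  assumes fw: "le_dir p c w" and w: "w \<in> stock I p \<union> {lo, hi}"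
    and hom: "act = Reclaim p (dir p) \<Longrightarrow> c \<noteq> w \<Longrightarrow> closed_segment c w \<subseteq> stock I p"
      "act = Travel (dir p) \<Longrightarrow> open_segment c w \<inter> stock I p = {}"
  shows "extends I lo hi \<kappa> p st st'" "arr st' (''x'' @ \<kappa>) (reg st' (''m'' @ \<kappa>)) = w"
    "reg st' (''m'' @ \<kappa>) \<le> Suc (reg st (''m'' @ \<kappa>))" "same_except (trip_arrays \<kappa>) {''m'' @ \<kappa>} st st'"
proof -
  let ?m = "reg st (''m'' @ \<kappa>)"
  define \<delta> where "\<delta> = (w - c) / slope (speed I) act"
  have lh': "arr st ''lo'' 0 \<le> arr st ''hi'' 0" using lh st by simp
  note E = exec_emit[OF lh', where \<kappa> = \<kappa> and e = e and act = act, unfolded st, folded w_def c_def, folded \<delta>_def, folded st'_def]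
  show "same_except (trip_arrays \<kappa>) {''m'' @ \<kappa>} st st'" by (rule E(1))
  have s: "speed I > 0" using speed_ge_1[OF I] by simp
  have sl: "slope (speed I) act \<noteq> 0" using act s by (cases p) auto
  show "arr st' (''x'' @ \<kappa>) (reg st' (''m'' @ \<kappa>)) = w"
  proof (cases "0 < \<delta>")
    case True then show ?thesis using E(2) by simp
  next
    case False
    have "w = c"
    proof (rule ccontr)
      assume "w \<noteq> c"
      then have "0 < \<delta>" using fw act s unfolding \<delta>_def
        by (cases p) (auto simp: divide_pos_pos divide_neg_neg divide_neg_pos)
      then show False using False by simp
    qed
    then show ?thesis using E(3)[OF False] by (simp add: c_def)
  qed
  show "reg st' (''m'' @ \<kappa>) \<le> Suc ?m" using E(2,3) by (cases "0 < \<delta>") auto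
  show "extends I lo hi \<kappa> p st st'"
  proof (cases "0 < \<delta>")
    case False
    then show ?thesis using E(3) by (simp add: extends_def)
  next
    case True
    then have cw: "c \<noteq> w" by (auto simp: \<delta>_def)
    note E2 = E(2)[OF True]
    have wr: "w \<in> {lo..hi}" unfolding w_def by (rule clip_in[OF lh])
    have wc: "w = c + slope (speed I) act * \<delta>" using sl by (simp add: \<delta>_def)
    let ?t = "arr st' (''t'' @ \<kappa>)" and ?x = "arr st' (''x'' @ \<kappa>)" and ?a = "arr st' (''a'' @ \<kappa>)"
    have t: "?t (Suc ?m) = ?t ?m + \<delta>" and x: "?x ?m = c" "?x (Suc ?m) = w" and a: "?a ?m = action_code act"
      using E2 unfolding c_def by (elim conjE, simp only: fun_upd_apply n_not_Suc_n if_False simp_thms if_True)+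
    have "\<exists>act. ?a ?m = action_code act \<and> ?x (Suc ?m) = ?x ?m + slope (speed I) act * (?t (Suc ?m) - ?t ?m) \<and>
        (act = Reclaim p (dir p) \<and> closed_segment (?x ?m) (?x (Suc ?m)) \<subseteq> stock I p \<or>
         act = Travel (dir p) \<and> open_segment (?x ?m) (?x (Suc ?m)) \<inter> stock I p = {})"
      unfolding x a t using act hom cw wc by (intro exI[of _ act]) auto
    then have "stage I lo hi p ?t ?x ?a ?m"
      unfolding stage_def x using t True wr w by simp
    then show ?thesis unfolding extends_def using E2 by (auto simp: less_Suc_eq)
  qed
qed

section \<open>The program for one leg\<close>

fun visits_exp :: "pad \<Rightarrow> iexp" where
  "visits_exp P1 = Reg ''n1''"
| "visits_exp P2 = IMinus (Reg ''n'') (Reg ''n1'')"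

fun index_exp :: "pad \<Rightarrow> iexp" where
  "index_exp P1 = IPlus (Reg ''i'') (INum 1)"
| "index_exp P2 = IMinus (Reg ''n'') (Reg ''i'')"

fun near_exp :: "pad \<Rightarrow> rexp" where
  "near_exp P1 = Arr ''l'' (index_exp P1)"
| "near_exp P2 = Arr ''r'' (index_exp P2)"

fun far_exp :: "pad \<Rightarrow> rexp" where
  "far_exp P1 = Arr ''r'' (index_exp P1)"
| "far_exp P2 = Arr ''l'' (index_exp P2)"

fun goal_exp :: "pad \<Rightarrow> rexp" where
  "goal_exp P1 = scalar ''L''"
| "goal_exp P2 = RNum 0"

definition leg_body :: "string \<Rightarrow> pad \<Rightarrow> com" where
  "leg_body \<kappa> p =
     Seq (emit \<kappa> (near_exp p) (Travel (dir p)))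
    (Seq (emit \<kappa> (far_exp p) (Reclaim p (dir p)))
         (SetReg ''i'' (IPlus (Reg ''i'') (INum 1))))"

definition leg :: "string \<Rightarrow> pad \<Rightarrow> com" where
  "leg \<kappa> p =
     Seq (SetReg ''i'' (INum 0))
    (Seq (While (ILess (Reg ''i'') (visits_exp p)) (leg_body \<kappa> p))
         (emit \<kappa> (goal_exp p) (Travel (dir p))))"

definition has_input :: "instance_data \<Rightarrow> state \<Rightarrow> bool" where
  "has_input I st \<longleftrightarrow> reg st ''n1'' = num1 I \<and> reg st ''n'' = num I \<and>
     arr st ''L'' 0 = of_int (rail I) \<and> arr st ''s'' 0 = speed I \<and>
     (\<forall>j\<in>{1..num I}. arr st ''l'' j = of_int (left I j) \<and> arr st ''r'' j = of_int (right I j))"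

lemma has_input_input_state: "has_input I (input_state I)"
  by (simp add: has_input_def input_state_def)

definition clip_range :: "state \<Rightarrow> real \<Rightarrow> real \<Rightarrow> bool" where
  "clip_range st lo hi \<longleftrightarrow> arr st ''lo'' 0 = lo \<and> arr st ''hi'' 0 = hi"

lemma has_input_same:
  assumes "has_input I st" "same_except A R st st'" "''n1'' \<notin> R" "''n'' \<notin> R"
    "''L'' \<notin> A" "''s'' \<notin> A" "''l'' \<notin> A" "''r'' \<notin> A"
  shows "has_input I st'"
  using assms unfolding has_input_def same_except_def by simp

lemma clip_range_same:
  assumes "clip_range st lo hi" "same_except A R st st'" "''lo'' \<notin> A" "''hi'' \<notin> A"
  shows "clip_range st' lo hi"
  using assms unfolding clip_range_def same_except_def by simp

lemma same_except_mono:
  "same_except A R st st' \<Longrightarrow> A \<subseteq> A' \<Longrightarrow> R \<subseteq> R' \<Longrightarrow> same_except A' R' st st'"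
  unfolding same_except_def by blast

lemma ival_visits_exp: "has_input I st \<Longrightarrow> ival (visits_exp p) st = visits I p"
  by (cases p) (simp_all add: has_input_def)

lemma rval_near_far:
  assumes "valid_instance I" "has_input I st" "reg st ''i'' = j" "j < visits I p"
  shows "rval (near_exp p) st = near I p j" "rval (far_exp p) st = far I p j"
proof -
  have "num1 I \<le> num I" using assms(1) by (simp add: valid_instance_def)
  then show "rval (near_exp p) st = near I p j" "rval (far_exp p) st = far I p j"
    using assms by (cases p; simp add: has_input_def)+
qed

lemma rval_goal_exp: "has_input I st \<Longrightarrow> rval (goal_exp p) st = goal I p"
  by (cases p) (simp_all add: has_input_def)

lemma near_far_stock:
  assumes "valid_instance I" "j < visits I p"
  shows "near I p j \<in> stock I p" "far I p j \<in> stock I p"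
  using assms(2) unfolding stock_visits[OF assms(1)] by (blast intro: ends_in_segment)+

lemma clip_cases: "clip lo hi z \<in> {z, lo, hi}"
  by (auto simp: min_def max_def)

text \<open>Different clipped ends mean that the segment meets the interior of
  \<open>[lo, hi]\<close>, and clipping is then intersection. Equal ones may result from a segment
  entirely outside.\<close>

lemma clip_segment_subset:
  assumes "le_dir p u v" "clip lo hi u \<noteq> clip lo hi v" "lo \<le> hi"
  shows "closed_segment (clip lo hi u) (clip lo hi v) \<subseteq> closed_segment u v"
  using assms by (intro closed_segment_subset)
    (cases p; auto simp: closed_segment_eq_real_ivl min_def max_def split: if_splits)+

lemma leg_step:
  fixes \<kappa> :: string
  assumes I: "valid_instance I" and lh: "lo \<le> hi" and inp: "has_input I st" "clip_range st lo hi"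
    and j: "reg st ''i'' = j" "j < visits I p" and x: "arr st (''x'' @ \<kappa>) (reg st (''m'' @ \<kappa>)) = reached I lo hi p j"
  defines "st' \<equiv> exec (leg_body \<kappa> p) st"
  shows "extends I lo hi \<kappa> p st st'" "reg st' ''i'' = Suc j"
    "arr st' (''x'' @ \<kappa>) (reg st' (''m'' @ \<kappa>)) = reached I lo hi p (Suc j)"
    "reg st' (''m'' @ \<kappa>) \<le> reg st (''m'' @ \<kappa>) + 2"
    "same_except (trip_arrays \<kappa>) (trip_regs \<kappa>) st st'"
proof -
  define st1 where "st1 = exec (emit \<kappa> (near_exp p) (Travel (dir p))) st"
  define st2 where "st2 = exec (emit \<kappa> (far_exp p) (Reclaim p (dir p))) st1"
  have st': "st' = st2\<lparr>reg := (reg st2)(''i'' := reg st2 ''i'' + 1)\<rparr>"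
    unfolding st'_def leg_body_def st1_def st2_def by simp
  have s: "arr st ''lo'' 0 = lo" "arr st ''hi'' 0 = hi" "arr st ''s'' 0 = speed I"
    using inp unfolding has_input_def clip_range_def by simp_all
  have tgt: "target I p j = near I p j" using j(2) by simp
  have in1: "clip lo hi (near I p j) \<in> stock I p \<union> {lo, hi}"
    using clip_cases[of lo hi "near I p j"] near_far_stock(1)[OF I j(2)] by auto
  have in2: "clip lo hi (far I p j) \<in> stock I p \<union> {lo, hi}"
    using clip_cases[of lo hi "far I p j"] near_far_stock(2)[OF I j(2)] by auto
  note r1 = rval_near_far(1)[OF I inp(1) j]
  have E1: "extends I lo hi \<kappa> p st st1"
    "arr st1 (''x'' @ \<kappa>) (reg st1 (''m'' @ \<kappa>)) = clip lo hi (near I p j)"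
    "reg st1 (''m'' @ \<kappa>) \<le> Suc (reg st (''m'' @ \<kappa>))" "same_except (trip_arrays \<kappa>) {''m'' @ \<kappa>} st st1"
    unfolding st1_def
    using emit_extends[OF I lh s disjI2[OF refl], of p \<kappa> "near_exp p"] in1
      reached_le_target[OF I lh, of j p] no_stock_before_target[OF I lh, of j p] j(2)
    unfolding r1 x tgt by (simp_all del: clip.simps)
  have inp1: "has_input I st1" "clip_range st1 lo hi"
    using has_input_same[OF inp(1) E1(4)] clip_range_same[OF inp(2) E1(4)] by simp_all
  have s1: "arr st1 ''lo'' 0 = lo" "arr st1 ''hi'' 0 = hi" "arr st1 ''s'' 0 = speed I"
    using inp1 unfolding has_input_def clip_range_def by simp_all
  have j1: "reg st1 ''i'' = j" using E1(4) j(1) by (simp add: same_except_def)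
  note r2 = rval_near_far(2)[OF I inp1(1) j1 j(2)]
  have seg: "closed_segment (near I p j) (far I p j) \<subseteq> stock I p"
    unfolding stock_visits[OF I] using j(2) by blast
  have hom: "clip lo hi (near I p j) \<noteq> clip lo hi (far I p j) \<Longrightarrow>
      closed_segment (clip lo hi (near I p j)) (clip lo hi (far I p j)) \<subseteq> stock I p"
    using clip_segment_subset[OF near_far(1)[OF I j(2)] _ lh] seg by blast
  have E2: "extends I lo hi \<kappa> p st1 st2"
    "arr st2 (''x'' @ \<kappa>) (reg st2 (''m'' @ \<kappa>)) = clip lo hi (far I p j)"
    "reg st2 (''m'' @ \<kappa>) \<le> Suc (reg st1 (''m'' @ \<kappa>))" "same_except (trip_arrays \<kappa>) {''m'' @ \<kappa>} st1 st2"
    unfolding st2_def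
    using emit_extends[OF I lh s1 disjI1[OF refl], of p \<kappa> "far_exp p"] in2 hom
      le_dir_clip[OF near_far(1)[OF I j(2)], of lo hi]
    unfolding r2 E1(2) by (simp_all del: clip.simps)
  have E12: "extends I lo hi \<kappa> p st st2" by (rule extends_trans[OF E1(1) E2(1)])
  have m': "reg st' (''m'' @ \<kappa>) = reg st2 (''m'' @ \<kappa>)" and arr': "arr st' = arr st2"
    unfolding st' by simp_all
  show "extends I lo hi \<kappa> p st st'" using E12 unfolding extends_def m' arr' .
  show "reg st' ''i'' = Suc j" using E2(4) j1 unfolding st' by (simp add: same_except_def)
  show "arr st' (''x'' @ \<kappa>) (reg st' (''m'' @ \<kappa>)) = reached I lo hi p (Suc j)"
    unfolding m' arr' using E2(2) by simp
  show "reg st' (''m'' @ \<kappa>) \<le> reg st (''m'' @ \<kappa>) + 2" unfolding m' using E1(3) E2(3) by simp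
  show "same_except (trip_arrays \<kappa>) (trip_regs \<kappa>) st st'"
    using E1(4) E2(4) unfolding st' same_except_def by auto
qed

text \<open>The 2 is one unit for the guard of each round and one for the initial
  assignment.\<close>

definition leg_cost :: "string \<Rightarrow> pad \<Rightarrow> nat" where
  "leg_cost \<kappa> p = 2 + com_size (leg_body \<kappa> p) + com_size (emit \<kappa> (goal_exp p) (Travel (dir p)))"

lemma visits_le_num: "valid_instance I \<Longrightarrow> visits I p \<le> num I"
  by (cases p) (auto simp: valid_instance_def)

text \<open>The number of pieces is bounded too, because the running time of the sweep is linear in
  it: at most two pieces per stockpile and one at the end.\<close>

lemma leg_correct:
  fixes \<kappa> :: string
  assumes I: "valid_instance I" and lh: "0 \<le> lo" "lo \<le> hi" "hi \<le> of_int (rail I)"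
    and inp: "has_input I st" "clip_range st lo hi"
    and x: "arr st (''x'' @ \<kappa>) (reg st (''m'' @ \<kappa>)) = origin p lo hi"
  shows "halts (leg \<kappa> p) st (leg_cost \<kappa> p * (num I + 1))
    (\<lambda>st'. extends I lo hi \<kappa> p st st' \<and> arr st' (''x'' @ \<kappa>) (reg st' (''m'' @ \<kappa>)) = origin (other p) lo hi \<and>
       reg st' (''m'' @ \<kappa>) \<le> reg st (''m'' @ \<kappa>) + 2 * visits I p + 1 \<and>
       same_except (trip_arrays \<kappa>) (trip_regs \<kappa>) st st')"
proof -
  define Inv where "Inv j st' \<longleftrightarrow> reg st' ''i'' = j \<and> j \<le> visits I p \<and> extends I lo hi \<kappa> p st st' \<and>
     arr st' (''x'' @ \<kappa>) (reg st' (''m'' @ \<kappa>)) = reached I lo hi p j \<and>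
     reg st' (''m'' @ \<kappa>) \<le> reg st (''m'' @ \<kappa>) + 2 * j \<and>
     same_except (trip_arrays \<kappa>) (trip_regs \<kappa>) st st'" for j st'
  let ?b = "ILess (Reg ''i'') (visits_exp p)"
  let ?B = "com_size (leg_body \<kappa> p)" and ?E = "com_size (emit \<kappa> (goal_exp p) (Travel (dir p)))"
  have inp': "has_input I st'" "clip_range st' lo hi" if "Inv j st'" for j st'
  proof -
    have "same_except (trip_arrays \<kappa>) (trip_regs \<kappa>) st st'" using that unfolding Inv_def by simp
    then show "has_input I st'" "clip_range st' lo hi"
      using has_input_same[OF inp(1)] clip_range_same[OF inp(2)] by simp_all
  qed
  have b: "bval ?b st' \<longleftrightarrow> j < visits I p" if "Inv j st'" for j st'
    using ival_visits_exp[OF inp'(1)[OF that]] that unfolding Inv_def by simp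
  have init: "halts (SetReg ''i'' (INum 0)) st 1 (Inv 0)"
  proof (rule halts_weaken[OF halts_exec])
    show "Inv 0 (exec (SetReg ''i'' (INum 0)) st)"
      using x unfolding Inv_def by (simp add: extends_def same_except_def)
  qed simp_all
  have lf: "loop_free (leg_body \<kappa> p)" by (simp add: leg_body_def)
  have loop: "halts (While ?b (leg_body \<kappa> p)) st1 (Suc (visits I p - 0) * (?B + 1))
      (\<lambda>st'. (\<exists>j. Inv j st') \<and> \<not> bval ?b st')" if st1: "Inv 0 st1" for st1
  proof (rule halts_While[OF lf, where Inv = Inv and k = 0, OF st1])
    fix j st' assume J: "Inv j st'" and bv: "bval ?b st'"
    have j: "j < visits I p" using b[OF J] bv by simp
    note J' = J[unfolded Inv_def]
    have i: "reg st' ''i'' = j" and xx: "arr st' (''x'' @ \<kappa>) (reg st' (''m'' @ \<kappa>)) = reached I lo hi p j"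
      using J' by simp_all
    note L = leg_step[OF I lh(2) inp'[OF J] i j xx]
    have "Inv (Suc j) (exec (leg_body \<kappa> p) st')"
      unfolding Inv_def
    proof (intro conjI)
      show "extends I lo hi \<kappa> p st (exec (leg_body \<kappa> p) st')"
        by (rule extends_trans[OF _ L(1)]) (use J' in simp)
      show "same_except (trip_arrays \<kappa>) (trip_regs \<kappa>) st (exec (leg_body \<kappa> p) st')"
        by (rule same_except_trans[OF _ L(5)]) (use J' in simp)
      show "reg (exec (leg_body \<kappa> p) st') (''m'' @ \<kappa>) \<le> reg st (''m'' @ \<kappa>) + 2 * Suc j"
        using L(4) J' by simp
    qed (use L(2,3) j in simp_all)
    with j show "j < visits I p \<and> Inv (Suc j) (exec (leg_body \<kappa> p) st')" ..
  qed
  have fin: "halts (emit \<kappa> (goal_exp p) (Travel (dir p))) st1 ?E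
    (\<lambda>st'. extends I lo hi \<kappa> p st st' \<and> arr st' (''x'' @ \<kappa>) (reg st' (''m'' @ \<kappa>)) = origin (other p) lo hi \<and>
       reg st' (''m'' @ \<kappa>) \<le> reg st (''m'' @ \<kappa>) + 2 * visits I p + 1 \<and>
       same_except (trip_arrays \<kappa>) (trip_regs \<kappa>) st st')"
    if st1: "(\<exists>j. Inv j st1) \<and> \<not> bval ?b st1" for st1
  proof (rule halts_exec)
    obtain j where J: "Inv j st1" using st1 by blast
    then have j: "j = visits I p" using b[OF J] st1 unfolding Inv_def by simp
    note J' = J[unfolded Inv_def j] and i1 = inp'[OF J]
    have s: "arr st1 ''lo'' 0 = lo" "arr st1 ''hi'' 0 = hi" "arr st1 ''s'' 0 = speed I"
      using i1 unfolding has_input_def clip_range_def by simp_all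
    have x1: "arr st1 (''x'' @ \<kappa>) (reg st1 (''m'' @ \<kappa>)) = reached I lo hi p (visits I p)" using J' by simp
    have tgt: "target I p (visits I p) = goal I p" by simp
    \<comment> \<open>Clipping turns the end of the rail into the end of the range, which is where
      the leg for the other pad begins.\<close>
    have g: "clip lo hi (goal I p) = origin (other p) lo hi" using lh by (cases p) auto
    have go: "origin (other p) lo hi \<in> stock I p \<union> {lo, hi}" by (cases p) auto
    let ?st' = "exec (emit \<kappa> (goal_exp p) (Travel (dir p))) st1"
    have E: "extends I lo hi \<kappa> p st1 ?st'"
      "arr ?st' (''x'' @ \<kappa>) (reg ?st' (''m'' @ \<kappa>)) = origin (other p) lo hi"
      "reg ?st' (''m'' @ \<kappa>) \<le> Suc (reg st1 (''m'' @ \<kappa>))" "same_except (trip_arrays \<kappa>) {''m'' @ \<kappa>} st1 ?st'"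
      using emit_extends[OF I lh(2) s disjI2[OF refl], of p \<kappa> "goal_exp p"] go
        reached_le_target[OF I lh(2), of "visits I p" p] no_stock_before_target[OF I lh(2), of "visits I p" p]
      unfolding rval_goal_exp[OF i1(1)] x1 tgt g by simp_all
    show "extends I lo hi \<kappa> p st ?st' \<and> arr ?st' (''x'' @ \<kappa>) (reg ?st' (''m'' @ \<kappa>)) = origin (other p) lo hi \<and>
       reg ?st' (''m'' @ \<kappa>) \<le> reg st (''m'' @ \<kappa>) + 2 * visits I p + 1 \<and>
       same_except (trip_arrays \<kappa>) (trip_regs \<kappa>) st ?st'"
    proof (intro conjI)
      show "extends I lo hi \<kappa> p st ?st'" by (rule extends_trans[OF _ E(1)]) (use J' in simp)
      show "same_except (trip_arrays \<kappa>) (trip_regs \<kappa>) st ?st'"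
        by (rule same_except_trans[OF _ same_except_mono[OF E(4)]]) (use J' in auto)
    qed (use E J' in simp_all)
  qed simp
  have "1 + (Suc (visits I p - 0) * (?B + 1) + ?E) \<le> leg_cost \<kappa> p * (num I + 1)"
  proof -
    have "Suc (visits I p) * (?B + 1) \<le> (num I + 1) * (?B + 1)"
      using visits_le_num[OF I, of p] by (intro mult_right_mono) auto
    then show ?thesis unfolding leg_cost_def by (simp add: algebra_simps)
  qed
  then show ?thesis
    unfolding leg_def by (intro halts_weaken[OF halts_Seq[OF init halts_Seq[OF loop fin]]])
qed

section \<open>The program for a round trip\<close>

definition trip_com :: "string \<Rightarrow> pad \<Rightarrow> com" where
  "trip_com \<kappa> p =
     Seq (Seq (SetReg (''m'' @ \<kappa>) (INum 0))
         (Seq (SetArr (''t'' @ \<kappa>) (INum 0) (RNum 0))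
              (SetArr (''x'' @ \<kappa>) (INum 0) (case p of P1 \<Rightarrow> scalar ''lo'' | P2 \<Rightarrow> scalar ''hi''))))
    (Seq (leg \<kappa> p) (leg \<kappa> (other p)))"

definition trip_cost :: "string \<Rightarrow> pad \<Rightarrow> nat" where
  "trip_cost \<kappa> p = 3 + leg_cost \<kappa> p + leg_cost \<kappa> (other p)"

lemma trip_com_correct:
  fixes \<kappa> :: string
  assumes I: "valid_instance I" and lh: "0 \<le> lo" "lo \<le> hi" "hi \<le> of_int (rail I)"
    and inp: "has_input I st" "clip_range st lo hi"
  shows "halts (trip_com \<kappa> p) st (trip_cost \<kappa> p * (num I + 1))
    (\<lambda>st'. (\<exists>k. trip I lo hi p k (reg st' (''m'' @ \<kappa>)) (arr st' (''t'' @ \<kappa>)) (arr st' (''x'' @ \<kappa>)) (arr st' (''a'' @ \<kappa>))) \<and>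
       reg st' (''m'' @ \<kappa>) \<le> 2 * num I + 2 \<and>
       same_except (trip_arrays \<kappa>) (trip_regs \<kappa>) st st')"
proof -
  let ?m = "\<lambda>st. reg st (''m'' @ \<kappa>)" and ?t = "\<lambda>st. arr st (''t'' @ \<kappa>)"
    and ?x = "\<lambda>st. arr st (''x'' @ \<kappa>)" and ?a = "\<lambda>st. arr st (''a'' @ \<kappa>)"
  let ?same = "same_except (trip_arrays \<kappa>) (trip_regs \<kappa>)"
  have keep: "has_input I st' \<and> clip_range st' lo hi" if "?same st st'" for st'
    using has_input_same[OF inp(1) that] clip_range_same[OF inp(2) that] by simp
  define R0 where "R0 st' \<longleftrightarrow> ?m st' = 0 \<and> ?t st' 0 = 0 \<and> ?x st' 0 = origin p lo hi \<and> ?same st st'" for st'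
  define R1 where "R1 st' \<longleftrightarrow> (\<exists>st0. R0 st0 \<and> extends I lo hi \<kappa> p st0 st' \<and>
      ?x st' (?m st') = origin (other p) lo hi \<and> ?m st' \<le> 2 * visits I p + 1 \<and> ?same st st')" for st'
  have oo: "other (other p) = p" by (cases p) auto
  have init: "halts (Seq (SetReg (''m'' @ \<kappa>) (INum 0))
         (Seq (SetArr (''t'' @ \<kappa>) (INum 0) (RNum 0))
              (SetArr (''x'' @ \<kappa>) (INum 0) (case p of P1 \<Rightarrow> scalar ''lo'' | P2 \<Rightarrow> scalar ''hi'')))) st 3 R0"
    using inp(2)
    by (intro halts_weaken[OF halts_exec[where Q = R0]])
      (cases p; auto simp: R0_def same_except_def clip_range_def)+
  have leg1: "halts (leg \<kappa> p) st0 (leg_cost \<kappa> p * (num I + 1)) R1" if R: "R0 st0" for st0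
  proof -
    note R' = R[unfolded R0_def]
    have same: "?same st st0" and x0: "?x st0 (?m st0) = origin p lo hi" using R' by simp_all
    from keep[OF same] have i0: "has_input I st0" "clip_range st0 lo hi" by simp_all
    show ?thesis
    proof (rule halts_weaken[OF leg_correct[OF I lh i0 x0] order_refl])
      fix st' assume A: "extends I lo hi \<kappa> p st0 st' \<and> ?x st' (?m st') = origin (other p) lo hi \<and>
         ?m st' \<le> ?m st0 + 2 * visits I p + 1 \<and> ?same st0 st'"
      then have "?same st st'" using same_except_trans[OF same] by blast
      then show "R1 st'" unfolding R1_def using A R R' by (intro exI[of _ st0]) simp
    qed
  qed
  have leg2: "halts (leg \<kappa> (other p)) st1 (leg_cost \<kappa> (other p) * (num I + 1))
    (\<lambda>st'. (\<exists>k. trip I lo hi p k (?m st') (?t st') (?x st') (?a st')) \<and>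
       ?m st' \<le> 2 * num I + 2 \<and> ?same st st')" if R: "R1 st1" for st1
  proof -
    from R obtain st0 where R0: "R0 st0" and e1: "extends I lo hi \<kappa> p st0 st1"
      and x1: "?x st1 (?m st1) = origin (other p) lo hi" and m1: "?m st1 \<le> 2 * visits I p + 1" and same: "?same st st1"
      unfolding R1_def by blast
    note R0' = R0[unfolded R0_def]
    from keep[OF same] have i1: "has_input I st1" "clip_range st1 lo hi" by simp_all
    show ?thesis
    proof (rule halts_weaken[OF leg_correct[OF I lh i1 x1] order_refl])
      fix st' assume A: "extends I lo hi \<kappa> (other p) st1 st' \<and>
         ?x st' (?m st') = origin (other (other p)) lo hi \<and>
         ?m st' \<le> ?m st1 + 2 * visits I (other p) + 1 \<and> ?same st1 st'"
      then have e2: "extends I lo hi \<kappa> (other p) st1 st'" by simp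
      note B = e1[unfolded extends_def] and C = e2[unfolded extends_def]
      \<comment> \<open>These pieces were written by the first leg, and the second leg only
        appends.\<close>
      have "stage I lo hi p (?t st') (?x st') (?a st') i" if "i < ?m st1" for i
      proof -
        have "stage I lo hi p (?t st1) (?x st1) (?a st1) i" using B R0' that by simp
        moreover have "stage I lo hi p (?t st') (?x st') (?a st') i = stage I lo hi p (?t st1) (?x st1) (?a st1) i"
          by (rule stage_cong) (use C that in auto)
        ultimately show ?thesis by simp
      qed
      moreover have "?t st' 0 = 0" "?x st' 0 = origin p lo hi" using B C R0' by simp_all
      moreover have "?x st' (?m st1) = origin (other p) lo hi" using C x1 by simp
      ultimately have "trip I lo hi p (?m st1) (?m st') (?t st') (?x st') (?a st')"
        unfolding trip_def using A C oo by simp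
      moreover have "visits I p + visits I (other p) = num I"
        using I by (cases p) (simp_all add: valid_instance_def)
      then have "?m st' \<le> 2 * num I + 2" using A m1 by simp
      moreover have "?same st st'" using A same_except_trans[OF same] by blast
      ultimately show "(\<exists>k. trip I lo hi p k (?m st') (?t st') (?x st') (?a st')) \<and>
         ?m st' \<le> 2 * num I + 2 \<and> ?same st st'" by blast
    qed
  qed
  have "3 + (leg_cost \<kappa> p * (num I + 1) + leg_cost \<kappa> (other p) * (num I + 1)) \<le> trip_cost \<kappa> p * (num I + 1)"
    unfolding trip_cost_def by (simp add: algebra_simps)
  then show ?thesis
    unfolding trip_com_def by (intro halts_weaken[OF halts_Seq[OF init halts_Seq[OF leg1 leg2]]])
qed

subsection \<open>Finding a balanced split\<close>

text \<open>For the full trip the last breakpoint is twice \<open>K0\<close>, so the program obtains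
  \<open>K0\<close> without computing \<open>Q1\<close>, \<open>Q2\<close> or the empty
  part.\<close>

lemma trip_total:
  assumes I: "valid_instance I" and T: "trip I lo hi p k m b y a"
    and lh: "0 \<le> lo" "lo \<le> hi" "hi \<le> of_int (rail I)" and q: "origin p lo hi = real q * of_int (rail I)"
  shows "b m = work I {lo..hi}"
proof -
  obtain H where "schedule_of I q H" "finish H = work I {lo..hi}" "length (actions H) = m"
    "\<And>j. j \<le> m \<Longrightarrow> breaks H ! j = b j \<and> pos H (breaks H ! j) = y j"
    by (rule trip_schedule[OF I T lh q]) (assumption | blast)+
  then show ?thesis using schedule_of_ends(2)[of I q H] by simp
qed

text \<open>
  The pointer \<open>i\<close> ascends through the rightward half of the full trip, \<open>j\<close> descends through its
  leftward half, and \<open>k\<close> is the index of the turning point. On the interval from \<open>z\<close> up to the nearer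
  of the next two nodes \<open>y (i + 1)\<close> and \<open>y (j - 1)\<close> the status of both pads is constant.
\<close>

definition cell :: "nat \<Rightarrow> nat \<Rightarrow> (nat \<Rightarrow> real) \<Rightarrow> nat \<Rightarrow> nat \<Rightarrow> real \<Rightarrow> bool" where
  "cell k m y i j z \<longleftrightarrow> i < k \<and> k < j \<and> j \<le> m \<and> y i \<le> z \<and> z \<le> y (Suc i) \<and> y j \<le> z \<and> z \<le> y (j - 1) \<and>
     (z = y i \<or> z = y j)"

text \<open>
  The action codes 1 and 2 mean travelling, 3 and 6 reclaiming.
\<close>

definition rate :: "real \<Rightarrow> (nat \<Rightarrow> real) \<Rightarrow> nat \<Rightarrow> nat \<Rightarrow> real" where
  "rate s a i j = (if a i < 2 then 1 / s else 1) + (if a (j - 1) < 3 then 1 / s else 1)"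

section \<open>Cells of the full trip\<close>

lemma K0_pos:
  assumes "valid_instance I" shows "0 < K0 I"
  using work_pos[OF assms, of 0 "of_int (rail I)"] rail_pos[OF assms] by (simp add: K0_def)

lemma rate_pos:
  assumes "s \<ge> 1" shows "0 < rate s a i j"
  using assms unfolding rate_def by (auto intro!: add_pos_pos)

context
  fixes I k m b y a
  assumes I: "valid_instance I" and T: "trip I 0 (of_int (rail I)) P1 k m b y a"
begin

lemma sweep_ends: "y 0 = 0" "y k = of_int (rail I)" "y m = 0" "k \<le> m"
  using T by (simp_all add: trip_def)

lemma sweep_stages:
  shows "i < k \<Longrightarrow> stage I 0 (of_int (rail I)) P1 b y a i"
    and "k \<le> i \<Longrightarrow> i < m \<Longrightarrow> stage I 0 (of_int (rail I)) P2 b y a i"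
  using T by (simp_all add: trip_def)

lemma sweep_up: "i < k \<Longrightarrow> y i < y (Suc i)"
  using stage_forward[OF I sweep_stages(1), of i] by simp

lemma sweep_down: "k \<le> i \<Longrightarrow> i < m \<Longrightarrow> y (Suc i) < y i"
  using stage_forward[OF I sweep_stages(2), of i] by simp

text \<open>On the way out only the codes 1 and 3 occur, on the way back only 2 and 6; hence the
  thresholds 2 here and 3 for the other half.\<close>

lemma sweep_segment_up:
  assumes "i < k"
  shows "(if a i < 2 then {y i<..<y (Suc i)} \<inter> stock I P1 = {} else {y i..y (Suc i)} \<subseteq> stock I P1)"
proof -
  have lt: "y i < y (Suc i)" by (rule sweep_up[OF assms])
  from sweep_stages(1)[OF assms] obtain act where act: "a i = action_code act"
    "act = Reclaim P1 Rightward \<and> closed_segment (y i) (y (Suc i)) \<subseteq> stock I P1 \<or>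
     act = Travel Rightward \<and> open_segment (y i) (y (Suc i)) \<inter> stock I P1 = {}"
    unfolding stage_def dir.simps by blast
  from act(2) show ?thesis
  proof (elim disjE conjE)
    assume "act = Reclaim P1 Rightward" "closed_segment (y i) (y (Suc i)) \<subseteq> stock I P1"
    then show ?thesis using act(1) lt by (simp add: closed_segment_eq_real_ivl)
  next
    assume "act = Travel Rightward" "open_segment (y i) (y (Suc i)) \<inter> stock I P1 = {}"
    then show ?thesis using act(1) lt by (simp add: open_segment_eq_real_ivl)
  qed
qed

lemma sweep_segment_down:
  assumes "k \<le> i" "i < m"
  shows "(if a i < 3 then {y (Suc i)<..<y i} \<inter> stock I P2 = {} else {y (Suc i)..y i} \<subseteq> stock I P2)"
proof -
  have lt: "y (Suc i) < y i" by (rule sweep_down[OF assms])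
  from sweep_stages(2)[OF assms] obtain act where act: "a i = action_code act"
    "act = Reclaim P2 Leftward \<and> closed_segment (y i) (y (Suc i)) \<subseteq> stock I P2 \<or>
     act = Travel Leftward \<and> open_segment (y i) (y (Suc i)) \<inter> stock I P2 = {}"
    unfolding stage_def dir.simps by blast
  from act(2) show ?thesis
  proof (elim disjE conjE)
    assume "act = Reclaim P2 Leftward" "closed_segment (y i) (y (Suc i)) \<subseteq> stock I P2"
    then show ?thesis using act(1) lt by (simp add: closed_segment_eq_real_ivl)
  next
    assume "act = Travel Leftward" "open_segment (y i) (y (Suc i)) \<inter> stock I P2 = {}"
    then show ?thesis using act(1) lt by (simp add: open_segment_eq_real_ivl)
  qed
qed

text \<open>Makes the borders of cells admissible as end points of a balanced split.\<close>

lemma sweep_nodes: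
  assumes "i \<le> m"
  shows "y i \<in> {0..of_int (rail I)}" "y i \<in> stock I P1 \<union> stock I P2 \<union> {0, of_int (rail I)}"
proof -
  have "y i \<in> {0..of_int (rail I)} \<and> y i \<in> stock I P1 \<union> stock I P2 \<union> {0, of_int (rail I)}"
  proof (cases i)
    case 0
    then show ?thesis using sweep_ends(1) rail_pos[OF I] by simp
  next
    case (Suc j)
    then have "stage I 0 (of_int (rail I)) P1 b y a j \<or> stage I 0 (of_int (rail I)) P2 b y a j"
      using sweep_stages[of j] assms by (cases "j < k") auto
    then show ?thesis unfolding stage_def Suc by blast
  qed
  then show "y i \<in> {0..of_int (rail I)}" "y i \<in> stock I P1 \<union> stock I P2 \<union> {0, of_int (rail I)}" by auto
qed

text \<open>Both halves contain a piece, since the turning point at \<open>L > 0\<close> differs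
  from the common start and end at 0.\<close>

lemma cell_start: "cell k m y 0 m 0"
proof -
  have L: "(0::real) < of_int (rail I)" using rail_pos[OF I] by simp
  have "y k \<noteq> y 0" "y k \<noteq> y m" unfolding sweep_ends using L by simp_all
  then have k: "k \<noteq> 0" and km: "k \<noteq> m" by (metis, metis)
  have "y 0 < y (Suc 0)" "y (Suc (m - 1)) < y (m - 1)"
    using sweep_up[of 0] sweep_down[of "m - 1"] k km sweep_ends(4) by simp_all
  then show ?thesis using k km sweep_ends unfolding cell_def by simp
qed

lemma cell_bounds:
  assumes "cell k m y i j z"
  shows "0 \<le> z" "z \<le> min (y (Suc i)) (y (j - 1))" "min (y (Suc i)) (y (j - 1)) \<le> of_int (rail I)"
  using assms sweep_nodes(1)[of i] sweep_nodes(1)[of "Suc i"] sweep_ends(4) unfolding cell_def by auto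

lemma cell_segments:
  assumes C: "cell k m y i j z" and w: "w \<le> min (y (Suc i)) (y (j - 1))"
  shows "if a i < 2 then {z<..<w} \<inter> stock I P1 = {} else {z..w} \<subseteq> stock I P1"
    "if a (j - 1) < 3 then {z<..<w} \<inter> stock I P2 = {} else {z..w} \<subseteq> stock I P2"
proof -
  note C' = C[unfolded cell_def]
  have "{z<..<w} \<subseteq> {y i<..<y (Suc i)}" "{z..w} \<subseteq> {y i..y (Suc i)}" using C' w by auto
  then show "if a i < 2 then {z<..<w} \<inter> stock I P1 = {} else {z..w} \<subseteq> stock I P1"
    using sweep_segment_up[of i] C' by (auto split: if_splits)
  \<comment> \<open>On the way back the cell lies between nodes \<open>j\<close> and
    \<open>j - 1\<close>, which are joined by piece \<open>j - 1\<close>.\<close>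
  have "Suc (j - 1) = j" "k \<le> j - 1" "j - 1 < m" using C' by auto
  note D = sweep_segment_down[OF this(2,3), unfolded this(1)]
  have "{z<..<w} \<subseteq> {y j<..<y (j - 1)}" "{z..w} \<subseteq> {y j..y (j - 1)}" using C' w by auto
  then show "if a (j - 1) < 3 then {z<..<w} \<inter> stock I P2 = {} else {z..w} \<subseteq> stock I P2"
    using D by (auto split: if_splits)
qed

text \<open>Both pads have constant status on a cell, so the work is affine there with slope
  \<open>rate\<close>.\<close>

lemma cell_work:
  assumes C: "cell k m y i j z" and w: "z \<le> w" "w \<le> min (y (Suc i)) (y (j - 1))"
  shows "work I {0..w} = work I {0..z} + (w - z) * rate (speed I) a i j"
proof -
  note B = cell_bounds[OF C] and S = cell_segments[OF C w(2)]
  have "ptime I P1 {z..w} = (w - z) * (if a i < 2 then 1 / speed I else 1)"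
    using S(1) ptime_inside[OF w(1)] ptime_outside[OF w(1)] by (auto split: if_splits)
  moreover have "ptime I P2 {z..w} = (w - z) * (if a (j - 1) < 3 then 1 / speed I else 1)"
    using S(2) ptime_inside[OF w(1)] ptime_outside[OF w(1)] by (auto split: if_splits)
  ultimately have "work I {z..w} = (w - z) * rate (speed I) a i j"
    using work_ivl[OF I B(1), of w] B(3) w(2) by (simp only: rate_def distrib_left)
  then show ?thesis using work_add[OF I, of 0 z w] B w by simp
qed

text \<open>Neither pointer can run past the turning point: the work up to the right border is below
  \<open>K0\<close>, so the border is not \<open>L\<close>. If both next nodes coincide, only
  \<open>i\<close> moves and the new cell has width 0, which \<open>cell\<close> permits.\<close>

lemma cell_next:
  assumes C: "cell k m y i j z" and lt: "work I {0..min (y (Suc i)) (y (j - 1))} < K0 I"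
  shows "y (j - 1) < y (Suc i) \<Longrightarrow> cell k m y i (j - 1) (y (j - 1))"
    and "\<not> y (j - 1) < y (Suc i) \<Longrightarrow> cell k m y (Suc i) j (y (Suc i))"
proof -
  note C' = C[unfolded cell_def]
  let ?L = "of_int (rail I) :: real"
  have "min (y (Suc i)) (y (j - 1)) \<noteq> ?L"
  proof
    assume "min (y (Suc i)) (y (j - 1)) = ?L"
    then show False using lt K0_pos[OF I] by (simp add: K0_def)
  qed
  then have ltL: "min (y (Suc i)) (y (j - 1)) < ?L" using cell_bounds(3)[OF C] by simp
  show "cell k m y i (j - 1) (y (j - 1))" if "y (j - 1) < y (Suc i)"
  proof -
    have "j - 1 \<noteq> k" using ltL that sweep_ends(2) by auto
    moreover have "k < j" using C' by simp
    ultimately have j: "k < j - 1" by arith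
    moreover have "j \<le> m" using C' by simp
    ultimately have "k \<le> j - 1 - 1" "j - 1 - 1 < m" "Suc (j - 1 - 1) = j - 1" by arith+
    then have "y (j - 1) \<le> y (j - 1 - 1)" using sweep_down[of "j - 1 - 1"] by simp
    then show ?thesis using C' that j unfolding cell_def by auto
  qed
  show "cell k m y (Suc i) j (y (Suc i))" if "\<not> y (j - 1) < y (Suc i)"
  proof -
    have "Suc i \<noteq> k" using ltL that sweep_ends(2) by auto
    then have i: "Suc i < k" using C' by simp
    then show ?thesis using C' that sweep_up[OF i] unfolding cell_def by auto
  qed
qed

text \<open>\<open>x\<close> is the solution of an affine equation, the point of the cell where the
  work equals \<open>K0\<close>. If some pad is reclaimed in the cell, \<open>x\<close> is in the
  stock; if none is, the cell is a gap and its borders form the split.\<close>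

lemma cell_split:
  assumes C: "cell k m y i j z" and K: "work I {0..z} \<le> K0 I" "K0 I \<le> work I {0..min (y (Suc i)) (y (j - 1))}"
  defines "x \<equiv> z + (K0 I - work I {0..z}) / rate (speed I) a i j"
  shows "a i < 2 \<Longrightarrow> a (j - 1) < 3 \<Longrightarrow> balanced_split I z (min (y (Suc i)) (y (j - 1)))"
    and "\<not> (a i < 2 \<and> a (j - 1) < 3) \<Longrightarrow> balanced_split I x x"
proof -
  note C' = C[unfolded cell_def] and B = cell_bounds[OF C]
  let ?e = "min (y (Suc i)) (y (j - 1))" and ?r = "rate (speed I) a i j"
  show "balanced_split I z ?e" if "a i < 2" "a (j - 1) < 3"
  proof -
    have "{z<..<?e} \<inter> stock I p = {}" for p
      using cell_segments[OF C order_refl] that by (cases p) auto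
    moreover have "z \<in> stock I P1 \<union> stock I P2 \<union> {0, of_int (rail I)}"
      using C' sweep_nodes(2)[of i] sweep_nodes(2)[of j] by auto
    moreover have "?e \<in> stock I P1 \<union> stock I P2 \<union> {0, of_int (rail I)}"
      using C' sweep_nodes(2)[of "Suc i"] sweep_nodes(2)[of "j - 1"] unfolding min_def by auto
    ultimately show ?thesis using B K unfolding balanced_split_def by blast
  qed
  have x: "z \<le> x" using K(1) rate_pos[OF speed_ge_1[OF I], of a i j] by (simp add: x_def)
  have "work I {0..?e} = work I {0..z} + (?e - z) * ?r" by (rule cell_work[OF C B(2) order_refl])
  then have "(K0 I - work I {0..z}) / ?r \<le> ?e - z"
    using K(2) rate_pos[OF speed_ge_1[OF I], of a i j] by (simp add: pos_divide_le_eq)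
  then have xe: "x \<le> ?e" unfolding x_def by linarith
  have wx: "work I {0..x} = K0 I"
    using cell_work[OF C x xe] rate_pos[OF speed_ge_1[OF I], of a i j] by (simp add: x_def)
  show "balanced_split I x x" if "\<not> (a i < 2 \<and> a (j - 1) < 3)"
  proof -
    have "x \<in> stock I P1 \<union> stock I P2"
      using cell_segments[OF C order_refl] that x xe by (auto split: if_splits)
    then show ?thesis using B x xe wx unfolding balanced_split_def by auto
  qed
qed

end

section \<open>The sweep program\<close>

definition look_ahead :: com where
  "look_ahead =
     Seq (If (RLess (Arr ''a0'' (Reg ''p'')) (RNum 2))
            (SetArr ''hp'' (INum 0) (RDivide (RNum 1) (scalar ''s''))) (SetArr ''hp'' (INum 0) (RNum 1)))
    (Seq (If (RLess (Arr ''a0'' (IMinus (Reg ''q'') (INum 1))) (RNum 3))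
            (SetArr ''hq'' (INum 0) (RDivide (RNum 1) (scalar ''s''))) (SetArr ''hq'' (INum 0) (RNum 1)))
    (Seq (If (RLess (Arr ''x0'' (IMinus (Reg ''q'') (INum 1))) (Arr ''x0'' (IPlus (Reg ''p'') (INum 1))))
            (SetArr ''e'' (INum 0) (Arr ''x0'' (IMinus (Reg ''q'') (INum 1))))
            (SetArr ''e'' (INum 0) (Arr ''x0'' (IPlus (Reg ''p'') (INum 1)))))
         (SetArr ''f'' (INum 0) (RPlus (scalar ''g'')
            (RTimes (RMinus (scalar ''e'') (scalar ''z'')) (RPlus (scalar ''hp'') (scalar ''hq'')))))))"

definition sweep_start :: com where
  "sweep_start =
     Seq (SetArr ''K'' (INum 0) (RDivide (Arr ''t0'' (Reg ''m0'')) (RNum 2)))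
    (Seq (SetReg ''p'' (INum 0)) (Seq (SetReg ''q'' (Reg ''m0''))
    (Seq (SetArr ''z'' (INum 0) (RNum 0)) (Seq (SetArr ''g'' (INum 0) (RNum 0)) look_ahead))))"

definition sweep_body :: com where
  "sweep_body =
     Seq (If (RLess (Arr ''x0'' (IMinus (Reg ''q'') (INum 1))) (Arr ''x0'' (IPlus (Reg ''p'') (INum 1))))
            (SetReg ''q'' (IMinus (Reg ''q'') (INum 1))) (SetReg ''p'' (IPlus (Reg ''p'') (INum 1))))
    (Seq (SetArr ''z'' (INum 0) (scalar ''e'')) (Seq (SetArr ''g'' (INum 0) (scalar ''f'')) look_ahead))"

definition sweep_finish :: com where
  "sweep_finish =
     If (Conj (RLess (Arr ''a0'' (Reg ''p'')) (RNum 2)) (RLess (Arr ''a0'' (IMinus (Reg ''q'') (INum 1))) (RNum 3)))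
       (Seq (SetArr ''u'' (INum 0) (scalar ''z'')) (SetArr ''v'' (INum 0) (scalar ''e'')))
       (Seq (SetArr ''u'' (INum 0) (RPlus (scalar ''z'')
              (RDivide (RMinus (scalar ''K'') (scalar ''g'')) (RPlus (scalar ''hp'') (scalar ''hq'')))))
            (SetArr ''v'' (INum 0) (scalar ''u'')))"

definition sweep :: com where
  "sweep = Seq sweep_start
     (Seq (While (RLess (scalar ''f'') (scalar ''K'')) sweep_body) sweep_finish)"

abbreviation sweep_arrays :: "string set" where
  "sweep_arrays \<equiv> {''hp'', ''hq'', ''e'', ''f'', ''K'', ''z'', ''g'', ''u'', ''v''}"

text \<open>\<open>look_ahead\<close> prepares the current cell: \<open>hp\<close> plus
  \<open>hq\<close> is its rate, \<open>e\<close> its right border and \<open>f\<close> the work up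
  to \<open>e\<close>. The guard of the sweep is thus a single comparison of \<open>f\<close> with
  \<open>K\<close>.\<close>

lemma look_ahead_correct:
  fixes st :: state
  defines "st' \<equiv> exec look_ahead st"
  shows "arr st' ''hp'' 0 + arr st' ''hq'' 0 = rate (arr st ''s'' 0) (arr st ''a0'') (reg st ''p'') (reg st ''q'')"
    "arr st' ''e'' 0 = min (arr st ''x0'' (Suc (reg st ''p''))) (arr st ''x0'' (reg st ''q'' - 1))"
    "arr st' ''f'' 0 = arr st ''g'' 0 + (arr st' ''e'' 0 - arr st ''z'' 0) * (arr st' ''hp'' 0 + arr st' ''hq'' 0)"
    "arr st' ''K'' = arr st ''K''" "arr st' ''z'' = arr st ''z''" "arr st' ''g'' = arr st ''g''"
    "reg st' = reg st" "same_except sweep_arrays {''p'', ''q''} st st'"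
  unfolding st'_def look_ahead_def by (simp_all add: rate_def same_except_def min_def)

text \<open>The factor 3 comes from at most \<open>m + 1\<close> evaluations of the guard, with
  \<open>m + 1 \<le> 2 * num I + 3 \<le> 3 * (num I + 1)\<close>.\<close>

definition sweep_cost :: nat where
  "sweep_cost = com_size sweep_start + 3 * (com_size sweep_body + 1) + com_size sweep_finish"

lemma sweep_correct:
  assumes I: "valid_instance I" and inp: "has_input I st"
    and T: "trip I 0 (of_int (rail I)) P1 k (reg st ''m0'') (arr st ''t0'') (arr st ''x0'') (arr st ''a0'')"
    and m: "reg st ''m0'' \<le> 2 * num I + 2"
  shows "halts sweep st (sweep_cost * (num I + 1))
    (\<lambda>st'. balanced_split I (arr st' ''u'' 0) (arr st' ''v'' 0) \<and> same_except sweep_arrays {''p'', ''q''} st st')"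
proof -
  let ?L = "of_int (rail I) :: real"
  define m where "m = reg st ''m0''"
  define y where "y = arr st ''x0''"
  define a where "a = arr st ''a0''"
  note T' = T[folded m_def y_def a_def]
  have s: "arr st ''s'' 0 = speed I" using inp by (simp add: has_input_def)
  let ?same = "same_except sweep_arrays {''p'', ''q''}"
  \<comment> \<open>\<open>n\<close> counts the moves of both pointers. It stays below
    \<open>m\<close> because the pointers remain on opposite sides of \<open>k\<close>.\<close>
  define Inv where "Inv n st' \<longleftrightarrow> ?same st st' \<and>
     cell k m y (reg st' ''p'') (reg st' ''q'') (arr st' ''z'' 0) \<and> n = reg st' ''p'' + (m - reg st' ''q'') \<and>
     arr st' ''K'' 0 = K0 I \<and> arr st' ''g'' 0 = work I {0..arr st' ''z'' 0} \<and> arr st' ''g'' 0 \<le> K0 I \<and>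
     arr st' ''hp'' 0 + arr st' ''hq'' 0 = rate (speed I) a (reg st' ''p'') (reg st' ''q'') \<and>
     arr st' ''e'' 0 = min (y (Suc (reg st' ''p''))) (y (reg st' ''q'' - 1)) \<and>
     arr st' ''f'' 0 = work I {0..arr st' ''e'' 0}" for n st'
  have ahead: "Inv n (exec look_ahead st')"
    if "?same st st'" "cell k m y (reg st' ''p'') (reg st' ''q'') (arr st' ''z'' 0)"
      "n = reg st' ''p'' + (m - reg st' ''q'')"
      "arr st' ''K'' 0 = K0 I" "arr st' ''g'' 0 = work I {0..arr st' ''z'' 0}" "arr st' ''g'' 0 \<le> K0 I" for n st'
  proof -
    have keep: "arr st' ''s'' 0 = speed I" "arr st' ''a0'' = a" "arr st' ''x0'' = y"
      using that(1) s unfolding same_except_def a_def y_def by simp_all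
    note A = look_ahead_correct[of st', unfolded keep]
    have "?same st (exec look_ahead st')" by (rule same_except_trans[OF that(1) A(8)])
    then show ?thesis unfolding Inv_def
      using A(1-7) that(2-) cell_bounds(2)[OF I T' that(2)] cell_work[OF I T' that(2) _ order_refl] by simp
  qed
  have w00: "work I {0..0} = 0" using work_add[OF I, of 0 0 0] rail_pos[OF I] by simp
  have start: "halts sweep_start st (com_size sweep_start) (Inv 0)"
  proof (rule halts_exec)
    show "loop_free sweep_start" by (simp add: sweep_start_def look_ahead_def)
    have L: "(0::real) \<le> ?L" using rail_pos[OF I] by simp
    have tot: "arr st ''t0'' m = work I {0..?L}"
      by (rule trip_total[OF I T' order_refl L order_refl, of 0]) simp
    show "Inv 0 (exec sweep_start st)"
      unfolding sweep_start_def exec.simps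
      by (rule ahead)
        (use cell_start[OF I T'] tot w00 less_imp_le[OF K0_pos[OF I]] in \<open>simp_all add: same_except_def m_def[symmetric] K0_def\<close>)
  qed
  have lf: "loop_free sweep_body" by (simp add: sweep_body_def look_ahead_def)
  let ?b = "RLess (scalar ''f'') (scalar ''K'')"
  have loop: "halts (While ?b sweep_body) st1 (Suc (m - 0) * (com_size sweep_body + 1))
      (\<lambda>st'. (\<exists>n. Inv n st') \<and> \<not> bval ?b st')" if st1: "Inv 0 st1" for st1
  proof (rule halts_While[OF lf, where Inv = Inv and k = 0, OF st1])
    fix n st' assume J: "Inv n st'" and bv: "bval ?b st'"
    note J' = J[unfolded Inv_def]
    let ?i = "reg st' ''p''" and ?j = "reg st' ''q''"
    have C: "cell k m y ?i ?j (arr st' ''z'' 0)" using J' by simp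
    have lt: "work I {0..min (y (Suc ?i)) (y (?j - 1))} < K0 I" using J' bv by simp
    note N = cell_next[OF I T' C lt]
    have ij: "?i < k" "k < ?j" "?j \<le> m" using C unfolding cell_def by simp_all
    have x0: "arr st' ''x0'' = y" using J' unfolding same_except_def y_def by simp
    have "Inv (Suc n) (exec sweep_body st')"
    proof (cases "y (?j - 1) < y (Suc ?i)")
      case True
      have e: "arr st' ''e'' 0 = y (?j - 1)" using J' True by simp
      show ?thesis unfolding sweep_body_def exec.simps
        by (rule ahead) (use True x0 e J' N(1)[OF True] ij lt in \<open>auto simp: same_except_def\<close>)
    next
      case False
      have e: "arr st' ''e'' 0 = y (Suc ?i)" using J' False by simp
      show ?thesis unfolding sweep_body_def exec.simps
        by (rule ahead) (use False x0 e J' N(2)[OF False] ij lt in \<open>auto simp: same_except_def\<close>)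
    qed
    moreover have "n < m" using J' ij by simp
    ultimately show "n < m \<and> Inv (Suc n) (exec sweep_body st')" by simp
  qed
  have fin: "halts sweep_finish st1 (com_size sweep_finish)
      (\<lambda>st'. balanced_split I (arr st' ''u'' 0) (arr st' ''v'' 0) \<and> ?same st st')"
    if st1: "(\<exists>n. Inv n st1) \<and> \<not> bval ?b st1" for st1
  proof (rule halts_exec)
    show "loop_free sweep_finish" by (simp add: sweep_finish_def)
    obtain n where J: "Inv n st1" using st1 by blast
    note J' = J[unfolded Inv_def]
    let ?i = "reg st1 ''p''" and ?j = "reg st1 ''q''"
    have C: "cell k m y ?i ?j (arr st1 ''z'' 0)" using J' by simp
    have K: "work I {0..arr st1 ''z'' 0} \<le> K0 I" "K0 I \<le> work I {0..min (y (Suc ?i)) (y (?j - 1))}"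
      using J' st1 by simp_all
    have a0: "arr st1 ''a0'' = a" using J' unfolding same_except_def a_def by simp
    note D = cell_split[OF I T' C K]
    have "?same st1 (exec sweep_finish st1)" by (simp add: sweep_finish_def same_except_def)
    then have same: "?same st (exec sweep_finish st1)" using same_except_trans J' by blast
    have "balanced_split I (arr (exec sweep_finish st1) ''u'' 0) (arr (exec sweep_finish st1) ''v'' 0)"
    proof (cases "a ?i < 2 \<and> a (?j - 1) < 3")
      case True
      then show ?thesis using D(1) a0 J' by (simp add: sweep_finish_def)
    next
      case False
      then show ?thesis using D(2)[OF False] a0 J' by (auto simp: sweep_finish_def)
    qed
    with same show "balanced_split I (arr (exec sweep_finish st1) ''u'' 0) (arr (exec sweep_finish st1) ''v'' 0) \<and>
        ?same st (exec sweep_finish st1)" by simp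
  qed
  have "com_size sweep_start + (Suc (m - 0) * (com_size sweep_body + 1) + com_size sweep_finish)
      \<le> sweep_cost * (num I + 1)"
  proof -
    have "Suc m * (com_size sweep_body + 1) \<le> (3 * (num I + 1)) * (com_size sweep_body + 1)"
      using assms(4) unfolding m_def by (intro mult_right_mono) auto
    then show ?thesis unfolding sweep_cost_def by (simp add: algebra_simps)
  qed
  then show ?thesis
    unfolding sweep_def by (intro halts_weaken[OF halts_Seq[OF start halts_Seq[OF loop fin]]])
qed

section \<open>The complete program\<close>

definition set_range :: "rexp \<Rightarrow> rexp \<Rightarrow> com" where
  "set_range e f = Seq (SetArr ''lo'' (INum 0) e) (SetArr ''hi'' (INum 0) f)"

text \<open>The trip over the whole rail only feeds the sweep; the trip on \<open>[0, u]\<close>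
  then overwrites its arrays.\<close>

definition optimal_com :: com where
  "optimal_com =
     Seq (set_range (RNum 0) (scalar ''L'')) (Seq (trip_com ''0'' P1) (Seq sweep
    (Seq (set_range (RNum 0) (scalar ''u'')) (Seq (trip_com ''0'' P1)
    (Seq (set_range (scalar ''v'') (scalar ''L'')) (trip_com ''1'' P2))))))"

definition optimal_cost :: nat where
  "optimal_cost = 6 + 2 * trip_cost ''0'' P1 + sweep_cost + trip_cost ''1'' P2"

text \<open>\<open>f\<close> is evaluated after \<open>lo\<close> has been written, hence the
  updated state in its assumption.\<close>

lemma set_range_correct:
  assumes "has_input I st" "rval e st = lo" "rval f (st\<lparr>arr := (arr st)(''lo'' := (arr st ''lo'')(0 := lo))\<rparr>) = hi"
  shows "halts (set_range e f) st 2
    (\<lambda>st'. has_input I st' \<and> clip_range st' lo hi \<and> same_except {''lo'', ''hi''} {} st st')"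
proof (rule halts_weaken[OF halts_exec])
  let ?P = "\<lambda>st'. has_input I st' \<and> clip_range st' lo hi \<and> same_except {''lo'', ''hi''} {} st st'"
  have same: "same_except {''lo'', ''hi''} {} st (exec (set_range e f) st)"
    by (simp add: set_range_def same_except_def)
  moreover have "clip_range (exec (set_range e f) st) lo hi"
    using assms(2,3) by (simp add: set_range_def clip_range_def)
  moreover have "has_input I (exec (set_range e f) st)"
    by (rule has_input_same[OF assms(1) same]) simp_all
  ultimately show "?P (exec (set_range e f) st)" by simp
qed (simp_all add: set_range_def)

lemma outputs_trip:
  assumes "length (actions H) = m" "reg st \<mu> = m"
    "\<And>j. j \<le> m \<Longrightarrow> breaks H ! j = arr st \<tau> j \<and> pos H (breaks H ! j) = arr st \<xi> j"
    "\<And>j. j < m \<Longrightarrow> action_code (actions H ! j) = arr st \<alpha> j"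
  shows "outputs st \<mu> \<tau> \<xi> \<alpha> H"
  unfolding outputs_def assms(1,2)
proof (intro conjI allI impI)
  show "arr st \<tau> j = breaks H ! j" if "j \<le> m" for j using assms(3)[OF that] by (elim conjE) (rule sym)
  show "arr st \<xi> j = pos H (breaks H ! j)" if "j \<le> m" for j using assms(3)[OF that] by (elim conjE) (rule sym)
  show "arr st \<alpha> j = action_code (actions H ! j)" if "j < m" for j using assms(4)[OF that] by (rule sym)
qed (rule refl)

lemma optimal_com_correct:
  assumes I: "valid_instance I"
  shows "halts optimal_com (input_state I) (optimal_cost * (num I + 1))
    (\<lambda>st. \<exists>H. outputs_schedule st H \<and> optimal I H \<and> makespan H = K_star I)"
proof -
  let ?L = "of_int (rail I) :: real" and ?n = "num I + 1"
  have L: "0 \<le> ?L" using rail_pos[OF I] by simp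
  define S1 where "S1 st \<longleftrightarrow> has_input I st \<and> clip_range st 0 ?L" for st
  define tr where "tr \<kappa> p lo hi st \<longleftrightarrow> (\<exists>k. trip I lo hi p k (reg st (''m'' @ \<kappa>)) (arr st (''t'' @ \<kappa>))
     (arr st (''x'' @ \<kappa>)) (arr st (''a'' @ \<kappa>)))" for \<kappa> :: string and p lo hi and st :: state
  define S2 where "S2 st \<longleftrightarrow> has_input I st \<and> tr ''0'' P1 0 ?L st \<and> reg st ''m0'' \<le> 2 * num I + 2" for st
  \<comment> \<open>Once copied to \<open>hi\<close>, the number \<open>u\<close> is remembered only
    logically, whereas \<open>v\<close> must survive the next trip in its cell.\<close>
  define uv where "uv u v st \<longleftrightarrow> has_input I st \<and> balanced_split I u v \<and> arr st ''v'' 0 = v" for u v st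
  define S3 where "S3 st \<longleftrightarrow> has_input I st \<and> balanced_split I (arr st ''u'' 0) (arr st ''v'' 0)" for st
  define S4 where "S4 st \<longleftrightarrow> (\<exists>u v. uv u v st \<and> clip_range st 0 u)" for st
  define S5 where "S5 st \<longleftrightarrow> (\<exists>u v. uv u v st \<and> tr ''0'' P1 0 u st)" for st
  define S6 where "S6 st \<longleftrightarrow> (\<exists>u v. uv u v st \<and> tr ''0'' P1 0 u st \<and> clip_range st v ?L)" for st
  have h1: "halts (set_range (RNum 0) (scalar ''L'')) (input_state I) 2 S1"
    by (rule halts_weaken[OF set_range_correct[where lo = 0 and hi = ?L, OF has_input_input_state]])
      (simp_all add: S1_def input_state_def)
  have h2: "halts (trip_com ''0'' P1) st (trip_cost ''0'' P1 * ?n) S2" if "S1 st" for st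
  proof -
    have i: "has_input I st" "clip_range st 0 ?L" using that by (simp_all add: S1_def)
    show ?thesis
    proof (rule halts_weaken[OF trip_com_correct[OF I order_refl L order_refl i] order_refl], elim conjE)
      fix st' assume A: "same_except (trip_arrays ''0'') (trip_regs ''0'') st st'"
        "\<exists>k. trip I 0 ?L P1 k (reg st' (''m'' @ ''0'')) (arr st' (''t'' @ ''0''))
          (arr st' (''x'' @ ''0'')) (arr st' (''a'' @ ''0''))" "reg st' (''m'' @ ''0'') \<le> 2 * num I + 2"
      then show "S2 st'" using has_input_same[OF i(1) A(1)] unfolding S2_def tr_def by simp
    qed
  qed
  have h3: "halts sweep st (sweep_cost * ?n) S3" if S2: "S2 st" for st
  proof -
    have i: "has_input I st" "reg st ''m0'' \<le> 2 * num I + 2" using S2 by (simp_all add: S2_def)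
    from S2 obtain k where t: "trip I 0 ?L P1 k (reg st ''m0'') (arr st ''t0'') (arr st ''x0'') (arr st ''a0'')"
      by (auto simp: S2_def tr_def)
    show ?thesis
    proof (rule halts_weaken[OF sweep_correct[OF I i(1) t i(2)] order_refl], elim conjE)
      fix st' assume A: "balanced_split I (arr st' ''u'' 0) (arr st' ''v'' 0)" "same_except sweep_arrays {''p'', ''q''} st st'"
      then show "S3 st'" using has_input_same[OF i(1) A(2)] unfolding S3_def by simp
    qed
  qed
  have h4: "halts (set_range (RNum 0) (scalar ''u'')) st 2 S4" if S3: "S3 st" for st
  proof -
    have i: "has_input I st" "balanced_split I (arr st ''u'' 0) (arr st ''v'' 0)" using S3 by (simp_all add: S3_def)
    show ?thesis
    proof (rule halts_weaken[OF set_range_correct[where lo = 0 and hi = "arr st ''u'' 0", OF i(1)] order_refl])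
      fix st' assume A: "has_input I st' \<and> clip_range st' 0 (arr st ''u'' 0) \<and> same_except {''lo'', ''hi''} {} st st'"
      then have "arr st' ''v'' 0 = arr st ''v'' 0" by (simp add: same_except_def)
      then show "S4 st'" using A i(2) unfolding S4_def uv_def by blast
    qed simp_all
  qed
  have h5: "halts (trip_com ''0'' P1) st (trip_cost ''0'' P1 * ?n) S5" if S4: "S4 st" for st
  proof -
    from S4 obtain u v where i: "has_input I st" "clip_range st 0 u" and s: "balanced_split I u v" "arr st ''v'' 0 = v"
      by (auto simp: S4_def uv_def)
    have u: "0 \<le> u" "u \<le> ?L" using s(1) by (simp_all add: balanced_split_def)
    show ?thesis
    proof (rule halts_weaken[OF trip_com_correct[OF I order_refl u i] order_refl], elim conjE)
      fix st' assume A: "same_except (trip_arrays ''0'') (trip_regs ''0'') st st'"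
        "\<exists>k. trip I 0 u P1 k (reg st' (''m'' @ ''0'')) (arr st' (''t'' @ ''0''))
          (arr st' (''x'' @ ''0'')) (arr st' (''a'' @ ''0''))"
      have "arr st' ''v'' 0 = v" using A(1) s(2) by (simp add: same_except_def)
      moreover have "has_input I st'" by (rule has_input_same[OF i(1) A(1)]) simp_all
      ultimately have "uv u v st'" using s(1) by (simp add: uv_def)
      moreover have "tr ''0'' P1 0 u st'" using A(2) unfolding tr_def .
      ultimately show "S5 st'" unfolding S5_def by blast
    qed
  qed
  have h6: "halts (set_range (scalar ''v'') (scalar ''L'')) st 2 S6" if S5: "S5 st" for st
  proof -
    from S5 obtain u v where i: "has_input I st" and t: "tr ''0'' P1 0 u st" and s: "balanced_split I u v" "arr st ''v'' 0 = v"
      by (auto simp: S5_def uv_def)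
    show ?thesis
    proof (rule halts_weaken[OF set_range_correct[where lo = v and hi = ?L, OF i] order_refl])
      fix st' assume A: "has_input I st' \<and> clip_range st' v ?L \<and> same_except {''lo'', ''hi''} {} st st'"
      then have "arr st' ''v'' 0 = v" "tr ''0'' P1 0 u st'"
        using s(2) t by (simp_all add: same_except_def tr_def)
      then show "S6 st'" using A s(1) unfolding S6_def uv_def by blast
    qed (use s(2) i in \<open>simp_all add: has_input_def\<close>)
  qed
  have h7: "halts (trip_com ''1'' P2) st (trip_cost ''1'' P2 * ?n)
      (\<lambda>st. \<exists>H. outputs_schedule st H \<and> optimal I H \<and> makespan H = K_star I)" if S6: "S6 st" for st
  proof -
    from S6 obtain u v where i: "has_input I st" "clip_range st v ?L" and t: "tr ''0'' P1 0 u st" and s: "balanced_split I u v"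
      by (auto simp: S6_def uv_def)
    have v: "0 \<le> v" "v \<le> ?L" using s by (simp_all add: balanced_split_def)
    show ?thesis
    proof (rule halts_weaken[OF trip_com_correct[OF I v order_refl i] order_refl], elim conjE exE)
      fix st' k1 assume A: "same_except (trip_arrays ''1'') (trip_regs ''1'') st st'"
        and T1: "trip I v ?L P2 k1 (reg st' (''m'' @ ''1'')) (arr st' (''t'' @ ''1''))
          (arr st' (''x'' @ ''1'')) (arr st' (''a'' @ ''1''))"
      \<comment> \<open>The last trip writes only to names with suffix 1 and to scratch variables,
        so the output for the left reclaimer is intact.\<close>
      have "tr ''0'' P1 0 u st'" using t A by (simp add: tr_def same_except_def)
      then obtain k0 where T0: "trip I 0 u P1 k0 (reg st' (''m'' @ ''0'')) (arr st' (''t'' @ ''0''))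
          (arr st' (''x'' @ ''0'')) (arr st' (''a'' @ ''0''))" unfolding tr_def by blast
      show "\<exists>H. outputs_schedule st' H \<and> optimal I H \<and> makespan H = K_star I"
      proof (rule trips_optimal[OF I s T0 T1])
        fix H0 H1
        assume "optimal I (H0, H1)" "makespan (H0, H1) = K_star I"
          and l: "length (actions H0) = reg st' (''m'' @ ''0'')" "length (actions H1) = reg st' (''m'' @ ''1'')"
          and b0: "\<And>j. j \<le> reg st' (''m'' @ ''0'') \<Longrightarrow>
             breaks H0 ! j = arr st' (''t'' @ ''0'') j \<and> pos H0 (breaks H0 ! j) = arr st' (''x'' @ ''0'') j"
          and a0: "\<And>j. j < reg st' (''m'' @ ''0'') \<Longrightarrow> action_code (actions H0 ! j) = arr st' (''a'' @ ''0'') j"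
          and b1: "\<And>j. j \<le> reg st' (''m'' @ ''1'') \<Longrightarrow>
             breaks H1 ! j = arr st' (''t'' @ ''1'') j \<and> pos H1 (breaks H1 ! j) = arr st' (''x'' @ ''1'') j"
          and a1: "\<And>j. j < reg st' (''m'' @ ''1'') \<Longrightarrow> action_code (actions H1 ! j) = arr st' (''a'' @ ''1'') j"
        moreover have "outputs_schedule st' (H0, H1)"
          using outputs_trip[OF l(1) refl b0 a0] outputs_trip[OF l(2) refl b1 a1] by simp
        ultimately show ?thesis by blast
      qed
    qed
  qed
  have "2 + (trip_cost ''0'' P1 * ?n + (sweep_cost * ?n + (2 + (trip_cost ''0'' P1 * ?n +
      (2 + trip_cost ''1'' P2 * ?n))))) \<le> optimal_cost * ?n"
    unfolding optimal_cost_def by (simp add: algebra_simps)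
  then show ?thesis
    unfolding optimal_com_def
    by (intro halts_weaken[OF halts_Seq[OF h1 halts_Seq[OF h2 halts_Seq[OF h3 halts_Seq[OF h4
      halts_Seq[OF h5 halts_Seq[OF h6 h7]]]]]]])
qed

theorem theorem3:
  shows "(\<forall>I. valid_instance I \<longrightarrow> (\<exists>H. optimal I H \<and> makespan H = K_star I)) \<and>
         (\<exists>prog. computes_optimal_in_linear_time prog)"
proof
  show "\<forall>I. valid_instance I \<longrightarrow> (\<exists>H. optimal I H \<and> makespan H = K_star I)"
    \<comment> \<open>Even the existence of an optimal schedule is read off from the final state of
      the program.\<close>
    using optimal_com_correct unfolding halts_def by blast
  have "computes_optimal_in_linear_time optimal_com"
    unfolding computes_optimal_in_linear_time_def
    using optimal_com_correct unfolding halts_def by blast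
  then show "\<exists>prog. computes_optimal_in_linear_time prog" ..
qed

end
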